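(* Let $\mathcal C$ be a topologically closed class of finite graphs. The following are equivalent: (1) $\mathcal C$ has bounded expansion; (2) $\mathcal C$ has all restricted dualities; (3) for every odd integer $g$ there exists a graph $H_g$ with odd-girth greater than $g$ such that every graph $G\in\mathcal C$ with odd-girth greater than $g$ has a homomorphism to $H_g$.
   Context: Graphs are finite, simple and undirected. $\mathcal C$ is topologically closed if every subdivision of a graph in $\mathcal C$ is in $\mathcal C$. A $\le k$-subdivision of $H$ replaces each edge of $H$ by a path of length at most $k+1$; for a half-integer $p$, $H$ is a shallow topological minor of $G$ at depth $p$ if some $\le 2p$-subdivision of $H$ is a subgraph of $G$. $\mathcal C$ has bounded expansion if for every integer $p$ the average degrees of the shallow minors at depth $p$ of graphs in $\mathcal C$ are bounded (equivalently, the average degrees of shallow topological minors at depth $p$ of graphs in $\mathcal C$ are bounded). $\mathcal C$ has all restricted dualities if for every non-empty connected graph $F$ there is a graph $D$ with $F\nrightarrow D$ such that for every $G\in\mathcal C$: $F\to G$ if and only if $G\nrightarrow D$ ($\to$ denotes existence of a homomorphism). The odd-girth of a graph is the length of its shortest odd cycle. *)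

theory Defs
  imports "Graph_Theory.Graph_Theory" "HOL-Library.Extended_Nat" "HOL-Library.Disjoint_Sets"
    Complex_Main
begin

text \<open>
  A finite simple undirected graph is a \<^locale>\<open>pair_graph\<close>: a finite vertex set with a finite,
  symmetric, irreflexive set of arcs, each edge being the pair of its two orientations. The graph
  without vertices is included (it is needed as the dual of the one-vertex graph). Every finite
  graph has an isomorphic copy with vertices in \<^typ>\<open>nat\<close>, so classes of finite graphs are sets of
  graphs over \<^typ>\<open>nat\<close>.
\<close>

type_synonym nat_graph = "nat pair_pre_digraph"

definition has_hom :: "'a pair_pre_digraph \<Rightarrow> 'b pair_pre_digraph \<Rightarrow> bool" where
  "has_hom G H \<longleftrightarrow>
     (\<exists>f. f ` pverts G \<subseteq> pverts H \<and> (\<forall>(u, v) \<in> parcs G. (f u, f v) \<in> parcs H))"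

text \<open>
  \<^const>\<open>subdivision\<close> keeps the names of the original vertices and gives the new ones arbitrary
  fresh names; for a class closed under isomorphism this is the usual notion of being closed
  under subdivision.
\<close>

definition topologically_closed :: "nat_graph set \<Rightarrow> bool" where
  "topologically_closed C \<longleftrightarrow> (\<forall>G \<in> C. \<forall>H. subdivision_pair G H \<longrightarrow> H \<in> C)"

text \<open>
  \<open>H\<close> is a shallow minor of \<open>G\<close> at depth \<open>p\<close>: it is obtained from a subgraph of \<open>G\<close> by contracting
  pairwise disjoint branch sets \<open>B x\<close>, where \<open>B x\<close> induces a subgraph all of whose vertices are at
  distance at most \<open>p\<close> (in that subgraph) from a centre \<open>c x\<close>.
\<close>

definition shallow_minor :: "nat \<Rightarrow> 'b pair_pre_digraph \<Rightarrow> 'a pair_pre_digraph \<Rightarrow> bool" where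
  "shallow_minor p H G \<longleftrightarrow> pair_graph H \<and>
     (\<exists>B c. disjoint_family_on B (pverts H) \<and>
        (\<forall>x \<in> pverts H. B x \<subseteq> pverts G \<and> c x \<in> B x \<and>
           (\<forall>v \<in> B x. \<exists>w. pre_digraph.awalk (with_proj G \<restriction> B x) (c x) w v \<and> length w \<le> p)) \<and>
        (\<forall>(x, y) \<in> parcs H. \<exists>u \<in> B x. \<exists>v \<in> B y. (u, v) \<in> parcs G))"

text \<open>
  The degree of a vertex is its out-degree, as every edge is present in both orientations. The
  average degree of the graph without vertices is \<open>0\<close>.
\<close>

definition average_degree :: "'a pair_pre_digraph \<Rightarrow> real" where
  "average_degree G =
     (\<Sum>v \<in> pverts G. real (out_degree (with_proj G) v)) / real (card (pverts G))"

definition bounded_expansion :: "nat_graph set \<Rightarrow> bool" where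
  "bounded_expansion C \<longleftrightarrow>
     (\<forall>p. \<exists>b. \<forall>G \<in> C. \<forall>H :: nat_graph. shallow_minor p H G \<longrightarrow> average_degree H \<le> b)"

definition all_restricted_dualities :: "nat_graph set \<Rightarrow> bool" where
  "all_restricted_dualities C \<longleftrightarrow>
     (\<forall>F :: nat_graph. pair_graph F \<and> pverts F \<noteq> {} \<and> connected (with_proj F) \<longrightarrow>
        (\<exists>D :: nat_graph. pair_graph D \<and> \<not> has_hom F D \<and>
           (\<forall>G \<in> C. has_hom F G \<longleftrightarrow> \<not> has_hom G D)))"

text \<open>
  A closed walk \<open>u, v, u\<close> along one edge counts as a \<^const>\<open>pre_digraph.cycle\<close>, but it has length 2;
  the cycles of odd length are exactly the odd cycles of the undirected graph. The odd-girth is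
  \<open>\<infinity>\<close> if there are none.
\<close>

definition odd_girth :: "'a pair_pre_digraph \<Rightarrow> enat" where
  "odd_girth G =
     (INF w \<in> {w. pre_digraph.cycle (with_proj G) w \<and> odd (length w)}. enat (length w))"

end

theory Submission
  imports Defs
begin

text \<open>
  All three conditions are equivalent to uniform sparsity of path families: for every \<open>r\<close> there is \<open>D\<close>
  such that, in every graph of the class, any internally disjoint paths of length at most \<open>r\<close> joining
  distinct pairs of a vertex set \<open>S\<close>, with interiors avoiding \<open>S\<close>, number at most \<open>D * card S\<close>.

  From bounded expansion: assign the interior of each path to its first vertex; this is a shallow minor.

  From the homomorphism bounds: given such a family \<open>K\<close>, put \<open>a = max r 2\<close> and \<open>g = 2 * a + 1\<close>.
  Subdivide so that each path of \<open>K\<close> gets length \<open>a\<close> or \<open>a + 1\<close>, as one likes, and all other edges become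
  long. A cycle either uses a long edge or contains three paths of \<open>K\<close>, so it has length at least
  \<open>3 * a > g\<close>, and the subdivision maps to the fixed graph \<open>H\<close> of odd-girth greater than \<open>g\<close>. Two choices of
  lengths with the same images of the ends would give a closed walk of odd length \<open>g\<close> in \<open>H\<close>.
  Hence \<open>2 ^ card K\<close> is at most the number of maps from the ends to \<open>H\<close>.

  Conversely, uniform sparsity yields vertex orderings with bounded fans (bounded admissibility), hence
  with bounded weak reachability sets. These bound the density of shallow minors directly, and colouring
  greedily along them gives colourings with boundedly many colours in which every connected set with at
  most \<open>p\<close> colours has a uniquely coloured vertex. The subgraphs induced by at most \<open>p\<close> colours then fold
  to bounded size, so a graph \<open>G\<close> not receiving \<open>F\<close> maps to a quotient of bounded size not receiving \<open>F\<close>.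
  The dual of \<open>F\<close> is the disjoint union of all graphs of that size that do not receive \<open>F\<close>.
\<close>

section \<open>Walks and path families\<close>

text \<open>A path family is a shallow topological minor with branch vertices \<open>S\<close>. This
  is the form of sparsity that subdividing can test, since the length of each member of
  \<open>K\<close> can be chosen independently while the ends stay fixed; the counting closes
  because \<open>H\<close> depends on \<open>g\<close>, hence on \<open>r\<close>, and not on the
  graph. Closing a cycle takes three members because distinct members join distinct pairs.

  Branch sets of shallow minors need not be paths from a centre, so the two kinds of density are
  compared through an ordering rather than directly. The ordering is chosen from its top: a set all
  of whose vertices had large fans into the rest would give rise to a path family that is too dense,
  so some vertex can always be ranked last.

  Dualities say nothing about \<open>g = 1\<close>, where the cycle to be excluded would be a loop.
  That case of (3) is a bound on the chromatic number and comes from uniform sparsity, for which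
  larger \<open>g\<close> are enough.\<close>

definition walk :: "('a \<times> 'a) set \<Rightarrow> 'a \<Rightarrow> 'a list \<Rightarrow> 'a \<Rightarrow> bool" where
  "walk E x xs y \<longleftrightarrow>
     xs \<noteq> [] \<and> hd xs = x \<and> last xs = y \<and> successively (\<lambda>a b. (a, b) \<in> E) xs"

lemma walk_singleton [simp]: "walk E x [z] y \<longleftrightarrow> z = x \<and> z = y"
  by (auto simp: walk_def)

lemma not_walk_Nil [simp]: "\<not> walk E x [] y"
  by (simp add: walk_def)

lemma walk_Cons: "xs \<noteq> [] \<Longrightarrow> walk E x (z # xs) y \<longleftrightarrow> z = x \<and> (x, hd xs) \<in> E \<and> walk E (hd xs) xs y"
  by (cases xs) (auto simp: walk_def)

lemma walk_Cons_Cons [simp]: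
  "walk E x (z # w # xs) y \<longleftrightarrow> z = x \<and> (x, w) \<in> E \<and> walk E w (w # xs) y"
  by (simp add: walk_Cons)

lemma walk_ends: "walk E x xs y \<Longrightarrow> x \<in> set xs \<and> y \<in> set xs"
  by (auto simp: walk_def)

lemma walk_append:
  assumes "walk E x xs y" "walk E y ys z"
  shows "walk E x (xs @ tl ys) z"
  using assms by (cases ys) (auto simp: walk_def successively_append_iff successively_Cons)

lemma walk_split:
  "walk E x (as @ b # bs) y \<longleftrightarrow> walk E x (as @ [b]) b \<and> walk E b (b # bs) y"
  by (auto simp: walk_def successively_append_iff hd_append)

lemma walk_rev: "sym E \<Longrightarrow> walk E x xs y \<Longrightarrow> walk E y (rev xs) x"
  by (auto simp: walk_def hd_rev last_rev dest: symD elim!: successively_mono)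

lemma walk_Field: "walk E x xs y \<Longrightarrow> length xs \<ge> 2 \<Longrightarrow> set xs \<subseteq> Field E"
proof (induction xs arbitrary: x)
  case (Cons a xs)
  then show ?case
    by (cases xs; cases "tl xs") (auto simp: Field_def)
qed simp

lemma walk_in:
  assumes "walk E x xs y" "x \<in> V" "E \<subseteq> V \<times> V"
  shows "set xs \<subseteq> V"
  using assms
proof (induction xs arbitrary: x)
  case (Cons a xs)
  then show ?case by (cases xs) auto
qed simp

lemma walk_to_path:
  assumes "walk E x xs y"
  shows "\<exists>ys. walk E x ys y \<and> distinct ys \<and> set ys \<subseteq> set xs \<and> length ys \<le> length xs"
  using assms
proof (induction "length xs" arbitrary: xs rule: less_induct)
  case less
  show ?case
  proof (cases "distinct xs")
    case False
    then obtain as b bs cs where xs: "xs = as @ [b] @ bs @ [b] @ cs"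
      using not_distinct_decomp by blast
    have "walk E x (as @ b # (bs @ b # cs)) y" using less.prems xs by simp
    then have 1: "walk E x (as @ [b]) b" "walk E b ((b # bs) @ b # cs) y"
      by (subst (asm) walk_split, simp)+
    then have "walk E b (b # cs) y" using walk_split[of E b "b # bs" b cs y] by blast
    with 1(1) have "walk E x (as @ b # cs) y" by (subst walk_split) simp
    from less.hyps[OF _ this] obtain ys where
      "walk E x ys y" "distinct ys" "set ys \<subseteq> set (as @ b # cs)" "length ys \<le> length (as @ b # cs)"
      by (auto simp: xs)
    then show ?thesis by (intro exI[of _ ys]) (auto simp: xs)
  qed (use less.prems in blast)
qed

definition inner :: "'a list \<Rightarrow> 'a set" where
  "inner p = set p - {hd p, last p}"

lemma finite_inner [simp]: "finite (inner p)"
  by (simp add: inner_def)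

text \<open>Lists count vertices, so \<open>Suc r\<close> allows \<open>r\<close> edges. Ends are
  compared as sets, so no two members join the same pair in either direction and the topological
  minor on \<open>S\<close> is simple.\<close>

definition path_family :: "('a \<times> 'a) set \<Rightarrow> nat \<Rightarrow> 'a set \<Rightarrow> 'a list set \<Rightarrow> bool" where
  "path_family E r S K \<longleftrightarrow> finite K \<and>
     (\<forall>p \<in> K. successively (\<lambda>a b. (a, b) \<in> E) p \<and> distinct p \<and> 2 \<le> length p \<and> length p \<le> Suc r \<and>
        hd p \<in> S \<and> last p \<in> S \<and> inner p \<inter> S = {}) \<and>
     (\<forall>p \<in> K. \<forall>q \<in> K. p \<noteq> q \<longrightarrow> inner p \<inter> inner q = {} \<and> {hd p, last p} \<noteq> {hd q, last q})"

definition sparse_path_families :: "('a \<times> 'a) set \<Rightarrow> nat \<Rightarrow> nat \<Rightarrow> bool" where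
  "sparse_path_families E r D \<longleftrightarrow>
     (\<forall>S K. finite S \<longrightarrow> path_family E r S K \<longrightarrow> card K \<le> D * card S)"

text \<open>Members start after \<open>v\<close>, so that disjoint vertex sets mean sharing
  \<open>v\<close> only, and \<open>length p\<close> counts edges. The largest size of a fan into
  the lower vertices of an ordering is the admissibility of \<open>v\<close>.\<close>

definition fan :: "('a \<times> 'a) set \<Rightarrow> nat \<Rightarrow> 'a \<Rightarrow> 'a set \<Rightarrow> 'a list set \<Rightarrow> bool" where
  "fan E r v T F \<longleftrightarrow> finite F \<and>
     (\<forall>p \<in> F. p \<noteq> [] \<and> successively (\<lambda>a b. (a, b) \<in> E) (v # p) \<and> distinct (v # p) \<and> length p \<le> r \<and>
        last p \<in> T \<and> set (butlast p) \<inter> T = {}) \<and>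
     (\<forall>p \<in> F. \<forall>q \<in> F. p \<noteq> q \<longrightarrow> set p \<inter> set q = {})"

section \<open>Degeneracy and the end graph of a path family\<close>

text \<open>The vertex of small degree in all of \<open>S\<close> is coloured last; its neighbours
  block at most \<open>d\<close> of the \<open>Suc d\<close> colours.\<close>

lemma degenerate_coloring:
  fixes R :: "('a \<times> 'a) set"
  assumes "finite S" "sym R"
    and "\<And>T. T \<subseteq> S \<Longrightarrow> T \<noteq> {} \<Longrightarrow> \<exists>v\<in>T. card {u \<in> T. u \<noteq> v \<and> (u, v) \<in> R} \<le> d"
  shows "\<exists>c. c ` S \<subseteq> {..d} \<and> (\<forall>u\<in>S. \<forall>v\<in>S. (u, v) \<in> R \<longrightarrow> u \<noteq> v \<longrightarrow> c u \<noteq> (c v :: nat))"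
  using assms
proof (induction "card S" arbitrary: S)
  case 0
  then show ?case by auto
next
  case (Suc n)
  then have "S \<noteq> {}" by auto
  with Suc.prems(3)[of S] obtain v where v: "v \<in> S" "card {u \<in> S. u \<noteq> v \<and> (u, v) \<in> R} \<le> d" by auto
  have "n = card (S - {v})" using Suc.hyps(2) v Suc.prems(1) by simp
  moreover have "\<And>T. T \<subseteq> S - {v} \<Longrightarrow> T \<noteq> {} \<Longrightarrow> \<exists>v\<in>T. card {u \<in> T. u \<noteq> v \<and> (u, v) \<in> R} \<le> d"
    by (rule Suc.prems(3)) auto
  ultimately obtain c where
    c: "c ` (S - {v}) \<subseteq> {..d}" "\<forall>u\<in>S-{v}. \<forall>w\<in>S-{v}. (u, w) \<in> R \<longrightarrow> u \<noteq> w \<longrightarrow> c u \<noteq> (c w :: nat)"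
    using Suc.hyps(1)[of "S - {v}"] Suc.prems(1,2) by auto
  let ?N = "{u \<in> S. u \<noteq> v \<and> (u, v) \<in> R}"
  have "card (c ` ?N) \<le> d" using v(2) card_image_le[of ?N c] Suc.prems(1) by simp
  then have "\<not> {..d} \<subseteq> c ` ?N"
    using card_mono[of "c ` ?N" "{..d}"] Suc.prems(1) by auto
  then obtain k where k: "k \<le> d" "k \<notin> c ` ?N" by auto
  show ?case
  proof (intro exI[of _ "c(v := k)"] conjI ballI impI)
    show "(c(v := k)) ` S \<subseteq> {..d}" using c(1) k by auto
    fix u w assume u: "u \<in> S" "w \<in> S" "(u, w) \<in> R" "u \<noteq> w"
    have "(w, u) \<in> R" using u \<open>sym R\<close> by (auto dest: symD)
    then show "(c(v := k)) u \<noteq> (c(v := k)) w"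
      using u c(2) k(2) by (cases "u = v"; cases "w = v") auto
  qed
qed

lemma large_color_class:
  assumes "finite S" "c ` S \<subseteq> {..d :: nat}"
  shows "\<exists>k. card S \<le> Suc d * card {v \<in> S. c v = k}"
proof (rule ccontr)
  assume neg: "\<not> ?thesis"
  have "card S = (\<Sum>k\<le>d. card {v \<in> S. c v = k})"
    using assms by (subst card_UN_disjoint[symmetric]) (auto intro!: arg_cong[where f=card])
  then have "Suc d * card S = (\<Sum>k\<le>d. Suc d * card {v \<in> S. c v = k})"
    by (simp only: sum_distrib_left)
  also have "\<dots> < (\<Sum>k\<le>d. card S)"
    using neg by (intro sum_strict_mono) (auto simp: not_le)
  finally show False by simp
qed

lemma path_family_restrict:
  assumes "path_family E r S K" "T \<subseteq> S"
  shows "path_family E r T {p \<in> K. hd p \<in> T \<and> last p \<in> T}"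
  using assms unfolding path_family_def by (auto simp: inner_def)

definition ends_rel :: "'a list set \<Rightarrow> ('a \<times> 'a) set" where
  "ends_rel K = (\<lambda>p. (hd p, last p)) ` K \<union> (\<lambda>p. (last p, hd p)) ` K"

lemma sym_ends_rel: "sym (ends_rel K)"
  by (auto simp: ends_rel_def sym_def)

lemma finite_ends_rel: "finite K \<Longrightarrow> finite (ends_rel K)"
  by (simp add: ends_rel_def)

lemma card_ends_rel: "finite K \<Longrightarrow> card (ends_rel K) \<le> 2 * card K"
  unfolding ends_rel_def
  by (rule order_trans[OF card_Un_le]) (use card_image_le in \<open>fastforce simp: mult_2 intro: add_mono\<close>)

text \<open>The members of \<open>K\<close> with both ends in \<open>T\<close> form a path family on
  \<open>T\<close>, so the end graph has at most \<open>D * card T\<close> edges inside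
  \<open>T\<close> and average degree at most \<open>2 * D\<close> there.\<close>

lemma ends_rel_degenerate:
  assumes tb: "sparse_path_families E r D" and pf: "path_family E r S K"
    and T: "finite T" "T \<subseteq> S" "T \<noteq> {}"
  shows "\<exists>v\<in>T. card {u \<in> T. u \<noteq> v \<and> (u, v) \<in> ends_rel K} \<le> 2 * D"
proof (rule ccontr)
  assume neg: "\<not> ?thesis"
  let ?KT = "{p \<in> K. hd p \<in> T \<and> last p \<in> T}"
  have fin: "finite ?KT" using pf by (auto simp: path_family_def)
  have "card ?KT \<le> D * card T"
    using tb T path_family_restrict[OF pf T(2)] by (auto simp: sparse_path_families_def)
  moreover have "(\<Sum>v\<in>T. Suc (2 * D)) \<le> (\<Sum>v\<in>T. card {u \<in> T. (u, v) \<in> ends_rel K})"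
  proof (rule sum_mono)
    fix v assume "v \<in> T"
    with neg have "Suc (2 * D) \<le> card {u \<in> T. u \<noteq> v \<and> (u, v) \<in> ends_rel K}" by auto
    also have "\<dots> \<le> card {u \<in> T. (u, v) \<in> ends_rel K}" using T(1) by (intro card_mono) auto
    finally show "Suc (2 * D) \<le> card {u \<in> T. (u, v) \<in> ends_rel K}" .
  qed
  moreover have "(\<Sum>v\<in>T. card {u \<in> T. (u, v) \<in> ends_rel K})
      = card (Sigma T (\<lambda>v. {u \<in> T. (u, v) \<in> ends_rel K}))"
    using T(1) by (simp add: card_SigmaI)
  moreover have "card (Sigma T (\<lambda>v. {u \<in> T. (u, v) \<in> ends_rel K})) \<le> card (ends_rel ?KT)"
    by (intro card_mono finite_ends_rel fin) (auto simp: ends_rel_def image_iff)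
  moreover note card_ends_rel[OF fin]
  ultimately have "Suc (2 * D) * card T \<le> 2 * (D * card T)" by (simp add: algebra_simps)
  then have "card T \<le> 0" by simp
  then show False using T by simp
qed

text \<open>Otherwise the walk could be shortened to a path and added to \<open>K\<close>.
  Maximality turns every short connection that avoids \<open>S\<close> and the interiors into an
  edge of the end graph.\<close>

lemma adjacent_of_maximal:
  assumes pf: "path_family E r S K"
    and max: "\<And>K'. path_family E r S K' \<Longrightarrow> card K' \<le> card K"
    and w: "walk E s xs t" "length xs \<le> Suc r" "s \<in> S" "t \<in> S" "s \<noteq> t"
    and av: "set xs \<inter> (S \<union> (\<Union>p\<in>K. inner p)) \<subseteq> {s, t}"
  shows "(s, t) \<in> ends_rel K"
proof (rule ccontr)
  assume neg: "(s, t) \<notin> ends_rel K"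
  obtain ys where ys: "walk E s ys t" "distinct ys" "set ys \<subseteq> set xs" "length ys \<le> length xs"
    using walk_to_path[OF w(1)] by blast
  have h: "hd ys = s" "last ys = t" "ys \<noteq> []" "successively (\<lambda>a b. (a, b) \<in> E) ys"
    using ys(1) by (auto simp: walk_def)
  have "2 \<le> length ys"
    using h w(5) by (cases ys; cases "tl ys") auto
  have inn: "inner ys \<inter> S = {}" "\<And>p. p \<in> K \<Longrightarrow> inner ys \<inter> inner p = {}"
    using ys(3) av h by (auto simp: inner_def)
  have ends: "\<And>p. p \<in> K \<Longrightarrow> {hd p, last p} \<noteq> {s, t}"
    using neg by (auto simp: ends_rel_def doubleton_eq_iff image_iff)
  then have "ys \<notin> K" using h by auto
  have "path_family E r S (insert ys K)"
    unfolding path_family_def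
  proof (intro conjI)
    show "finite (insert ys K)" using pf by (auto simp: path_family_def)
    show "\<forall>p\<in>insert ys K. successively (\<lambda>a b. (a, b) \<in> E) p \<and> distinct p \<and> 2 \<le> length p \<and>
        length p \<le> Suc r \<and> hd p \<in> S \<and> last p \<in> S \<and> inner p \<inter> S = {}"
      using pf inn(1) h ys(2,4) w(2-4) \<open>2 \<le> length ys\<close> by (simp add: path_family_def)
    have *: "\<forall>p \<in> K. \<forall>q \<in> K. p \<noteq> q \<longrightarrow> inner p \<inter> inner q = {} \<and> {hd p, last p} \<noteq> {hd q, last q}"
      using pf by (simp add: path_family_def)
    have **: "inner ys \<inter> inner p = {} \<and> inner p \<inter> inner ys = {} \<and>
        {hd ys, last ys} \<noteq> {hd p, last p} \<and> {hd p, last p} \<noteq> {hd ys, last ys}" if "p \<in> K" for p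
      using inn(2)[OF that] ends[OF that] h(1,2) by (metis Int_commute)
    show "\<forall>p\<in>insert ys K. \<forall>q\<in>insert ys K. p \<noteq> q \<longrightarrow>
        inner p \<inter> inner q = {} \<and> {hd p, last p} \<noteq> {hd q, last q}"
      using * ** by blast
  qed
  from max[OF this] show False using \<open>ys \<notin> K\<close> pf by (auto simp: path_family_def)
qed

section \<open>Maximal path families against large fans\<close>

lemma maximal_card_exists:
  fixes b :: nat
  assumes "P x" "\<And>y. P y \<Longrightarrow> card y \<le> b"
  obtains z where "P z" "\<And>y. P y \<Longrightarrow> card y \<le> card z"
proof -
  have "\<forall>y. P y \<longrightarrow> card y < Suc b"
    using assms(2) by (simp add: less_Suc_eq_le)
  from ex_has_greatest_nat[OF assms(1) this] obtain z
    where "P z \<and> (\<forall>y. P y \<longrightarrow> card y \<le> card z)" ..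
  then show ?thesis by (intro that[of z]) simp_all
qed

lemma fan_last_inj:
  assumes "fan E r v T F" "p \<in> F" "q \<in> F" "z \<in> set p" "z \<in> set q"
  shows "p = q"
  using assms unfolding fan_def by (meson disjoint_iff)

text \<open>Take a maximal path family \<open>K\<close> on \<open>S\<close> with interiors
  \<open>M\<close>, and a large set \<open>I\<close> independent in its end graph. A fan path from
  \<open>I\<close> that avoids \<open>M\<close> makes its ends adjacent by maximality, and the end
  graph has few edges. All other fan paths are cut at their first vertex in \<open>M\<close>. Cut
  paths from different vertices of \<open>I\<close> cannot meet before \<open>M\<close>, since this
  would make the two vertices adjacent; so the cut paths form a path family on
  \<open>I \<union> M\<close>, which is sparse too.\<close>

lemma not_all_fans_large:
  assumes "sym E" and tb: "sparse_path_families E (2 * r) D"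
    and S: "finite S" "S \<noteq> {}"
    and fans: "\<And>v. v \<in> S \<Longrightarrow> fan E r v (S - {v}) (F v)"
    and k: "\<And>v. v \<in> S \<Longrightarrow> k \<le> card (F v)"
  shows "k \<le> Suc (2 * D) * (3 * D + 2 * r * D * D)"
proof -
  have "path_family E (2 * r) S {}" by (auto simp: path_family_def)
  then obtain K where K: "path_family E (2 * r) S K"
    and Kmax: "\<And>K'. path_family E (2 * r) S K' \<Longrightarrow> card K' \<le> card K"
    using maximal_card_exists[of "path_family E (2 * r) S" "{}" "D * card S"] tb S
    unfolding sparse_path_families_def by blast
  have finK: "finite K" using K by (simp add: path_family_def)
  have cardK: "card K \<le> D * card S" using tb S K by (auto simp: sparse_path_families_def)
  define R where "R = ends_rel K"
  define M where "M = (\<Union>p\<in>K. inner p)"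
  have adj: "(s, t) \<in> R" if "walk E s xs t" "length xs \<le> Suc (2 * r)" "s \<in> S" "t \<in> S" "s \<noteq> t"
    "set xs \<inter> (S \<union> M) \<subseteq> {s, t}" for s t xs
    unfolding R_def using K Kmax that(1-5) that(6)[unfolded M_def] by (rule adjacent_of_maximal)
  have finM: "finite M" using finK by (auto simp: M_def)
  have MS: "M \<inter> S = {}" using K by (auto simp: M_def path_family_def)
  have "card M \<le> (\<Sum>p\<in>K. card (inner p))" unfolding M_def using finK by (rule card_UN_le)
  also have "\<dots> \<le> (\<Sum>p\<in>K. 2 * r)"
  proof (rule sum_mono)
    fix p assume "p \<in> K"
    then have p: "distinct p" "2 \<le> length p" "length p \<le> Suc (2 * r)" using K by (auto simp: path_family_def)
    have "inner p \<subset> set p" using p(2) by (cases p) (auto simp: inner_def)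
    then have "card (inner p) < card (set p)" by (simp add: psubset_card_mono)
    then show "card (inner p) \<le> 2 * r" using p by (simp add: distinct_card)
  qed
  finally have cardM: "card M \<le> 2 * r * card K" by (simp add: mult.commute)
  have "\<And>T. T \<subseteq> S \<Longrightarrow> T \<noteq> {} \<Longrightarrow> \<exists>v\<in>T. card {u \<in> T. u \<noteq> v \<and> (u, v) \<in> R} \<le> 2 * D"
    unfolding R_def using ends_rel_degenerate[OF tb K] S(1) finite_subset by blast
  then obtain c where c: "c ` S \<subseteq> {..2 * D}" "\<forall>u\<in>S. \<forall>v\<in>S. (u, v) \<in> R \<longrightarrow> u \<noteq> v \<longrightarrow> c u \<noteq> (c v :: nat)"
    using degenerate_coloring[of S R "2 * D"] S sym_ends_rel[of K] unfolding R_def by auto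
  obtain j where j: "card S \<le> Suc (2 * D) * card {v \<in> S. c v = j}"
    using large_color_class[OF S(1) c(1)] by blast
  define I where "I = {v \<in> S. c v = j}"
  have I: "I \<subseteq> S" "finite I" "card S \<le> Suc (2 * D) * card I"
    and indep: "\<And>u v. u \<in> I \<Longrightarrow> v \<in> I \<Longrightarrow> (u, v) \<in> R \<Longrightarrow> u = v"
    using j c(2) S(1) unfolding I_def by (auto, metis)
  have finF: "finite (F v)" if "v \<in> I" for v using fans that I by (auto simp: fan_def)
  have fd: "p \<noteq> []" "successively (\<lambda>a b. (a, b) \<in> E) (v # p)" "distinct (v # p)" "length p \<le> r"
    "last p \<in> S" "last p \<noteq> v" "set (butlast p) \<inter> S = {}" if "v \<in> I" "p \<in> F v" for v p
  proof -
    have "fan E r v (S - {v}) (F v)" using fans that I by auto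
    then have *: "p \<noteq> []" "successively (\<lambda>a b. (a, b) \<in> E) (v # p)" "distinct (v # p)" "length p \<le> r"
      "last p \<in> S - {v}" "set (butlast p) \<inter> (S - {v}) = {}"
      using that(2) unfolding fan_def by blast+
    then show "p \<noteq> []" "successively (\<lambda>a b. (a, b) \<in> E) (v # p)" "distinct (v # p)" "length p \<le> r"
      "last p \<in> S" "last p \<noteq> v" by auto
    have "v \<notin> set (butlast p)" using *(3) in_set_butlastD by fastforce
    then show "set (butlast p) \<inter> S = {}" using *(6) by auto
  qed
  have same: "p = q" if "v \<in> I" "p \<in> F v" "q \<in> F v" "z \<in> set p" "z \<in> set q" for v p q z
    using fan_last_inj[OF fans] that I by blast
  define bad where "bad = {(v, p). v \<in> I \<and> p \<in> F v \<and> (v, last p) \<in> R}"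
  define good where "good = {(v, p). v \<in> I \<and> p \<in> F v \<and> (v, last p) \<notin> R}"
  have split: "Sigma I F = bad \<union> good" "bad \<inter> good = {}"
    by (auto simp: bad_def good_def)
  have "finite (Sigma I F)" by (rule finite_SigmaI[OF I(2)]) (rule finF)
  then have fin: "finite bad" "finite good"
    unfolding split(1) by auto
  have "k * card I = (\<Sum>v\<in>I. k)" by simp
  also have "\<dots> \<le> (\<Sum>v\<in>I. card (F v))" using I k by (intro sum_mono) auto
  also have "\<dots> = card (Sigma I F)" using I finF by (simp add: card_SigmaI)
  also have "\<dots> = card bad + card good" unfolding split(1) by (intro card_Un_disjoint fin split(2))
  finally have kI: "k * card I \<le> card bad + card good" .
  \<comment> \<open>Members of one fan have different last vertices, so a bad pair is determined by
    its arc of \<open>R\<close>.\<close>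
  have "card bad \<le> card R"
  proof (rule card_inj_on_le)
    show "inj_on (\<lambda>(v, p). (v, last p)) bad"
      using same fd(1) by (auto simp: inj_on_def bad_def) (metis last_in_set)
    show "(\<lambda>(v, p). (v, last p)) ` bad \<subseteq> R" by (auto simp: bad_def)
    show "finite R" using finK by (simp add: R_def finite_ends_rel)
  qed
  then have cbad: "card bad \<le> 2 * card K"
    using card_ends_rel[OF finK] by (simp add: R_def)
  have hitM: "set p \<inter> M \<noteq> {}" if "(v, p) \<in> good" for v p
  proof
    assume "set p \<inter> M = {}"
    have vp: "v \<in> I" "p \<in> F v" "(v, last p) \<notin> R" using that by (auto simp: good_def)
    note f = fd[OF vp(1,2)]
    have "set p = insert (last p) (set (butlast p))"
      using f(1) by (metis append_butlast_last_id list.simps(15) rotate1.simps(2) set_rotate1)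
    then have "set (v # p) \<inter> (S \<union> M) \<subseteq> {v, last p}"
      using f(7) \<open>set p \<inter> M = {}\<close> vp I MS by auto
    moreover have "walk E v (v # p) (last p)" using f by (simp add: walk_def)
    ultimately have "(v, last p) \<in> R"
      using adj[of v "v # p" "last p"] f I vp by (auto simp: subset_iff)
    then show False using vp by simp
  qed
  \<comment> \<open>On good pairs \<open>hitM\<close> makes the \<open>dropWhile\<close> part
    non-empty, so \<open>hd\<close> yields the first vertex in \<open>M\<close>.\<close>
  define cut where "cut = (\<lambda>p. takeWhile (\<lambda>z. z \<notin> M) p @ [hd (dropWhile (\<lambda>z. z \<notin> M) p)])"
  have cut: "\<exists>as m bs. p = as @ m # bs \<and> cut p = as @ [m] \<and> m \<in> M \<and> set as \<inter> (M \<union> S \<union> {v}) = {}"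
    if g: "(v, p) \<in> good" for v p
  proof -
    have vp: "v \<in> I" "p \<in> F v" using g by (auto simp: good_def)
    obtain as m bs where *: "p = as @ m # bs" "m \<in> M" "\<forall>z\<in>set as. z \<notin> M"
      using hitM[OF g] split_list_first_prop[of p "\<lambda>z. z \<in> M"] by blast
    have "cut p = as @ [m]" using * by (simp add: cut_def takeWhile_append dropWhile_append)
    moreover have "set as \<subseteq> set (butlast p)" using *(1) by (auto simp: butlast_append)
    moreover note fd(3,7)[OF vp]
    ultimately show ?thesis using * by fastforce
  qed
  define K' where "K' = (\<lambda>(v, p). v # cut p) ` good"
  \<comment> \<open>This is why sparsity is assumed at \<open>2 * r\<close>: the pieces from
    \<open>v\<close> and \<open>w\<close>, glued at a common vertex, can have almost
    \<open>2 * r\<close> edges.\<close>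
  have disj: False
    if t: "(v, p) \<in> good" "(w, q) \<in> good" "(v, p) \<noteq> (w, q)" "cut p = as @ [m]" "cut q = bs @ [n]"
      "z \<in> set as" "z \<in> set bs" for v w p q as m bs n z
  proof -
    have vp: "v \<in> I" "p \<in> F v" "w \<in> I" "q \<in> F w" using t by (auto simp: good_def)
    obtain cs ds where pq: "p = as @ m # cs" "q = bs @ n # ds" "set as \<inter> (M \<union> S \<union> {v}) = {}"
      "set bs \<inter> (M \<union> S \<union> {w}) = {}"
      using cut[OF t(1)] cut[OF t(2)] t(4,5) by auto
    have "v \<noteq> w"
      using same[of v p q z] vp t(3,6,7) pq by auto
    obtain as1 as2 where as: "as = as1 @ z # as2" using t(6) by (meson split_list)
    obtain bs1 bs2 where bs: "bs = bs1 @ z # bs2" using t(7) by (meson split_list)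
    note fp = fd[OF vp(1,2)] and fq = fd[OF vp(3,4)]
    have "walk E v ((v # as1) @ z # (as2 @ m # cs)) (last p)"
      using fp by (simp add: walk_def pq as)
    then have wv: "walk E v ((v # as1) @ [z]) z" using walk_split by fast
    have "walk E w ((w # bs1) @ z # (bs2 @ n # ds)) (last q)"
      using fq by (simp add: walk_def pq bs)
    then have "walk E w ((w # bs1) @ [z]) z" using walk_split by fast
    from walk_rev[OF \<open>sym E\<close> this] have "walk E z (z # rev bs1 @ [w]) w" by simp
    from walk_append[OF wv this] have wk: "walk E v (v # as1 @ z # rev bs1 @ [w]) w" by simp
    have "length as1 + 2 \<le> r" "length bs1 + 2 \<le> r" using fp(4) fq(4) by (auto simp: pq as bs)
    then have "length (v # as1 @ z # rev bs1 @ [w]) \<le> Suc (2 * r)" by simp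
    moreover have "set (v # as1 @ z # rev bs1 @ [w]) \<inter> (S \<union> M) \<subseteq> {v, w}"
      using pq(3,4) by (auto simp: as bs)
    ultimately have "(v, w) \<in> R" using adj[OF wk] vp I \<open>v \<noteq> w\<close> by blast
    then show False using indep vp \<open>v \<noteq> w\<close> by blast
  qed
  have inj: "inj_on (\<lambda>(v, p). v # cut p) good"
  proof (rule inj_onI)
    fix x y assume xy: "x \<in> good" "y \<in> good"
      "(case x of (v, p) \<Rightarrow> v # cut p) = (case y of (v, p) \<Rightarrow> v # cut p)"
    obtain v p w q where vpwq: "x = (v, p)" "y = (w, q)" by (metis surj_pair)
    have g: "(v, p) \<in> good" "(w, q) \<in> good" and eq: "v # cut p = w # cut q"
      using xy vpwq by auto
    obtain as m bs where 1: "p = as @ m # bs" "cut p = as @ [m]" using cut[OF g(1)] by blast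
    obtain cs n ds where 2: "q = cs @ n # ds" "cut q = cs @ [n]" using cut[OF g(2)] by blast
    have "m = n" using eq 1 2 by simp
    moreover have "v = w" using eq by simp
    ultimately have "p = q" using same[of v p q m] g 1(1) 2(1) by (auto simp: good_def)
    then show "x = y" using \<open>v = w\<close> vpwq by simp
  qed
  have pfK': "path_family E (2 * r) (I \<union> M) K'"
    unfolding path_family_def
  proof (intro conjI ballI impI)
    show "finite K'" using fin by (simp add: K'_def)
  next
    fix p' assume "p' \<in> K'"
    then obtain v p where g: "(v, p) \<in> good" and p': "p' = v # cut p" by (auto simp: K'_def)
    obtain as m bs where 1: "p = as @ m # bs" "cut p = as @ [m]" "m \<in> M" "set as \<inter> (M \<union> S \<union> {v}) = {}"
      using cut[OF g] by blast
    have vp: "v \<in> I" "p \<in> F v" using g by (auto simp: good_def)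
    note f = fd[OF vp]
    show "successively (\<lambda>a b. (a, b) \<in> E) p'"
      using f(2) unfolding 1(1) by (auto simp: p' 1(2) successively_append_iff successively_Cons hd_append split: if_splits)
    show "distinct p'" using f(3) unfolding 1(1) by (auto simp: p' 1(2))
    show "2 \<le> length p'" by (simp add: p' 1(2))
    show "length p' \<le> Suc (2 * r)" using f(4) unfolding 1(1) by (simp add: p' 1(2))
    show "hd p' \<in> I \<union> M" using vp by (simp add: p')
    show "last p' \<in> I \<union> M" using 1(2,3) by (simp add: p')
    show "inner p' \<inter> (I \<union> M) = {}" using 1(2-4) I(1) by (auto simp: inner_def p')
  next
    fix p' q' assume "p' \<in> K'" "q' \<in> K'" "p' \<noteq> q'"
    then obtain v p w q where g: "(v, p) \<in> good" "(w, q) \<in> good" and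
      p': "p' = v # cut p" and q': "q' = w # cut q" by (auto simp: K'_def)
    with \<open>p' \<noteq> q'\<close> have ne: "(v, p) \<noteq> (w, q)" by auto
    obtain as m as' where 1: "p = as @ m # as'" "cut p = as @ [m]" "m \<in> M"
      using cut[OF g(1)] by blast
    obtain bs n bs' where 2: "q = bs @ n # bs'" "cut q = bs @ [n]" "n \<in> M"
      using cut[OF g(2)] by blast
    have "set as \<inter> set bs = {}" using disj[OF g ne 1(2) 2(2)] by blast
    moreover have "inner p' \<subseteq> set as" "inner q' \<subseteq> set bs" by (auto simp: p' q' 1(2) 2(2) inner_def)
    ultimately show "inner p' \<inter> inner q' = {}" by blast
    have vw: "v \<in> I" "w \<in> I" "p \<in> F v" "q \<in> F w" using g by (auto simp: good_def)
    \<comment> \<open>The sets \<open>I\<close> and \<open>M\<close> are disjoint, so equal pairs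
      force equal starts and equal last vertices; but members of one fan share no vertex.\<close>
    show "{hd p', last p'} \<noteq> {hd q', last q'}"
    proof
      assume "{hd p', last p'} = {hd q', last q'}"
      then have "{v, m} = {w, n}" by (simp add: p' q' 1(2) 2(2))
      then have "v = w \<and> m = n" using vw I MS 1(3) 2(3) by (auto simp: doubleton_eq_iff)
      then show False using same[of v p q m] vw ne 1 2 by auto
    qed
  qed
  have "card good = card K'" unfolding K'_def using inj by (simp add: card_image)
  also have "\<dots> \<le> D * card (I \<union> M)"
    using tb pfK' I finM by (auto simp: sparse_path_families_def)
  also have "\<dots> \<le> D * (card I + card M)" by (intro mult_le_mono2 card_Un_le)
  also have "\<dots> \<le> D * (card S + 2 * r * (D * card S))"
  proof (intro mult_le_mono2 add_mono)
    show "card I \<le> card S" using I S by (simp add: card_mono)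
    show "card M \<le> 2 * r * (D * card S)"
      using cardM cardK by (meson mult_le_mono2 order_trans)
  qed
  finally have cgood: "card good \<le> D * (card S + 2 * r * (D * card S))" .
  have "k * card I \<le> 2 * (D * card S) + D * (card S + 2 * r * (D * card S))"
    using kI cbad cardK cgood by linarith
  also have "\<dots> = (3 * D + 2 * r * D * D) * card S" by (simp add: algebra_simps)
  \<comment> \<open>Passing from \<open>S\<close> to the colour class \<open>I\<close> costs the
    number of colours, \<open>Suc (2 * D)\<close>.\<close>
  also have "\<dots> \<le> (3 * D + 2 * r * D * D) * (Suc (2 * D) * card I)"
    using I(3) by (intro mult_le_mono2)
  finally have "k * card I \<le> (Suc (2 * D) * (3 * D + 2 * r * D * D)) * card I"
    by (simp only: mult_ac)
  moreover have "card I > 0" using I(3) S by (metis card_0_eq gr0I le_zero_eq mult_0_right)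
  ultimately show ?thesis by simp
qed

section \<open>Weak reachability and centred colourings\<close>

lemma walk_snoc:
  "xs \<noteq> [] \<Longrightarrow> walk E x (xs @ [z]) y \<longleftrightarrow> z = y \<and> walk E x xs (last xs) \<and> (last xs, z) \<in> E"
  by (auto simp: walk_def successively_append_iff)

text \<open>Weak reachability for the ordering by \<open>f\<close>, within \<open>r\<close> edges.
  Walks give the same sets as paths, because shortening a walk only drops vertices.\<close>

definition wreach :: "('a \<times> 'a) set \<Rightarrow> ('a \<Rightarrow> nat) \<Rightarrow> nat \<Rightarrow> 'a \<Rightarrow> 'a set" where
  "wreach E f r v = {u. \<exists>xs. walk E v xs u \<and> length xs \<le> Suc r \<and> (\<forall>z\<in>set xs. f u \<le> f z)}"

lemma wreach_le: "u \<in> wreach E f r v \<Longrightarrow> f u \<le> f v"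
  unfolding wreach_def by (auto dest: walk_ends)

text \<open>The vertex without a large fan into the rest of \<open>S\<close> gets the top rank, so
  that the rest of \<open>S\<close> is exactly what lies below it; the others are ranked
  recursively.\<close>

lemma ranking_without_large_fans:
  assumes "finite S"
    and "\<And>T. T \<subseteq> S \<Longrightarrow> T \<noteq> {} \<Longrightarrow> \<exists>v\<in>T. \<forall>F. fan E r v (T - {v}) F \<longrightarrow> card F \<le> k"
  shows "\<exists>f :: 'a \<Rightarrow> nat. inj_on f S \<and> (\<forall>v\<in>S. \<forall>F. fan E r v {u \<in> S. f u < f v} F \<longrightarrow> card F \<le> k)"
  using assms
proof (induction "card S" arbitrary: S)
  case 0
  then show ?case by auto
next
  case (Suc n)
  then have "S \<noteq> {}" by auto
  with Suc.prems(2)[of S] obtain v where v: "v \<in> S" "\<forall>F. fan E r v (S - {v}) F \<longrightarrow> card F \<le> k" by auto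
  have n: "n = card (S - {v})" using Suc.hyps(2) v Suc.prems(1) by simp
  have "\<exists>f :: 'a \<Rightarrow> nat. inj_on f (S - {v}) \<and>
      (\<forall>w\<in>S-{v}. \<forall>F. fan E r w {u \<in> S - {v}. f u < f w} F \<longrightarrow> card F \<le> k)"
    by (rule Suc.hyps(1)[OF n]) (use Suc.prems in auto)
  then obtain f :: "'a \<Rightarrow> nat" where f: "inj_on f (S - {v})"
    "\<forall>w\<in>S-{v}. \<forall>F. fan E r w {u \<in> S - {v}. f u < f w} F \<longrightarrow> card F \<le> k" by blast
  \<comment> \<open>Inserting 0 keeps \<open>Max\<close> defined when \<open>v\<close> is the only
    vertex.\<close>
  define g where "g = f(v := Suc (Max (insert 0 (f ` (S - {v})))))"
  have gv: "g u < g v" if "u \<in> S - {v}" for u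
    using that Suc.prems(1) by (auto simp: g_def less_Suc_eq_le)
  have geq: "g u = f u" if "u \<noteq> v" for u using that by (simp add: g_def)
  show ?case
  proof (intro exI[of _ g] conjI ballI)
    show "inj_on g S"
    proof (rule inj_onI)
      fix x y assume "x \<in> S" "y \<in> S" "g x = g y"
      then show "x = y" using f(1) gv[of x] gv[of y] geq by (cases "x = v"; cases "y = v") (auto simp: inj_on_def)
    qed
    fix w assume w: "w \<in> S"
    have eq: "{u \<in> S. g u < g w} = (if w = v then S - {v} else {u \<in> S - {v}. f u < f w})"
    proof (cases "w = v")
      case True
      then show ?thesis using gv by auto
    next
      case False
      then have "\<not> g v < g w" using gv[of w] w by auto
      then have "g u < g w \<longleftrightarrow> u \<noteq> v \<and> f u < f w" for u
        using geq False by (cases "u = v") auto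
      then show ?thesis using False by auto
    qed
    show "\<forall>F. fan E r w {u \<in> S. g u < g w} F \<longrightarrow> card F \<le> k"
      using f(2) v(2) w unfolding eq by auto
  qed
qed

lemma fan_insert:
  assumes "fan E r v T F" "p \<noteq> []" "successively (\<lambda>a b. (a, b) \<in> E) (v # p)" "distinct (v # p)" "length p \<le> r"
    "last p \<in> T" "set (butlast p) \<inter> T = {}" "\<And>q. q \<in> F \<Longrightarrow> set p \<inter> set q = {}"
  shows "fan E r v T (insert p F)" and "p \<notin> F"
proof -
  show "p \<notin> F" using assms(2) assms(8)[of p] by auto
  have *: "\<forall>p \<in> F. \<forall>q \<in> F. p \<noteq> q \<longrightarrow> set p \<inter> set q = {}" using assms(1) by (simp add: fan_def)
  have "\<forall>q\<in>insert p F. \<forall>q'\<in>insert p F. q \<noteq> q' \<longrightarrow> set q \<inter> set q' = {}"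
    using * assms(8) by blast
  then show "fan E r v T (insert p F)" using assms(1-7) by (simp add: fan_def)
qed

text \<open>A maximal fan from \<open>v\<close> to the vertices below \<open>v\<close> covers few vertices, and every walk from
  \<open>v\<close> to a vertex below meets it; the part of the walk after that is shorter.\<close>

lemma wreach_via_fan:
  assumes fan: "fan E R v {u \<in> V. f u < f v} F"
    and max: "\<And>F'. fan E R v {u \<in> V. f u < f v} F' \<Longrightarrow> card F' \<le> card F"
    and E: "E \<subseteq> V \<times> V" and v: "v \<in> V" and f: "inj_on f V"
    and u: "u \<in> wreach E f (Suc r) v" "u \<noteq> v" and r: "Suc r \<le> R"
  shows "\<exists>x\<in>\<Union>(set ` F). u \<in> wreach E f r x"
proof -
  obtain xs0 where xs0: "walk E v xs0 u" "length xs0 \<le> Suc (Suc r)" "\<forall>z\<in>set xs0. f u \<le> f z"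
    using u(1) by (auto simp: wreach_def)
  obtain xs where xs: "walk E v xs u" "distinct xs" "length xs \<le> Suc (Suc r)" "\<forall>z\<in>set xs. f u \<le> f z"
    using walk_to_path[OF xs0(1)] xs0(2,3) by (meson order_trans subset_eq)
  have "u \<in> V" using walk_in[OF xs(1) v E] walk_ends[OF xs(1)] by blast
  have "f u < f v"
    using xs(4) walk_ends[OF xs(1)] f u(2) v \<open>u \<in> V\<close> by (metis inj_onD le_neq_implies_less)
  obtain ys where ys: "xs = v # ys" "ys \<noteq> []"
    using xs(1) u(2) by (cases xs) (auto simp: walk_def split: if_splits)
  let ?T = "{u \<in> V. f u < f v}"
  have "u \<in> set ys" using xs(1) ys by (auto simp: walk_def)
  with \<open>f u < f v\<close> \<open>u \<in> V\<close> have "\<exists>z\<in>set ys. z \<in> ?T" by auto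
  then obtain as t bs where ysd: "ys = as @ t # bs" "t \<in> ?T" "\<forall>z\<in>set as. z \<notin> ?T"
    using split_list_first_prop[of ys "\<lambda>z. z \<in> ?T"] by blast
  \<comment> \<open>Otherwise the segment up to the first vertex below \<open>v\<close> could be
    added to the maximal fan.\<close>
  have "\<exists>q\<in>F. set (as @ [t]) \<inter> set q \<noteq> {}"
  proof (rule ccontr)
    assume neg: "\<not> ?thesis"
    have suc: "successively (\<lambda>a b. (a, b) \<in> E) (v # as @ [t])"
      using xs(1) unfolding ys(1) ysd(1) walk_def
      by (auto simp: successively_append_iff successively_Cons hd_append split: if_splits)
    have "distinct (v # as @ [t])" "length (as @ [t]) \<le> R"
      using xs(2,3) r by (auto simp: ys ysd)
    then have "fan E R v ?T (insert (as @ [t]) F)" "as @ [t] \<notin> F"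
      using fan_insert[OF fan _ suc] ysd(2,3) neg by (auto simp del: distinct.simps)
    moreover have "finite F" using fan by (simp add: fan_def)
    ultimately show False using max[of "insert (as @ [t]) F"] by simp
  qed
  then obtain q x where q: "q \<in> F" "x \<in> set q" "x \<in> set (as @ [t])" by auto
  \<comment> \<open>As \<open>x\<close> comes after \<open>v\<close> on the path, the rest of the
    path from \<open>x\<close> is at least one edge shorter.\<close>
  have "x \<in> set ys" using q(3) ysd(1) by auto
  then obtain cs ds where ds: "ys = cs @ x # ds" by (meson split_list)
  have "walk E v ((v # cs) @ x # ds) u" using xs(1) by (simp add: ys ds)
  then have "walk E x (x # ds) u" using walk_split by fast
  moreover have "length (x # ds) \<le> Suc r" "\<forall>z\<in>set (x # ds). f u \<le> f z" using xs(3,4) by (auto simp: ys ds)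
  ultimately have "u \<in> wreach E f r x" unfolding wreach_def by blast
  then show ?thesis using q by auto
qed

text \<open>The fan radius \<open>R\<close> stays fixed while \<open>r\<close> decreases: a maximal
  fan covers at most \<open>k * R\<close> vertices, and everything reached from \<open>v\<close>
  besides \<open>v\<close> itself is reached from one of them with one edge less.\<close>

lemma wreach_card:
  assumes E: "E \<subseteq> V \<times> V" and f: "inj_on f V"
    and fans: "\<And>v F. v \<in> V \<Longrightarrow> fan E R v {u \<in> V. f u < f v} F \<Longrightarrow> card F \<le> k"
    and "r \<le> R" "v \<in> V"
  shows "finite (wreach E f r v) \<and> card (wreach E f r v) \<le> (1 + k * R) ^ r"
  using assms(4,5)
proof (induction r arbitrary: v)
  case 0
  have "wreach E f 0 v = {v}"
  proof
    show "wreach E f 0 v \<subseteq> {v}"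
    proof
      fix u assume "u \<in> wreach E f 0 v"
      then obtain xs where "walk E v xs u" "length xs \<le> 1" by (auto simp: wreach_def)
      then show "u \<in> {v}" by (cases xs) auto
    qed
    show "{v} \<subseteq> wreach E f 0 v" by (auto simp: wreach_def intro!: exI[of _ "[v]"])
  qed
  then show ?case by simp
next
  case (Suc r)
  have "fan E R v {u \<in> V. f u < f v} {}" by (simp add: fan_def)
  then obtain F where F: "fan E R v {u \<in> V. f u < f v} F"
    and max: "\<And>F'. fan E R v {u \<in> V. f u < f v} F' \<Longrightarrow> card F' \<le> card F"
    using maximal_card_exists[of "fan E R v {u \<in> V. f u < f v}" "{}" k] fans[OF Suc.prems(2)] by blast
  let ?X = "\<Union>(set ` F)"
  have finF: "finite F" using F by (simp add: fan_def)
  have "card ?X \<le> (\<Sum>p\<in>F. card (set p))" using finF by (rule card_UN_le)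
  also have "\<dots> \<le> (\<Sum>p\<in>F. R)"
    using F card_length by (intro sum_mono) (fastforce simp: fan_def intro: order_trans)
  also have "\<dots> \<le> k * R" using fans[OF Suc.prems(2) F] by simp
  finally have cX: "card ?X \<le> k * R" .
  have XV: "?X \<subseteq> V"
  proof
    fix x assume "x \<in> ?X"
    then obtain p where p: "p \<in> F" "x \<in> set p" by auto
    then have "walk E v (v # p) (last p)" using F by (auto simp: fan_def walk_def)
    then have "set (v # p) \<subseteq> V" using walk_in Suc.prems(2) E by metis
    then show "x \<in> V" using p by auto
  qed
  have sub: "wreach E f (Suc r) v \<subseteq> {v} \<union> (\<Union>x\<in>?X. wreach E f r x)"
    using wreach_via_fan[OF F max E Suc.prems(2) f _ _ Suc.prems(1)] by blast
  have IH: "finite (wreach E f r x) \<and> card (wreach E f r x) \<le> (1 + k * R) ^ r" if "x \<in> ?X" for x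
    using Suc.IH[of x] Suc.prems(1) XV that by auto
  have fin: "finite (\<Union>x\<in>?X. wreach E f r x)"
    using IH finF by (intro finite_UN_I) auto
  have "card (wreach E f (Suc r) v) \<le> card ({v} \<union> (\<Union>x\<in>?X. wreach E f r x))"
    using sub fin by (intro card_mono) auto
  also have "\<dots> \<le> 1 + card (\<Union>x\<in>?X. wreach E f r x)"
    using fin by (simp add: card_insert_if)
  also have "card (\<Union>x\<in>?X. wreach E f r x) \<le> (\<Sum>x\<in>?X. card (wreach E f r x))"
    using finF by (intro card_UN_le) auto
  also have "\<dots> \<le> (\<Sum>x\<in>?X. (1 + k * R) ^ r)" using IH by (intro sum_mono) auto
  also have "\<dots> \<le> k * R * (1 + k * R) ^ r" using cX by simp
  also have "1 + \<dots> \<le> (1 + k * R) ^ Suc r" by simp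
  finally show ?case using sub fin finite_subset by (metis finite.simps finite_Un le_Suc_eq add_left_mono)
qed

lemma sparse_path_families_wreach:
  fixes E :: "('a \<times> 'a) set"
  assumes "sym E" "E \<subseteq> V \<times> V" "finite V" "sparse_path_families E (2 * r) D"
  shows "\<exists>f :: 'a \<Rightarrow> nat. inj_on f V \<and> (\<forall>v\<in>V. finite (wreach E f r v) \<and>
    card (wreach E f r v) \<le> (1 + Suc (2 * D) * (3 * D + 2 * r * D * D) * r) ^ r)"
proof -
  let ?k = "Suc (2 * D) * (3 * D + 2 * r * D * D)"
  have "\<exists>v\<in>T. \<forall>F. fan E r v (T - {v}) F \<longrightarrow> card F \<le> ?k" if T: "T \<subseteq> V" "T \<noteq> {}" for T
  proof (rule ccontr)
    assume "\<not> ?thesis"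
    then obtain F where F: "\<And>v. v \<in> T \<Longrightarrow> fan E r v (T - {v}) (F v) \<and> Suc ?k \<le> card (F v)"
      by (metis not_less_eq_eq)
    have "Suc ?k \<le> ?k"
      by (rule not_all_fans_large[OF assms(1,4) _ T(2), of F]) (use T assms(3) F finite_subset in auto)
    then show False by simp
  qed
  from ranking_without_large_fans[OF assms(3) this] obtain f :: "'a \<Rightarrow> nat" where
    f: "inj_on f V" "\<forall>v\<in>V. \<forall>F. fan E r v {u \<in> V. f u < f v} F \<longrightarrow> card F \<le> ?k" by blast
  then have "\<forall>v\<in>V. finite (wreach E f r v) \<and> card (wreach E f r v) \<le> (1 + ?k * r) ^ r"
    using wreach_card[OF assms(2) f(1), of r ?k r] by blast
  then show ?thesis using f(1) by blast
qed

section \<open>Centred colourings\<close>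

definition connected_set :: "('a \<times> 'a) set \<Rightarrow> 'a set \<Rightarrow> bool" where
  "connected_set E X \<longleftrightarrow> X \<noteq> {} \<and> (\<forall>x\<in>X. \<forall>y\<in>X. \<exists>xs. walk E x xs y \<and> set xs \<subseteq> X)"

lemma connected_setD:
  "connected_set E X \<Longrightarrow> x \<in> X \<Longrightarrow> y \<in> X \<Longrightarrow> \<exists>xs. walk E x xs y \<and> set xs \<subseteq> X"
  by (simp add: connected_set_def)

text \<open>These are the \<open>p\<close>-centred colourings; the usual alternative that the
  connected set has more than \<open>p\<close> colours appears as a premise.\<close>

definition centred :: "('a \<times> 'a) set \<Rightarrow> 'a set \<Rightarrow> nat \<Rightarrow> ('a \<Rightarrow> nat) \<Rightarrow> bool" where
  "centred E V p c \<longleftrightarrow> (\<forall>X \<subseteq> V. connected_set E X \<longrightarrow> card (c ` X) \<le> p \<longrightarrow>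
     (\<exists>v\<in>X. \<forall>w\<in>X. c w = c v \<longrightarrow> w = v))"

lemma connected_set_walk:
  assumes "sym E" "walk E x xs y"
  shows "connected_set E (set xs)"
proof -
  have *: "\<exists>ys. walk E x ys z \<and> set ys \<subseteq> set xs" if z: "z \<in> set xs" for z
  proof -
    obtain as bs where "xs = as @ z # bs" using z by (meson split_list)
    then have "walk E x (as @ [z]) z" "set (as @ [z]) \<subseteq> set xs" using assms(2) walk_split by force+
    then show ?thesis by blast
  qed
  have "\<exists>zs. walk E a zs b \<and> set zs \<subseteq> set xs" if ab: "a \<in> set xs" "b \<in> set xs" for a b
  proof -
    obtain ys where ys: "walk E x ys a" "set ys \<subseteq> set xs" using * ab by blast
    obtain zs where zs: "walk E x zs b" "set zs \<subseteq> set xs" using * ab by blast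
    have "walk E a (rev ys @ tl zs) b" using walk_append[OF walk_rev[OF assms(1) ys(1)] zs(1)] .
    moreover have "set (rev ys @ tl zs) \<subseteq> set xs"
      using ys(2) zs(2) list.set_sel(2)[of zs] by (cases zs) auto
    ultimately show ?thesis by blast
  qed
  moreover have "set xs \<noteq> {}" using walk_ends[OF assms(2)] by auto
  ultimately show ?thesis by (simp add: connected_set_def)
qed

text \<open>The two claims feed each other. The \<open>f\<close>-least vertex \<open>v\<close> of
  \<open>X\<close> has a unique colour: up to the next vertex \<open>t\<close> of its colour a path
  uses one colour less, so by induction it can be shortened, and then \<open>v\<close> is weakly
  reachable from \<open>t\<close>. Conversely every vertex reaches \<open>v\<close> by a walk whose
  part before \<open>v\<close> has one colour less, and two such walks make up the walk claimed for
  \<open>Suc i\<close>.\<close>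

lemma unique_colour_and_short_walks:
  assumes "sym E" and f: "inj_on f V" and "E \<subseteq> V \<times> V"
    and c: "\<And>u v. u \<in> V \<Longrightarrow> v \<in> V \<Longrightarrow> u \<in> wreach E f (2 ^ p) v \<Longrightarrow> u \<noteq> v \<Longrightarrow> c u \<noteq> c v"
    and "i \<le> p" "X \<subseteq> V" "connected_set E X" "finite X" "card (c ` X) \<le> i"
  shows "(\<exists>v\<in>X. \<forall>w\<in>X. c w = c v \<longrightarrow> w = v) \<and>
    (\<forall>x\<in>X. \<forall>y\<in>X. \<exists>xs. walk E x xs y \<and> set xs \<subseteq> X \<and> length xs < 2 ^ i)"
  using assms(5-9)
proof (induction i arbitrary: X)
  case 0
  then show ?case by (auto simp: connected_set_def)
next
  case (Suc i)
  have IH: "\<exists>xs. walk E x xs y \<and> set xs \<subseteq> Y \<and> length xs < 2 ^ i"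
    if "Y \<subseteq> X" "connected_set E Y" "card (c ` Y) \<le> i" "x \<in> Y" "y \<in> Y" for Y x y
  proof -
    have "i \<le> p" "Y \<subseteq> V" using Suc.prems(1,2) that(1) by auto
    moreover have "finite Y" using that(1) Suc.prems(4) by (rule finite_subset)
    ultimately show ?thesis using Suc.IH[of Y] that(2-5) by simp
  qed
  have "X \<noteq> {}" using Suc.prems by (auto simp: connected_set_def)
  then have "Min (f ` X) \<in> f ` X" using Suc.prems(4) by (intro Min_in) auto
  then obtain v where v: "v \<in> X" "f v = Min (f ` X)" by auto
  then have v: "v \<in> X" "\<And>z. z \<in> X \<Longrightarrow> f v \<le> f z"
    using Suc.prems(4) by auto
  have few: "card (c ` Y) \<le> i" if "Y \<subseteq> X" "\<forall>z\<in>Y. c z \<noteq> c v" for Y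
  proof -
    have "c ` Y \<subseteq> c ` X - {c v}" using that by auto
    then have "card (c ` Y) \<le> card (c ` X - {c v})" using Suc.prems(4) by (intro card_mono) auto
    also have "\<dots> = card (c ` X) - 1" using v(1) by (simp add: card_Diff_singleton)
    finally show ?thesis using Suc.prems(5) by simp
  qed
  \<comment> \<open>Avoiding the colour of \<open>v\<close> leaves at most \<open>i\<close> colours,
    so the induction hypothesis applies to the vertex set of the walk.\<close>
  have shorten: "\<exists>ys. walk E x ys y \<and> set ys \<subseteq> set xs \<and> length ys < 2 ^ i"
    if "walk E x xs y" "set xs \<subseteq> X" "\<forall>z\<in>set xs. c z \<noteq> c v" for x xs y
    by (rule IH[OF that(2) connected_set_walk[OF assms(1) that(1)] few[OF that(2,3)]])
      (simp_all add: walk_ends[OF that(1)])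
  have uniq: "w = v" if w: "w \<in> X" "c w = c v" for w
  proof (rule ccontr)
    assume "w \<noteq> v"
    obtain xs where xs: "walk E v xs w" "set xs \<subseteq> X"
      using connected_setD[OF Suc.prems(3) v(1) w(1)] by blast
    obtain xs' where xs': "walk E v xs' w" "distinct xs'" "set xs' \<subseteq> X"
      using walk_to_path[OF xs(1)] xs(2) by blast
    obtain ys where ys: "xs' = v # ys" "ys \<noteq> []"
      using xs'(1) \<open>w \<noteq> v\<close> by (cases xs') (auto simp: walk_def split: if_splits)
    have "w \<in> set ys" using xs'(1) ys by (auto simp: walk_def)
    then obtain as t bs where t: "ys = as @ t # bs" "c t = c v" "\<forall>z\<in>set as. c z \<noteq> c v"
      using split_list_first_prop[of ys "\<lambda>z. c z = c v"] w(2) by blast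
    have "t \<noteq> v" "t \<in> X" using xs'(2,3) by (auto simp: ys t)
    have tv: "t \<in> V" "v \<in> V" using \<open>t \<in> X\<close> v(1) Suc.prems(2) by auto
    have wk: "walk E v (v # as @ [t]) t"
      using xs'(1) walk_split[of E v "v # as" t bs w] by (simp add: ys t)
    have "\<exists>zs. walk E v zs t \<and> set zs \<subseteq> X \<and> length zs \<le> Suc (2 ^ p)"
    proof (cases "as = []")
      case True
      then show ?thesis using wk v(1) \<open>t \<in> X\<close> by (intro exI[of _ "[v, t]"]) auto
    next
      case False
      have "walk E v (v # as) (last as)" "(last as, t) \<in> E"
        using wk False walk_snoc[of "v # as" E v t t] by simp_all
      then have "walk E (hd as) as (last as)" "(v, hd as) \<in> E"
        using False by (simp_all add: walk_Cons)
      moreover have "set as \<subseteq> X" using xs'(3) by (auto simp: ys t)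
      ultimately obtain zs where zs: "walk E (hd as) zs (last as)" "set zs \<subseteq> set as" "length zs < 2 ^ i"
        using shorten t(3) by blast
      have "zs \<noteq> []" "hd zs = hd as" "last zs = last as" using zs(1) by (auto simp: walk_def)
      have "walk E v (v # zs) (last as)"
        using zs(1) \<open>(v, hd as) \<in> E\<close> \<open>zs \<noteq> []\<close> \<open>hd zs = hd as\<close> by (simp add: walk_Cons)
      moreover have "walk E (last as) [last as, t] t" using \<open>(last as, t) \<in> E\<close> by simp
      ultimately have "walk E v ((v # zs) @ tl [last as, t]) t" by (rule walk_append)
      \<comment> \<open>Fewer than \<open>2 ^ i\<close> vertices in the middle plus the two ends
        \<open>v\<close> and \<open>t\<close> make at most \<open>Suc (2 ^ i)\<close>.\<close>
      moreover have "length ((v # zs) @ tl [last as, t]) \<le> Suc (2 ^ p)"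
      proof -
        have "(2::nat) ^ i \<le> 2 ^ p" using Suc.prems(1) by (intro power_increasing) auto
        moreover have "length ((v # zs) @ tl [last as, t]) = Suc (Suc (length zs))" by simp
        ultimately show ?thesis using zs(3) by linarith
      qed
      moreover have "set ((v # zs) @ tl [last as, t]) \<subseteq> X"
        using zs(2) \<open>set as \<subseteq> X\<close> v(1) \<open>t \<in> X\<close> by auto
      ultimately show ?thesis by blast
    qed
    then obtain zs where zs: "walk E v zs t" "set zs \<subseteq> X" "length zs \<le> Suc (2 ^ p)" by blast
    have "walk E t (rev zs) v" using walk_rev[OF assms(1) zs(1)] .
    then have "v \<in> wreach E f (2 ^ p) t"
      unfolding wreach_def using zs(2,3) v(2) by (intro CollectI exI[of _ "rev zs"]) auto
    then show False using c[OF tv(2,1)] \<open>t \<noteq> v\<close> t(2) by auto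
  qed
  have to_v: "\<exists>ys. walk E x ys v \<and> set ys \<subseteq> X \<and> length ys \<le> 2 ^ i" if x: "x \<in> X" for x
  proof -
    obtain xs where xs: "walk E x xs v" "set xs \<subseteq> X"
      using connected_setD[OF Suc.prems(3) x v(1)] by blast
    obtain xs' where xs': "walk E x xs' v" "distinct xs'" "set xs' \<subseteq> X"
      using walk_to_path[OF xs(1)] xs(2) by blast
    have ne: "xs' \<noteq> []" "last xs' = v" using xs'(1) by (auto simp: walk_def)
    show ?thesis
    proof (cases "butlast xs' = []")
      case True
      then have "xs' = [v]" using ne by (metis append_butlast_last_id append_Nil)
      then show ?thesis using xs'(1,3) by (intro exI[of _ xs']) auto
    next
      case False
      define as where "as = butlast xs'"
      have e: "xs' = as @ [v]" "as \<noteq> []"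
        using False ne append_butlast_last_id[OF ne(1)] by (simp_all add: as_def)
      have as: "walk E x as (last as)" "(last as, v) \<in> E"
        using xs'(1) walk_snoc[OF e(2)] unfolding e(1) by blast+
      have "v \<notin> set as" using xs'(2) by (simp add: e(1))
      moreover have "set as \<subseteq> X" using xs'(3) by (auto simp: as_def dest: in_set_butlastD)
      ultimately obtain ys where ys: "walk E x ys (last as)" "set ys \<subseteq> set as" "length ys < 2 ^ i"
        using shorten[OF as(1)] uniq by (metis subsetD)
      have "walk E (last as) [last as, v] v" using as(2) by simp
      from walk_append[OF ys(1) this] have "walk E x (ys @ [v]) v" by simp
      then show ?thesis using ys(2,3) \<open>set as \<subseteq> X\<close> v(1) by (intro exI[of _ "ys @ [v]"]) auto
    qed
  qed
  have "\<exists>xs. walk E x xs y \<and> set xs \<subseteq> X \<and> length xs < 2 ^ Suc i" if xy: "x \<in> X" "y \<in> X" for x y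
  proof -
    obtain ys where ys: "walk E x ys v" "set ys \<subseteq> X" "length ys \<le> 2 ^ i" using to_v xy by blast
    obtain zs where zs: "walk E y zs v" "set zs \<subseteq> X" "length zs \<le> 2 ^ i" using to_v xy by blast
    have "walk E x (ys @ tl (rev zs)) y" using walk_append[OF ys(1) walk_rev[OF assms(1) zs(1)]] .
    moreover have "zs \<noteq> []" using zs(1) by auto
    then have "set (ys @ tl (rev zs)) \<subseteq> X" "length (ys @ tl (rev zs)) < 2 ^ Suc i"
      using ys(2,3) zs(2,3) list.set_sel(2)[of "rev zs"] by (auto simp: in_set_butlastD) (cases zs; auto)
    ultimately show ?thesis by blast
  qed
  then show ?case using uniq v(1) by blast
qed

text \<open>Symmetrised weak reachability is \<open>N\<close>-degenerate: weak reachability only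
  goes down in \<open>f\<close>, so all neighbours of the \<open>f\<close>-largest vertex of
  \<open>T\<close> lie in its own weak reachability set.\<close>

lemma centred_coloring_exists:
  assumes "sym E" "E \<subseteq> V \<times> V" "finite V" and f: "inj_on f V"
    and w: "\<And>v. v \<in> V \<Longrightarrow> finite (wreach E f (2 ^ p) v) \<and> card (wreach E f (2 ^ p) v) \<le> N"
  shows "\<exists>c. c ` V \<subseteq> {..N} \<and> centred E V p c"
proof -
  let ?W = "wreach E f (2 ^ p)"
  let ?R = "{(u, v). u \<in> ?W v \<or> v \<in> ?W u}"
  have "\<exists>v\<in>T. card {u \<in> T. u \<noteq> v \<and> (u, v) \<in> ?R} \<le> N" if T: "T \<subseteq> V" "T \<noteq> {}" for T
  proof -
    have "finite T" using T assms(3) finite_subset by blast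
    then have "Max (f ` T) \<in> f ` T" using T(2) by (intro Max_in) auto
    then obtain v where v: "v \<in> T" "f v = Max (f ` T)" by auto
    have "{u \<in> T. u \<noteq> v \<and> (u, v) \<in> ?R} \<subseteq> ?W v"
    proof (rule subsetI, rule ccontr)
      fix u assume "u \<in> {u \<in> T. u \<noteq> v \<and> (u, v) \<in> ?R}" "u \<notin> ?W v"
      then have u: "u \<in> T" "u \<noteq> v" "v \<in> ?W u" by auto
      then have "f v \<le> f u" by (meson wreach_le)
      moreover have "f u \<le> f v" using v(2) u(1) \<open>finite T\<close> by simp
      ultimately show False using f u(1,2) v(1) T(1) by (metis inj_onD le_antisym subsetD)
    qed
    then have "card {u \<in> T. u \<noteq> v \<and> (u, v) \<in> ?R} \<le> card (?W v)"
      using w v(1) T(1) by (intro card_mono) auto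
    then show ?thesis using w[of v] v(1) T(1) by (intro bexI[of _ v]) auto
  qed
  moreover have "sym ?R" by (auto simp: sym_def)
  ultimately obtain c where c: "c ` V \<subseteq> {..N}" "\<forall>u\<in>V. \<forall>v\<in>V. (u, v) \<in> ?R \<longrightarrow> u \<noteq> v \<longrightarrow> c u \<noteq> c v"
    using degenerate_coloring[OF assms(3), of ?R N] by blast
  have "centred E V p c"
    unfolding centred_def
  proof (intro allI impI)
    fix X assume X: "X \<subseteq> V" "connected_set E X" "card (c ` X) \<le> p"
    then have "finite X" using assms(3) finite_subset by blast
    then show "\<exists>v\<in>X. \<forall>w\<in>X. c w = c v \<longrightarrow> w = v"
      using unique_colour_and_short_walks[OF assms(1) f assms(2), of p c p X] c(2) X by blast
  qed
  then show ?thesis using c(1) by blast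
qed

section \<open>Shallow minors, foldings and quotients\<close>

text \<open>Each branch set is represented by its \<open>f\<close>-least vertex. For an edge of the
  minor, the smaller representative is weakly reachable from the other one through the two branch
  sets: each contributes at most \<open>2 * p + 1\<close> vertices, going through its centre, hence
  \<open>4 * p + 1\<close> edges. So each branch set is charged at most \<open>N\<close> edges, and
  both orientations are counted.\<close>

lemma minor_density:
  fixes E :: "('a \<times> 'a) set" and M :: "('b \<times> 'b) set"
  assumes "sym E" and f: "inj_on f V"
    and N: "\<And>v. v \<in> V \<Longrightarrow> finite (wreach E f (4 * p + 1) v) \<and> card (wreach E f (4 * p + 1) v) \<le> N"
    and X: "finite X" "disjoint_family_on B X"
    and B: "\<And>x. x \<in> X \<Longrightarrow> finite (B x) \<and> B x \<subseteq> V \<and> c x \<in> B x"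
    and ball: "\<And>x v. x \<in> X \<Longrightarrow> v \<in> B x \<Longrightarrow> \<exists>xs. walk E (c x) xs v \<and> set xs \<subseteq> B x \<and> length xs \<le> Suc p"
    and M: "M \<subseteq> X \<times> X" "sym M" "irrefl M"
    and edge: "\<And>x y. (x, y) \<in> M \<Longrightarrow> \<exists>u\<in>B x. \<exists>v\<in>B y. (u, v) \<in> E"
  shows "card M \<le> 2 * N * card X"
proof -
  have "\<exists>m\<in>B x. \<forall>z\<in>B x. f m \<le> f z" if x: "x \<in> X" for x
  proof -
    have "Min (f ` B x) \<in> f ` B x" using B[OF x] by (intro Min_in) auto
    then obtain m where "m \<in> B x" "f m = Min (f ` B x)" by auto
    then show ?thesis using B[OF x] by (intro bexI[of _ m]) auto
  qed
  then obtain m where m: "\<And>x. x \<in> X \<Longrightarrow> m x \<in> B x" "\<And>x z. x \<in> X \<Longrightarrow> z \<in> B x \<Longrightarrow> f (m x) \<le> f z"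
    by metis
  have mV: "m x \<in> V" if "x \<in> X" for x using m(1)[OF that] B[OF that] by auto
  have minj: "x = y" if "x \<in> X" "y \<in> X" "m x = m y" for x y
    using X(2) m(1)[of x] m(1)[of y] that by (auto simp: disjoint_family_on_def)
  have to_m: "\<exists>xs. walk E v xs (m x) \<and> set xs \<subseteq> B x \<and> length xs \<le> Suc (2 * p)"
    if v: "x \<in> X" "v \<in> B x" for x v
  proof -
    obtain xs where xs: "walk E (c x) xs v" "set xs \<subseteq> B x" "length xs \<le> Suc p" using ball[OF v] by blast
    obtain ys where ys: "walk E (c x) ys (m x)" "set ys \<subseteq> B x" "length ys \<le> Suc p"
      using ball[OF v(1) m(1)[OF v(1)]] by blast
    have "walk E v (rev xs @ tl ys) (m x)" using walk_append[OF walk_rev[OF assms(1) xs(1)] ys(1)] .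
    moreover have "set (rev xs @ tl ys) \<subseteq> B x" using xs(2) ys(2) by (cases ys) auto
    moreover have "length (rev xs @ tl ys) \<le> Suc (2 * p)" using xs(3) ys(3) by simp
    ultimately show ?thesis by blast
  qed
  define L where "L = {(x, y). (x, y) \<in> M \<and> f (m x) < f (m y)}"
  have reach: "m x \<in> wreach E f (4 * p + 1) (m y)" if L: "(x, y) \<in> L" for x y
  proof -
    have xy: "(x, y) \<in> M" "x \<in> X" "y \<in> X" "f (m x) < f (m y)" using L M by (auto simp: L_def)
    obtain u v where uv: "u \<in> B x" "v \<in> B y" "(u, v) \<in> E" using edge[OF xy(1)] by blast
    obtain xs where xs: "walk E u xs (m x)" "set xs \<subseteq> B x" "length xs \<le> Suc (2 * p)"
      using to_m[OF xy(2) uv(1)] by blast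
    obtain ys where ys: "walk E v ys (m y)" "set ys \<subseteq> B y" "length ys \<le> Suc (2 * p)"
      using to_m[OF xy(3) uv(2)] by blast
    have "(v, u) \<in> E" using uv(3) assms(1) by (auto dest: symD)
    moreover have "hd xs = u" "xs \<noteq> []" using xs(1) by (auto simp: walk_def)
    ultimately have "walk E v (v # xs) (m x)" using xs(1) by (simp add: walk_Cons)
    from walk_append[OF walk_rev[OF assms(1) ys(1)] this]
    have "walk E (m y) (rev ys @ xs) (m x)" by simp
    moreover have "length (rev ys @ xs) \<le> Suc (4 * p + 1)" using xs(3) ys(3) by simp
    moreover have "\<forall>z\<in>set (rev ys @ xs). f (m x) \<le> f z"
    proof
      fix z assume "z \<in> set (rev ys @ xs)"
      then consider "z \<in> B x" | "z \<in> B y" using xs(2) ys(2) by auto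
      then show "f (m x) \<le> f z"
        using m(2)[OF xy(2), of z] m(2)[OF xy(3), of z] xy(4) by cases simp_all
    qed
    ultimately show ?thesis unfolding wreach_def by blast
  qed
  have "card L \<le> card (Sigma X (\<lambda>y. wreach E f (4 * p + 1) (m y)))"
  proof (rule card_inj_on_le)
    show "inj_on (\<lambda>(x, y). (y, m x)) L"
      using M(1) minj by (auto simp: inj_on_def L_def)
    show "(\<lambda>(x, y). (y, m x)) ` L \<subseteq> Sigma X (\<lambda>y. wreach E f (4 * p + 1) (m y))"
      using reach M(1) by (auto simp: L_def)
    show "finite (Sigma X (\<lambda>y. wreach E f (4 * p + 1) (m y)))"
      using X(1) N mV by (intro finite_SigmaI) auto
  qed
  also have "\<dots> = (\<Sum>y\<in>X. card (wreach E f (4 * p + 1) (m y)))"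
    using X(1) N mV by (intro card_SigmaI) auto
  also have "\<dots> \<le> (\<Sum>y\<in>X. N)" using N mV by (intro sum_mono) auto
  finally have cL: "card L \<le> N * card X" by (simp add: mult.commute)
  have "f (m x) \<noteq> f (m y)" if xy: "(x, y) \<in> M" for x y
  proof
    assume "f (m x) = f (m y)"
    moreover have "x \<in> X" "y \<in> X" using xy M(1) by auto
    ultimately have "x = y" using mV minj f by (metis inj_onD)
    then show False using xy M(3) by (auto simp: irrefl_def)
  qed
  then have "M \<subseteq> L \<union> L\<inverse>"
    using M(2) by (auto simp: L_def sym_def) (metis linorder_neqE_nat)
  moreover have "finite M" using M(1) X(1) by (meson finite_SigmaI finite_subset)
  then have "finite L" by (rule finite_subset[rotated]) (auto simp: L_def)
  ultimately have "card M \<le> card (L \<union> L\<inverse>)" by (intro card_mono) auto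
  also have "\<dots> \<le> card L + card (L\<inverse>)" by (rule card_Un_le)
  also have "card (L\<inverse>) = card L" by simp
  finally show ?thesis using cL by simp
qed

section \<open>Foldings of graphs with few colours\<close>

text \<open>The labels record adjacencies to vertices removed earlier in an induction, so that a
  folding of the rest extends to them.\<close>

definition folds :: "('a \<times> 'a) set \<Rightarrow> 'a set \<Rightarrow> ('a \<Rightarrow> nat) \<Rightarrow> nat \<Rightarrow> ('a \<Rightarrow> 'a) \<Rightarrow> bool" where
  "folds E V l M h \<longleftrightarrow> h ` V \<subseteq> V \<and> card (h ` V) \<le> M \<and>
     (\<forall>u\<in>V. \<forall>v\<in>V. (u, v) \<in> E \<longrightarrow> (h u, h v) \<in> E) \<and> (\<forall>v\<in>V. l (h v) = l v)"

definition component :: "('a \<times> 'a) set \<Rightarrow> 'a set \<Rightarrow> 'a \<Rightarrow> 'a set" where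
  "component E V v = {w. \<exists>xs. walk E v xs w \<and> set xs \<subseteq> V}"

lemma component_subset: "component E V v \<subseteq> V"
  unfolding component_def by (auto dest: walk_ends)

lemma component_self: "v \<in> V \<Longrightarrow> v \<in> component E V v"
  unfolding component_def by (auto intro!: exI[of _ "[v]"])

lemma component_trans:
  assumes "u \<in> component E V v" "w \<in> component E V u"
  shows "w \<in> component E V v"
proof -
  obtain xs ys where "walk E v xs u" "set xs \<subseteq> V" "walk E u ys w" "set ys \<subseteq> V"
    using assms by (auto simp: component_def)
  then have "walk E v (xs @ tl ys) w" "set (xs @ tl ys) \<subseteq> V"
    by (auto intro: walk_append dest: list.set_sel(2)[rotated])
  then show ?thesis unfolding component_def by blast
qed

lemma component_sym:
  assumes "sym E" "u \<in> component E V v"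
  shows "v \<in> component E V u"
proof -
  obtain xs where "walk E v xs u" "set xs \<subseteq> V" using assms(2) by (auto simp: component_def)
  then show ?thesis using walk_rev[OF assms(1)] unfolding component_def by (metis (mono_tags) mem_Collect_eq set_rev)
qed

lemma component_eq:
  assumes "sym E" "u \<in> component E V v"
  shows "component E V u = component E V v"
  using component_trans assms(2) component_sym[OF assms] by (metis subsetI subset_antisym)

lemma connected_component:
  assumes "sym E" "v \<in> V"
  shows "connected_set E (component E V v)"
  unfolding connected_set_def
proof (intro conjI ballI)
  show "component E V v \<noteq> {}" using component_self[OF assms(2)] by blast
  fix x y assume "x \<in> component E V v" "y \<in> component E V v"
  then have y: "y \<in> component E V x" using component_eq[OF assms(1)] by metis
  then obtain xs where xs: "walk E x xs y" "set xs \<subseteq> V" by (auto simp: component_def)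
  have "set xs \<subseteq> component E V x"
  proof
    fix z assume "z \<in> set xs"
    then obtain as bs where "xs = as @ z # bs" by (meson split_list)
    then have "walk E x (as @ [z]) z" "set (as @ [z]) \<subseteq> V" using xs walk_split[of E x as z bs y] by auto
    then show "z \<in> component E V x" unfolding component_def by blast
  qed
  also have "\<dots> = component E V v" using component_eq[OF assms(1)] \<open>x \<in> component E V v\<close> by metis
  finally show "\<exists>xs. walk E x xs y \<and> set xs \<subseteq> component E V v" using xs(1) by blast
qed

text \<open>The lowest bit of the new label keeps the folding of \<open>X - {v}\<close> from
  changing adjacency to \<open>v\<close>, so \<open>v\<close> can be put back as a fixed vertex; the
  other bits are the old label.\<close>

lemma folds_connected:
  assumes "sym E" "v \<in> X" "folds E (X - {v}) (\<lambda>w. 2 * l w + (if (w, v) \<in> E then 1 else 0)) M h" "finite X"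
  shows "folds E X l (Suc M) (h(v := v))"
proof -
  have h: "h ` (X - {v}) \<subseteq> X - {v}" "card (h ` (X - {v})) \<le> M"
    "\<And>u w. u \<in> X - {v} \<Longrightarrow> w \<in> X - {v} \<Longrightarrow> (u, w) \<in> E \<Longrightarrow> (h u, h w) \<in> E"
    "\<And>w. w \<in> X - {v} \<Longrightarrow> 2 * l (h w) + (if (h w, v) \<in> E then 1 else 0 :: nat) = 2 * l w + (if (w, v) \<in> E then 1 else 0)"
    using assms(3) unfolding folds_def by blast+
  have l: "l (h w) = l w" "(h w, v) \<in> E \<longleftrightarrow> (w, v) \<in> E" if "w \<in> X - {v}" for w
    using h(4)[OF that] by (auto split: if_splits; presburger)+
  have E': "(a, b) \<in> E \<longleftrightarrow> (b, a) \<in> E" for a b using assms(1) by (auto simp: sym_def)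
  have img: "(h(v := v)) ` X = insert v (h ` (X - {v}))" using assms(2) by auto
  show ?thesis
    unfolding folds_def img
  proof (intro conjI ballI impI)
    show "insert v (h ` (X - {v})) \<subseteq> X" using h(1) assms(2) by auto
    show "card (insert v (h ` (X - {v}))) \<le> Suc M"
      using h(2) assms(4) by (simp add: card_insert_if)
  next
    fix u w assume "u \<in> X" "w \<in> X" "(u, w) \<in> E"
    then show "((h(v := v)) u, (h(v := v)) w) \<in> E"
      using h(3)[of u w] l(2)[of u] l(2)[of w] E' by (cases "u = v"; cases "w = v") auto
  next
    fix w assume "w \<in> X"
    then show "l ((h(v := v)) w) = l w" using l(1)[of w] by (cases "w = v") auto
  qed
qed

text \<open>Components whose folded images are isomorphic as labelled graphs (which is recorded by the
  type \<open>\<tau>\<close>, after naming the vertices of the image by numbers below \<open>M\<close>) are mapped to the same image.\<close>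

lemma folds_components:
  fixes E :: "('a \<times> 'a) set"
  assumes "sym E" "finite V" and l: "l ` V \<subseteq> {..<m}"
    and fold: "\<And>v. v \<in> V \<Longrightarrow> \<exists>h. folds E (component E V v) l M h"
  shows "\<exists>h. folds E V l (2 ^ M * (2 ^ (M * M) * 2 ^ (M * m)) * M) h"
proof -
  define \<C> where "\<C> = component E V ` V"
  have sub: "X \<subseteq> V" if "X \<in> \<C>" for X using that component_subset[of E V] unfolding \<C>_def by blast
  have finX: "finite X" if "X \<in> \<C>" for X using sub[OF that] assms(2) finite_subset by blast
  have "\<forall>X\<in>\<C>. \<exists>h. folds E X l M h" using fold by (auto simp: \<C>_def)
  then obtain g where g: "\<And>X. X \<in> \<C> \<Longrightarrow> folds E X l M (g X)" by metis
  define Y where "Y X = g X ` X" for X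
  have Y: "Y X \<subseteq> X" "finite (Y X)" "card (Y X) \<le> M" if "X \<in> \<C>" for X
    using g[OF that] finX[OF that] by (auto simp: folds_def Y_def)
  have "\<exists>e. inj_on e (Y X) \<and> e ` Y X \<subseteq> {..<M}" if X: "X \<in> \<C>" for X
  proof -
    obtain e :: "'a \<Rightarrow> nat" where "bij_betw e (Y X) {0..<card (Y X)}"
      using ex_bij_betw_finite_nat[OF Y(2)[OF X]] by blast
    then show ?thesis using Y(3)[OF X] by (intro exI[of _ e]) (auto simp: bij_betw_def)
  qed
  then obtain e :: "'a set \<Rightarrow> 'a \<Rightarrow> nat" where e: "\<And>X. X \<in> \<C> \<Longrightarrow> inj_on (e X) (Y X)"
    "\<And>X. X \<in> \<C> \<Longrightarrow> e X ` Y X \<subseteq> {..<M}" by metis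
  define \<tau> where "\<tau> X = (e X ` Y X, {(e X a, e X b) | a b. a \<in> Y X \<and> b \<in> Y X \<and> (a, b) \<in> E},
    {(e X a, l a) | a. a \<in> Y X})" for X
  \<comment> \<open>The three factors hold the vertex sets, arc sets and labellings that a type can
    have; their sizes give the constant in the lemma.\<close>
  define \<T> where "\<T> = Pow {..<M} \<times> (Pow ({..<M} \<times> {..<M}) \<times> Pow ({..<M} \<times> {..<m}))"
  have \<tau>: "\<tau> X \<in> \<T>" if X: "X \<in> \<C>" for X
  proof -
    have "l a < m" if "a \<in> Y X" for a using that Y(1)[OF X] sub[OF X] l by blast
    then show ?thesis using e(2)[OF X] by (auto simp: \<tau>_def \<T>_def)
  qed
  have fin\<T>: "finite \<T>" and card\<T>: "card \<T> = 2 ^ M * (2 ^ (M * M) * 2 ^ (M * m))"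
    by (simp_all add: \<T>_def card_cartesian_product card_Pow)
  define \<rho> where "\<rho> t = (SOME X. X \<in> \<C> \<and> \<tau> X = t)" for t
  have \<rho>: "\<rho> (\<tau> X) \<in> \<C> \<and> \<tau> (\<rho> (\<tau> X)) = \<tau> X" if "X \<in> \<C>" for X
    unfolding \<rho>_def using someI[of "\<lambda>X'. X' \<in> \<C> \<and> \<tau> X' = \<tau> X" X] that by simp
  define K where "K v = component E V v" for v
  have K: "K v \<in> \<C>" "v \<in> K v" if "v \<in> V" for v
    using that component_self by (auto simp: K_def \<C>_def)
  define R where "R v = \<rho> (\<tau> (K v))" for v
  have R: "R v \<in> \<C>" "\<tau> (R v) = \<tau> (K v)" if "v \<in> V" for v
    using \<rho>[OF K(1)[OF that]] by (auto simp: R_def)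
  have KY: "g (K v) v \<in> Y (K v)" if "v \<in> V" for v using K(2)[OF that] by (auto simp: Y_def)
  \<comment> \<open>First fold the component of \<open>v\<close>, then move to the vertex with the
    same number in the representative component \<open>R v\<close>; equal types make this an
    isomorphism of labelled graphs.\<close>
  have "\<exists>w\<in>Y (R v). e (R v) w = e (K v) (g (K v) v)" if v: "v \<in> V" for v
  proof -
    have "e (R v) ` Y (R v) = e (K v) ` Y (K v)" using R(2)[OF v] by (simp add: \<tau>_def)
    then show ?thesis using KY[OF v] by (metis imageE imageI)
  qed
  then obtain h where h: "\<And>v. v \<in> V \<Longrightarrow> h v \<in> Y (R v)"
    "\<And>v. v \<in> V \<Longrightarrow> e (R v) (h v) = e (K v) (g (K v) v)" by metis
  have "folds E V l (card \<T> * M) h"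
    unfolding folds_def
  proof (intro conjI ballI impI)
    show "h ` V \<subseteq> V"
    proof
      fix x assume "x \<in> h ` V"
      then obtain v where "v \<in> V" "x = h v" by auto
      then show "x \<in> V" using h(1)[of v] Y(1)[OF R(1)[of v]] sub[OF R(1)[of v]] by auto
    qed
    have sub': "h ` V \<subseteq> (\<Union>t\<in>\<tau> ` \<C>. Y (\<rho> t))" using h(1) K(1) by (auto simp: R_def)
    have *: "finite (Y (\<rho> t))" "card (Y (\<rho> t)) \<le> M" if "t \<in> \<tau> ` \<C>" for t
      using that Y(2,3) \<rho> by auto
    have fin: "finite (\<tau> ` \<C>)" by (rule finite_subset[OF _ fin\<T>]) (use \<tau> in auto)
    have "finite (\<Union>t\<in>\<tau> ` \<C>. Y (\<rho> t))" using fin *(1) by (rule finite_UN_I)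
    then have "card (h ` V) \<le> card (\<Union>t\<in>\<tau> ` \<C>. Y (\<rho> t))"
      using sub' by (rule card_mono)
    also have "\<dots> \<le> (\<Sum>t\<in>\<tau> ` \<C>. card (Y (\<rho> t)))" using fin by (rule card_UN_le)
    also have "\<dots> \<le> (\<Sum>t\<in>\<tau> ` \<C>. M)" using * by (intro sum_mono)
    also have "\<dots> \<le> card \<T> * M" using card_mono[OF fin\<T>, of "\<tau> ` \<C>"] \<tau> by auto
    finally show "card (h ` V) \<le> card \<T> * M" .
  next
    fix u v assume uv: "u \<in> V" "v \<in> V" "(u, v) \<in> E"
    have "v \<in> component E V u"
      unfolding component_def using uv by (intro CollectI exI[of _ "[u, v]"]) auto
    then have Kuv: "K u = K v" using component_eq[OF assms(1)] by (simp add: K_def)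
    then have Ruv: "R u = R v" by (simp add: R_def)
    have "u \<in> K v" using K(2)[OF uv(1)] Kuv by simp
    then have "(g (K v) u, g (K v) v) \<in> E"
      using g[OF K(1)[OF uv(2)]] K(2)[OF uv(2)] uv(3) unfolding folds_def by blast
    then have "(e (K v) (g (K v) u), e (K v) (g (K v) v)) \<in> fst (snd (\<tau> (K v)))"
      using KY[OF uv(1)] KY[OF uv(2)] Kuv by (auto simp: \<tau>_def)
    then have "(e (R v) (h u), e (R v) (h v)) \<in> fst (snd (\<tau> (R v)))"
      using h(2)[OF uv(1)] h(2)[OF uv(2)] Kuv Ruv R(2)[OF uv(2)] by simp
    then obtain a b where ab: "e (R v) (h u) = e (R v) a" "e (R v) (h v) = e (R v) b"
      "a \<in> Y (R v)" "b \<in> Y (R v)" "(a, b) \<in> E" by (auto simp: \<tau>_def)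
    have "h u = a" "h v = b"
      using e(1)[OF R(1)[OF uv(2)]] ab h(1)[OF uv(1)] h(1)[OF uv(2)] Ruv by (auto dest: inj_onD)
    then show "(h u, h v) \<in> E" using ab by simp
  next
    fix v assume v: "v \<in> V"
    have "(e (K v) (g (K v) v), l (g (K v) v)) \<in> snd (snd (\<tau> (K v)))"
      using KY[OF v] by (auto simp: \<tau>_def)
    moreover have "l (g (K v) v) = l v"
      using g[OF K(1)[OF v]] K(2)[OF v] by (simp add: folds_def)
    ultimately have "(e (R v) (h v), l v) \<in> snd (snd (\<tau> (R v)))"
      using h(2)[OF v] R(2)[OF v] by simp
    then obtain a where a: "e (R v) (h v) = e (R v) a" "a \<in> Y (R v)" "l v = l a" by (auto simp: \<tau>_def)
    have "h v = a" using e(1)[OF R(1)[OF v]] a h(1)[OF v] by (auto dest: inj_onD)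
    then show "l (h v) = l v" using a by simp
  qed
  then show ?thesis unfolding card\<T> by blast
qed

text \<open>In each component the uniquely coloured vertex is removed, which leaves one colour less
  but doubles the range of labels; hence \<open>m\<close> varies in the induction. The bound
  \<open>M\<close> is chosen before the graph because it has to be uniform.\<close>

lemma centred_folds:
  "\<exists>M. \<forall>(E :: ('a \<times> 'a) set) V l c. sym E \<longrightarrow> finite V \<longrightarrow> l ` V \<subseteq> {..<m} \<longrightarrow> card (c ` V) \<le> i \<longrightarrow>
     centred E V i c \<longrightarrow> (\<exists>h. folds E V l M h)"
proof (induction i arbitrary: m)
  case 0
  have "\<exists>h. folds E V l 0 h" if "finite V" "card (c ` V) \<le> 0" for E :: "('a \<times> 'a) set" and V l and c :: "'a \<Rightarrow> nat"
  proof -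
    have "V = {}" using that by simp
    then show ?thesis by (simp add: folds_def)
  qed
  then show ?case by blast
next
  case (Suc i)
  obtain M where M: "\<And>(E :: ('a \<times> 'a) set) V l c. sym E \<Longrightarrow> finite V \<Longrightarrow> l ` V \<subseteq> {..<2 * m} \<Longrightarrow>
    card (c ` V) \<le> i \<Longrightarrow> centred E V i c \<Longrightarrow> \<exists>h. folds E V l M h"
    using Suc.IH[of "2 * m"] by blast
  \<comment> \<open>This is the constant of \<open>folds_components\<close> for images with
    \<open>Suc M\<close> vertices: \<open>M\<close> for the rest of the component and one for the
    removed vertex.\<close>
  have "\<exists>h. folds E V l (2 ^ Suc M * (2 ^ (Suc M * Suc M) * 2 ^ (Suc M * m)) * Suc M) h"
    if E: "sym E" and V: "finite V" and l: "l ` V \<subseteq> {..<m}" and c: "card (c ` V) \<le> Suc i" "centred E V (Suc i) c"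
    for E :: "('a \<times> 'a) set" and V l c
  proof (rule folds_components[OF E V l])
    fix x assume x: "x \<in> V"
    let ?X = "component E V x"
    have X: "?X \<subseteq> V" by (rule component_subset)
    have finX: "finite ?X" using X V finite_subset by blast
    have "card (c ` ?X) \<le> card (c ` V)" using X V by (intro card_mono) auto
    then have cX: "card (c ` ?X) \<le> Suc i" using c(1) by simp
    obtain v where v: "v \<in> ?X" "\<And>w. w \<in> ?X \<Longrightarrow> c w = c v \<Longrightarrow> w = v"
      using c(2) X connected_component[OF E x] cX unfolding centred_def by meson
    have "c ` (?X - {v}) \<subseteq> c ` ?X - {c v}" using v(2) by auto
    then have "card (c ` (?X - {v})) \<le> card (c ` ?X - {c v})" using finX by (intro card_mono) auto
    also have "\<dots> \<le> i" using cX v(1) finX by (simp add: card_Diff_singleton)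
    finally have cXv: "card (c ` (?X - {v})) \<le> i" .
    have "\<exists>h. folds E (?X - {v}) (\<lambda>w. 2 * l w + (if (w, v) \<in> E then 1 else 0)) M h"
    proof (rule M[OF E _ _ cXv])
      show "finite (?X - {v})" using finX by simp
      show "(\<lambda>w. 2 * l w + (if (w, v) \<in> E then 1 else 0)) ` (?X - {v}) \<subseteq> {..<2 * m}"
      proof (rule image_subsetI)
        fix w assume "w \<in> ?X - {v}"
        then have "l w < m" using X l by auto
        then show "2 * l w + (if (w, v) \<in> E then 1 else 0) \<in> {..<2 * m}" by auto
      qed
      show "centred E (?X - {v}) i c"
        unfolding centred_def
      proof (intro allI impI)
        fix Z assume Z: "Z \<subseteq> ?X - {v}" "connected_set E Z" "card (c ` Z) \<le> i"
        then have "Z \<subseteq> V" "card (c ` Z) \<le> Suc i" using X by auto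
        then show "\<exists>v\<in>Z. \<forall>w\<in>Z. c w = c v \<longrightarrow> w = v" using c(2) Z(2) unfolding centred_def by blast
      qed
    qed
    then show "\<exists>h. folds E ?X l (Suc M) h" using folds_connected[OF E v(1) _ finX] by blast
  qed
  then show ?case by blast
qed

text \<open>The two ends of a monochromatic edge would form a connected set with one colour and no
  uniquely coloured vertex.\<close>

lemma centred_proper:
  assumes "sym E" "centred E V p c" "1 \<le> p" "u \<in> V" "v \<in> V" "(u, v) \<in> E" "u \<noteq> v"
  shows "c u \<noteq> c v"
proof
  assume eq: "c u = c v"
  have "connected_set E (set [u, v])"
    by (rule connected_set_walk[OF assms(1), of u _ v]) (use assms in simp)
  moreover have "card (c ` set [u, v]) \<le> p" using eq assms(3) by simp
  moreover have "set [u, v] \<subseteq> V" using assms by simp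
  ultimately obtain x where "x \<in> set [u, v]" "\<forall>w\<in>set [u, v]. c w = c x \<longrightarrow> w = x"
    using assms(2) unfolding centred_def by meson
  then show False using eq assms(7) by auto
qed

section \<open>Quotients of bounded size\<close>

text \<open>The quotient by \<open>\<phi>\<close> stays implicit: \<open>\<psi>\<close> is a
  homomorphism into it from a graph with at most \<open>p\<close> vertices. The homomorphism
  \<open>\<chi>\<close> to the original graph need not lift \<open>\<psi>\<close>, since only its
  existence matters.\<close>

definition reflects :: "('a \<times> 'a) set \<Rightarrow> 'a set \<Rightarrow> nat \<Rightarrow> ('a \<Rightarrow> nat) \<Rightarrow> bool" where
  "reflects E V p \<phi> \<longleftrightarrow>
     (\<forall>(VF :: nat set) EF \<psi>. finite VF \<longrightarrow> card VF \<le> p \<longrightarrow> \<psi> ` VF \<subseteq> \<phi> ` V \<longrightarrow>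
        (\<forall>x y. (x, y) \<in> EF \<longrightarrow>
           x \<in> VF \<and> y \<in> VF \<and> (\<exists>u\<in>V. \<exists>v\<in>V. (u, v) \<in> E \<and> \<phi> u = \<psi> x \<and> \<phi> v = \<psi> y)) \<longrightarrow>
        (\<exists>\<chi>. \<chi> ` VF \<subseteq> V \<and> (\<forall>x y. (x, y) \<in> EF \<longrightarrow> (\<chi> x, \<chi> y) \<in> E)))"

text \<open>The quotient records the colour of a vertex together with its image under a folding of each
  subgraph induced by at most \<open>p\<close> colours. The image of a homomorphism from a graph with \<open>p\<close>
  vertices into the quotient sees only \<open>p\<close> colours \<open>I\<close>, and projecting it to the folding for \<open>I\<close>
  gives a homomorphism back to the original graph.\<close>

lemma centred_quotient:
  assumes "1 \<le> p"
  shows "\<exists>Q. \<forall>(E :: ('a \<times> 'a) set) V c. sym E \<longrightarrow> finite V \<longrightarrow> c ` V \<subseteq> {..N} \<longrightarrow> centred E V p c \<longrightarrow>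
    (\<exists>\<phi>. \<phi> ` V \<subseteq> {..<Q :: nat} \<and> (\<forall>u\<in>V. \<forall>v\<in>V. (u, v) \<in> E \<longrightarrow> u \<noteq> v \<longrightarrow> \<phi> u \<noteq> \<phi> v) \<and>
      reflects E V p \<phi>)"
proof -
  obtain M where M: "\<And>(E :: ('a \<times> 'a) set) V l c. sym E \<Longrightarrow> finite V \<Longrightarrow> l ` V \<subseteq> {..<1} \<Longrightarrow>
    card (c ` V) \<le> p \<Longrightarrow> centred E V p c \<Longrightarrow> \<exists>h. folds E V l M h"
    using centred_folds[of 1 p] by blast
  \<comment> \<open>One factor for the colour, and at most \<open>Suc M\<close> values for each of
    the \<open>2 ^ Suc N\<close> subsets of \<open>{..N}\<close>.\<close>
  define Q where "Q = Suc N * (Suc M) ^ (2 ^ Suc N)"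
  show ?thesis
  proof (intro exI[of _ Q] allI impI)
    fix E :: "('a \<times> 'a) set" and V and c :: "'a \<Rightarrow> nat"
    assume E: "sym E" and V: "finite V" and c: "c ` V \<subseteq> {..N}" "centred E V p c"
    define W where "W I = {v \<in> V. c v \<in> I}" for I
    define \<I> where "\<I> = {I. I \<subseteq> {..N} \<and> card I \<le> p}"
    have "\<exists>h. folds E (W I) (\<lambda>_. 0) M h" if I: "I \<in> \<I>" for I
    proof (rule M[OF E])
      show "finite (W I)" using V by (simp add: W_def)
      show "(\<lambda>_. 0 :: nat) ` W I \<subseteq> {..<1}" by auto
      have "c ` W I \<subseteq> I" by (auto simp: W_def)
      moreover have "finite I" using I by (auto simp: \<I>_def intro: finite_subset)
      ultimately have "card (c ` W I) \<le> card I" by (intro card_mono)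
      then show "card (c ` W I) \<le> p" using I by (simp add: \<I>_def)
      have "W I \<subseteq> V" by (auto simp: W_def)
      then show "centred E (W I) p c" using c(2) unfolding centred_def by (meson order_trans)
    qed
    then obtain h where h: "\<And>I. I \<in> \<I> \<Longrightarrow> folds E (W I) (\<lambda>_. 0) M (h I)" by metis
    define T where "T I = (if I \<in> \<I> then insert None (Some ` h I ` W I) else {None})" for I
    have T: "finite (T I)" "card (T I) \<le> Suc M" for I
    proof -
      have fin: "finite (W I)" using V by (simp add: W_def)
      then show "finite (T I)" by (simp add: T_def)
      show "card (T I) \<le> Suc M"
      proof (cases "I \<in> \<I>")
        case True
        then have "card (h I ` W I) \<le> M" using h by (simp add: folds_def)
        moreover have "card (Some ` h I ` W I) = card (h I ` W I)" by (simp add: card_image)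
        ultimately show ?thesis using True fin by (simp add: T_def card_insert_if)
      qed (simp add: T_def)
    qed
    \<comment> \<open>The value \<open>None\<close> stands for the colour sets that miss the colour
      of \<open>v\<close> or have more than \<open>p\<close> elements.\<close>
    define \<pi> where "\<pi> v = (c v, \<lambda>I\<in>Pow {..N}. if I \<in> \<I> \<and> c v \<in> I then Some (h I v) else None)" for v
    define P where "P = {..N} \<times> PiE (Pow {..N}) T"
    have \<pi>P: "\<pi> ` V \<subseteq> P"
    proof (rule image_subsetI)
      fix v assume "v \<in> V"
      then show "\<pi> v \<in> P"
        using c(1) unfolding \<pi>_def P_def by (auto simp: restrict_PiE_iff T_def W_def)
    qed
    have finP: "finite P" using T by (auto simp: P_def intro!: finite_PiE)
    have cP: "card P = Suc N * (\<Prod>I\<in>Pow {..N}. card (T I))"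
      by (simp add: P_def card_cartesian_product card_PiE)
    have "(\<Prod>I\<in>Pow {..N}. card (T I)) \<le> (\<Prod>I\<in>Pow {..N}. Suc M)"
      using T by (intro prod_mono) auto
    also have "\<dots> = Suc M ^ (2 ^ Suc N)" by (simp add: card_Pow)
    finally have "card P \<le> Q" unfolding cP Q_def by (rule mult_le_mono2)
    then have "card (\<pi> ` V) \<le> Q" using card_mono[OF finP \<pi>P] by simp
    obtain e :: "nat \<times> ('b0 \<Rightarrow> 'c0) \<Rightarrow> nat" where True by blast
    obtain e where e: "bij_betw e (\<pi> ` V) {0..<card (\<pi> ` V)}"
      using ex_bij_betw_finite_nat[of "\<pi> ` V"] V by blast
    define \<phi> where "\<phi> v = e (\<pi> v)" for v
    have \<phi>\<pi>: "\<phi> u = \<phi> v \<longleftrightarrow> \<pi> u = \<pi> v" if "u \<in> V" "v \<in> V" for u v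
      using e that by (auto simp: \<phi>_def bij_betw_def dest: inj_onD)
    show "\<exists>\<phi>. \<phi> ` V \<subseteq> {..<Q :: nat} \<and> (\<forall>u\<in>V. \<forall>v\<in>V. (u, v) \<in> E \<longrightarrow> u \<noteq> v \<longrightarrow> \<phi> u \<noteq> \<phi> v) \<and>
      reflects E V p \<phi>"
      unfolding reflects_def
    proof (intro exI[of _ \<phi>] conjI ballI allI impI)
      show "\<phi> ` V \<subseteq> {..<Q}"
      proof -
        have "\<phi> ` V = {0..<card (\<pi> ` V)}"
          using e by (simp add: \<phi>_def bij_betw_def image_image)
        then show ?thesis using \<open>card (\<pi> ` V) \<le> Q\<close> by auto
      qed
    next
      fix u v assume "u \<in> V" "v \<in> V" "(u, v) \<in> E" "u \<noteq> v"
      then have "c u \<noteq> c v" using centred_proper[OF E c(2) assms] by blast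
      then show "\<phi> u \<noteq> \<phi> v" using \<phi>\<pi>[OF \<open>u \<in> V\<close> \<open>v \<in> V\<close>] by (auto simp: \<pi>_def)
    next
      fix VF :: "nat set" and EF \<psi>
      assume VF: "finite VF" "card VF \<le> p" "\<psi> ` VF \<subseteq> \<phi> ` V"
        and EF: "\<forall>x y. (x, y) \<in> EF \<longrightarrow> x \<in> VF \<and> y \<in> VF \<and>
          (\<exists>u\<in>V. \<exists>v\<in>V. (u, v) \<in> E \<and> \<phi> u = \<psi> x \<and> \<phi> v = \<psi> y)"
      have "\<forall>x\<in>VF. \<exists>v\<in>V. \<phi> v = \<psi> x" using VF(3) by (metis imageE image_subset_iff)
      then obtain a where a: "\<And>x. x \<in> VF \<Longrightarrow> a x \<in> V" "\<And>x. x \<in> VF \<Longrightarrow> \<phi> (a x) = \<psi> x" by metis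
      define I where "I = c ` a ` VF"
      have "card I \<le> card VF" unfolding I_def using VF(1) by (meson card_image_le finite_imageI order_trans)
      then have I: "I \<in> \<I>" using VF(2) a(1) c(1) by (auto simp: \<I>_def I_def)
      have hI: "h I ` W I \<subseteq> W I" "\<And>u v. u \<in> W I \<Longrightarrow> v \<in> W I \<Longrightarrow> (u, v) \<in> E \<Longrightarrow> (h I u, h I v) \<in> E"
        using h[OF I] by (auto simp: folds_def)
      \<comment> \<open>An arc of the quotient comes from some \<open>u\<close>, \<open>v\<close>
        that need not be the chosen preimages; the coordinate at \<open>I\<close> ensures that their
        folded images agree with those of the chosen ones.\<close>
      have same: "c u = c v \<and> h I u = h I v" if uv: "u \<in> V" "v \<in> V" "\<phi> u = \<phi> v" "c v \<in> I" for u v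
      proof -
        have \<pi>: "\<pi> u = \<pi> v" using \<phi>\<pi> uv by blast
        then have "c u = c v" by (simp add: \<pi>_def)
        moreover have "I \<in> Pow {..N}" using I by (simp add: \<I>_def)
        moreover have "snd (\<pi> u) I = snd (\<pi> v) I" using \<pi> by simp
        ultimately show ?thesis using I uv(4) by (simp add: \<pi>_def)
      qed
      show "\<exists>\<chi>. \<chi> ` VF \<subseteq> V \<and> (\<forall>x y. (x, y) \<in> EF \<longrightarrow> (\<chi> x, \<chi> y) \<in> E)"
      proof (intro exI[of _ "\<lambda>x. h I (a x)"] conjI allI impI)
        show "(\<lambda>x. h I (a x)) ` VF \<subseteq> V"
          using hI(1) a(1) by (auto simp: W_def I_def image_subset_iff)
        fix x y assume "(x, y) \<in> EF"
        with EF obtain u v where uv: "x \<in> VF" "y \<in> VF" "u \<in> V" "v \<in> V" "(u, v) \<in> E" "\<phi> u = \<psi> x" "\<phi> v = \<psi> y"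
          by blast
        have "c (a x) \<in> I" "c (a y) \<in> I" using uv by (auto simp: I_def)
        then have "c u = c (a x) \<and> h I u = h I (a x)" "c v = c (a y) \<and> h I v = h I (a y)"
          using same[of u "a x"] same[of v "a y"] a uv by auto
        then show "(h I (a x), h I (a y)) \<in> E"
          using hI(2)[of u v] uv \<open>c (a x) \<in> I\<close> \<open>c (a y) \<in> I\<close> by (auto simp: W_def)
      qed
    qed
  qed
qed

section \<open>Odd closed walks and weighted subdivisions\<close>

lemma odd_girth_greater_iff:
  "odd_girth G > enat g \<longleftrightarrow>
     (\<forall>w. pre_digraph.cycle (with_proj G) w \<longrightarrow> odd (length w) \<longrightarrow> g < length w)"
proof -
  have "odd_girth G > enat g \<longleftrightarrow> enat (Suc g) \<le> odd_girth G" by (simp add: Suc_ile_eq)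
  also have "\<dots> \<longleftrightarrow> (\<forall>w. pre_digraph.cycle (with_proj G) w \<longrightarrow> odd (length w) \<longrightarrow> g < length w)"
    unfolding odd_girth_def le_INF_iff by (auto simp: Suc_le_eq)
  finally show ?thesis .
qed

lemma relpow_sym: "sym R \<Longrightarrow> (x, y) \<in> R ^^ n \<Longrightarrow> (y, x) \<in> R ^^ n"
proof (induction n arbitrary: x)
  case (Suc n)
  then obtain z where "(x, z) \<in> R" "(z, y) \<in> R ^^ n" by (meson relpow_Suc_D2)
  then show ?case using Suc by (metis relpow_Suc_I symD)
qed simp

lemma relpow_trans': "(x, y) \<in> R ^^ m \<Longrightarrow> (y, z) \<in> R ^^ n \<Longrightarrow> (x, z) \<in> R ^^ (m + n)"
  by (auto simp: relpow_add)

lemma relpow_image: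
  assumes "(x, y) \<in> R ^^ n" "\<And>u v. (u, v) \<in> R \<Longrightarrow> (f u, f v) \<in> R'"
  shows "(f x, f y) \<in> R' ^^ n"
  using assms(1)
proof (induction n arbitrary: y)
  case (Suc n)
  then obtain z where "(x, z) \<in> R ^^ n" "(z, y) \<in> R" by auto
  then show ?case using Suc.IH assms(2) by auto
qed simp

text \<open>The walk is prolonged by going back and forth along an edge at \<open>x\<close>, which
  exists because \<open>n\<close> is positive.\<close>

lemma closed_relpow_extend:
  assumes "sym R" "(x, x) \<in> R ^^ n" "1 \<le> n" "n \<le> m" "even (m - n)"
  shows "(x, x) \<in> R ^^ m"
proof -
  obtain k where "n = Suc k" using assms(3) by (cases n) auto
  then obtain y where "(x, y) \<in> R" using assms(2) by (meson relpow_Suc_D2)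
  then have two: "(x, x) \<in> R ^^ 2" using assms(1) by (auto simp: numeral_2_eq_2 dest: symD)
  obtain j where j: "m = n + 2 * j" using assms(4,5) by (metis dvdE le_add_diff_inverse)
  have "(x, x) \<in> R ^^ (n + 2 * j)"
  proof (induction j)
    case (Suc j)
    then show ?case using relpow_trans'[OF Suc two] by (simp add: add.assoc)
  qed (use assms(2) in simp)
  then show ?thesis by (simp add: j)
qed

lemma pcas_map: "pcas (h i) (map (\<lambda>i. (h i, h (Suc i))) [i..<i + k]) (h (i + k))"
proof (induction k arbitrary: i)
  case (Suc k)
  have "[i..<i + Suc k] = i # [Suc i..<Suc i + k]" by (simp add: upt_conv_Cons)
  then show ?case using Suc[of "Suc i"] by simp
qed simp

text \<open>A repeated vertex splits the closed walk into two shorter ones, and one of these has odd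
  length.\<close>

lemma odd_closed_walk_cycle:
  assumes "pair_wf_digraph G" "(x, x) \<in> parcs G ^^ n" "odd n"
  shows "\<exists>w. pre_digraph.cycle (with_proj G) w \<and> odd (length w) \<and> length w \<le> n"
  using assms(2,3)
proof (induction n arbitrary: x rule: less_induct)
  case (less n)
  interpret pair_wf_digraph G by fact
  obtain h where h: "h 0 = x" "h n = x" "\<And>i. i < n \<Longrightarrow> (h i, h (Suc i)) \<in> parcs G"
    using less.prems(1) by (auto simp: relpow_fun_conv)
  have n: "0 < n" using less.prems(2) by (cases n) auto
  have sub: "(h i, h j) \<in> parcs G ^^ (j - i)" if "i \<le> j" "j \<le> n" for i j
    unfolding relpow_fun_conv using that h(3) by (intro exI[of _ "\<lambda>k. h (i + k)"]) auto
  show ?case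
  proof (cases "\<exists>i j. i < j \<and> j < n \<and> h i = h j")
    case True
    then obtain i j where ij: "i < j" "j < n" "h i = h j" by blast
    have 1: "(h i, h i) \<in> parcs G ^^ (j - i)" using sub[of i j] ij by simp
    have "(h 0, h n) \<in> parcs G ^^ (i + (n - j))"
      using relpow_trans'[of "h 0" "h i" i "parcs G" "h n" "n - j"] sub[of 0 i] sub[of j n] ij by simp
    then have 2: "(x, x) \<in> parcs G ^^ (i + (n - j))" using h by simp
    show ?thesis
    proof (cases "odd (j - i)")
      case True
      then show ?thesis using less.IH[OF _ 1] ij by (meson diff_le_self le_trans less_imp_le less_imp_diff_less)
    next
      case False
      then have "odd (i + (n - j))" using less.prems(2) ij by presburger
      moreover have "i + (n - j) < n" using ij by simp
      ultimately show ?thesis using less.IH[OF _ 2] by fastforce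
    qed
  next
    case False
    then have inj: "\<And>i j. i < n \<Longrightarrow> j < n \<Longrightarrow> h i = h j \<Longrightarrow> i = j" by (metis nat_neq_iff)
    define w where "w = map (\<lambda>i. (h i, h (Suc i))) [0..<n]"
    have lw: "length w = n" "w \<noteq> []" using n by (auto simp: w_def)
    have "x \<in> pverts G" using h(3)[OF n] h(1) in_arcsD1 by auto
    moreover have "pcas x w x" using pcas_map[of h 0 n] h(1,2) by (simp add: w_def)
    ultimately have aw: "awalk x w x" using h(3) by (auto simp: awalk_def w_def)
    have "pawalk_verts x w = x # map snd w"
      using awalk_verts_conv'[of x w x] \<open>pcas x w x\<close> lw h(1) n by (simp add: w_def upt_conv_Cons)
    moreover have "distinct (map snd w)"
    proof -
      \<comment> \<open>A cycle is distinct on the tail of its vertex list, that is on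
        \<open>h 1\<close> up to \<open>h n\<close>, where \<open>h n\<close> takes the place of
        \<open>h 0\<close>.\<close>
      have "inj_on (\<lambda>i. h (Suc i)) {0..<n}"
      proof (rule inj_onI)
        fix i j assume ij: "i \<in> {0..<n}" "j \<in> {0..<n}" "h (Suc i) = h (Suc j)"
        show "i = j"
          using ij inj[of "Suc i" "Suc j"] inj[of 0 "Suc j"] inj[of "Suc i" 0] h(1,2) n
          by (cases "Suc i = n"; cases "Suc j = n") auto
      qed
      then show ?thesis by (simp add: w_def distinct_map o_def)
    qed
    ultimately have "cycle w" using aw lw unfolding cycle_def by auto
    then show ?thesis using lw less.prems(2) by auto
  qed
qed

lemma pcas_relpow: "pcas u w v \<Longrightarrow> set w \<subseteq> R \<Longrightarrow> (u, v) \<in> R ^^ length w"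
proof (induction w arbitrary: u)
  case (Cons e w)
  then have "(snd e, v) \<in> R ^^ length w" "(u, snd e) \<in> R" by auto
  then show ?case by (metis length_Cons relpow_Suc_I2)
qed simp

lemma cycle_relpow:
  assumes "pre_digraph.cycle (with_proj G) w"
  obtains x where "(x, x) \<in> parcs G ^^ length w" "w \<noteq> []"
proof -
  obtain u where u: "pre_digraph.awalk (with_proj G) u w u" "w \<noteq> []"
    using assms by (auto simp: pre_digraph.cycle_def)
  then have "pcas u w u" "set w \<subseteq> parcs G"
    by (auto simp: pre_digraph.awalk_def cas_with_proj_eq)
  then show ?thesis by (intro that[of u] pcas_relpow u(2))
qed

lemma odd_girth_greaterD:
  assumes "pair_wf_digraph G" "odd_girth G > enat g" "(x, x) \<in> parcs G ^^ n" "odd n" "n \<le> g"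
  shows False
proof -
  obtain w where "pre_digraph.cycle (with_proj G) w" "odd (length w)" "length w \<le> n"
    using odd_closed_walk_cycle[OF assms(1,3,4)] by blast
  moreover from this have "g < length w" using assms(2) by (simp add: odd_girth_greater_iff)
  ultimately show False using assms(5) by simp
qed

section \<open>Arc sets of minimum degree two\<close>

text \<open>A substitute for cycles that is easier to follow through subdivisions: no cyclic order
  has to be maintained. Both orientations are present, so cardinalities are twice the number of
  edges.\<close>

definition two_core :: "('a \<times> 'a) set \<Rightarrow> bool" where
  "two_core M \<longleftrightarrow> finite M \<and> M \<noteq> {} \<and> sym M \<and> (\<forall>u v. (u, v) \<in> M \<longrightarrow> (\<exists>w. w \<noteq> v \<and> (u, w) \<in> M))"

lemma pcas_nth:
  assumes "pcas u w v" "i < length w"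
  shows "fst (w ! i) = (if i = 0 then u else snd (w ! (i - 1)))"
  using assms
proof (induction w arbitrary: u i)
  case (Cons e w)
  then show ?case using Cons.IH[of "snd e" "i - 1"] by (cases i) (auto simp: nth_Cons')
qed simp

lemma pcas_last: "pcas u w v \<Longrightarrow> w \<noteq> [] \<Longrightarrow> snd (last w) = v"
proof (induction w arbitrary: u)
  case (Cons e w)
  then show ?case by (cases w) auto
qed simp

text \<open>Odd length and the absence of loops leave at least three arcs, so the predecessor and
  the successor of a vertex differ; a closed walk along a single edge would fail here.\<close>

lemma cycle_two_core:
  assumes "pair_graph G" "pre_digraph.cycle (with_proj G) w" "odd (length w)"
  shows "\<exists>M \<subseteq> parcs G. two_core M \<and> card M \<le> 2 * length w"
proof -
  interpret pair_graph G by fact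
  obtain u where u: "awalk u w u" "distinct (tl (pawalk_verts u w))" "w \<noteq> []"
    using assms(2) by (auto simp: cycle_def)
  then have c: "pcas u w u" "set w \<subseteq> parcs G" by (auto simp: awalk_def)
  define n where "n = length w"
  define s where "s i = snd (w ! i)" for i
  \<comment> \<open>Cyclic predecessor: the arc \<open>w ! i\<close> leads from
    \<open>s (pv i)\<close> to \<open>s i\<close>.\<close>
  define pv where "pv i = (if i = 0 then n - 1 else i - 1)" for i :: nat
  have n0: "0 < n" using u(3) by (simp add: n_def)
  have nth: "w ! i = (s (pv i), s i)" if "i < n" for i
  proof -
    have "s (n - 1) = u" using pcas_last[OF c(1) u(3)] u(3) by (simp add: s_def n_def last_conv_nth)
    then have "fst (w ! i) = s (pv i)" using pcas_nth[OF c(1), of i] that by (simp add: n_def s_def pv_def)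
    then show ?thesis by (simp add: s_def prod_eq_iff)
  qed
  have "pawalk_verts u w = fst (hd w) # map snd w"
    using awalk_verts_conv'[of u w u] c(1) u(3) by simp
  then have "distinct (map snd w)" using u(2) by simp
  then have inj: "i = j" if "i < n" "j < n" "s i = s j" for i j
    using that by (simp add: distinct_conv_nth n_def s_def) metis
  have "n \<noteq> 1"
  proof
    assume n1: "n = 1"
    then have "w ! 0 = (s 0, s 0)" using nth[of 0] by (simp add: pv_def)
    moreover have "w ! 0 \<in> parcs G" using c(2) n1 by (auto simp: n_def)
    ultimately show False using no_loops by fastforce
  qed
  moreover have "n \<noteq> 2" using assms(3) by (auto simp: n_def)
  ultimately have n3: "3 \<le> n" using n0 by linarith
  have pv: "pv i < n" if "i < n" for i using that by (auto simp: pv_def)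
  have pv2: "pv (pv i) \<noteq> i" if "i < n" for i using that n3 by (auto simp: pv_def)
  have surj: "\<exists>j<n. pv j = i" if "i < n" for i
    using that by (intro exI[of _ "if Suc i = n then 0 else Suc i"]) (auto simp: pv_def)
  define M where "M = set w \<union> (set w)\<inverse>"
  have arcM: "(s (pv i), s i) \<in> M" "(s i, s (pv i)) \<in> M" if "i < n" for i
    using nth[OF that] that nth_mem[of i w] by (auto simp: M_def n_def)
  have Mcases: "\<exists>i<n. (a, b) = (s (pv i), s i) \<or> (b, a) = (s (pv i), s i)" if "(a, b) \<in> M" for a b
    using that nth by (auto simp: M_def in_set_conv_nth n_def)
  have "two_core M"
    unfolding two_core_def
  proof (intro conjI allI impI)
    show "finite M" "M \<noteq> {}" "sym M" using u(3) by (auto simp: M_def sym_def)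
    fix a b assume "(a, b) \<in> M"
    then obtain i where i: "i < n" "(a, b) = (s (pv i), s i) \<or> (b, a) = (s (pv i), s i)" using Mcases by blast
    from i(2) show "\<exists>c. c \<noteq> b \<and> (a, c) \<in> M"
    proof
      assume ab: "(a, b) = (s (pv i), s i)"
      then have "s (pv (pv i)) \<noteq> b" using inj[of "pv (pv i)" i] pv pv2 i(1) by auto
      then show ?thesis using arcM(2)[of "pv i"] pv[OF i(1)] ab by auto
    next
      assume ab: "(b, a) = (s (pv i), s i)"
      obtain j where j: "j < n" "pv j = i" using surj i(1) by blast
      have "s j \<noteq> b" using inj[of j "pv i"] j pv pv2[of j] i(1) ab by auto
      then show ?thesis using arcM(1)[of j] j ab by auto
    qed
  qed
  moreover have "M \<subseteq> parcs G" using c(2) arcs_symmetric by (auto simp: M_def)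
  moreover have "card M \<le> card (set w) + card ((set w)\<inverse>)" unfolding M_def by (rule card_Un_le)
  then have "card M \<le> 2 * length w" using card_length[of w] by simp
  ultimately show ?thesis by blast
qed

section \<open>Weighted walks and repeated subdivision\<close>

inductive wwalk :: "('a \<times> 'a) set \<Rightarrow> ('a \<times> 'a \<Rightarrow> nat) \<Rightarrow> 'a \<Rightarrow> nat \<Rightarrow> 'a \<Rightarrow> bool" for R l where
  wwalk_refl: "wwalk R l x 0 x"
| wwalk_step: "wwalk R l x n y \<Longrightarrow> (y, z) \<in> R \<Longrightarrow> wwalk R l x (n + l (y, z)) z"

lemma wwalk_relpow:
  assumes "wwalk R l x n y" "\<And>e. e \<in> R \<Longrightarrow> l e = 1"
  shows "(x, y) \<in> R ^^ n"
  using assms(1)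
proof induction
  case (wwalk_step x n y z)
  then show ?case using assms(2)[of "(y, z)"] by auto
qed simp

text \<open>The new vertex \<open>w\<close> cuts off an edge of weight 1 at \<open>u\<close>, and
  the remaining weight stays at \<open>v\<close>; repeating this brings all weights down to
  1.\<close>

definition split_weight :: "('a \<times> 'a \<Rightarrow> nat) \<Rightarrow> 'a \<Rightarrow> 'a \<Rightarrow> 'a \<Rightarrow> 'a \<times> 'a \<Rightarrow> nat" where
  "split_weight l u v w e = (if e \<in> {(u, w), (w, u)} then 1
     else if e \<in> {(v, w), (w, v)} then l (u, v) - 1 else l e)"

text \<open>At \<open>w\<close> minimum degree two forces both halves of the subdivided edge into
  \<open>M\<close> or neither, so they can be merged again without changing the total
  weight.\<close>

lemma two_core_unsubdivide:
  assumes G: "pair_graph G" and uv: "(u, v) \<in> parcs G" and w: "w \<notin> pverts G"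
    and l: "l (v, u) = l (u, v)" "1 \<le> l (u, v)"
    and M: "M \<subseteq> parcs (subdivide G (u, v) w)" "two_core M"
  shows "\<exists>M' \<subseteq> parcs G. two_core M' \<and> sum l M' = sum (split_weight l u v w) M"
proof -
  interpret pair_graph G by fact
  have ne: "u \<noteq> v" "u \<noteq> w" "v \<noteq> w" using uv w no_loops' in_arcsD1 in_arcsD2 by auto
  have Gw: "(a, b) \<in> parcs G \<Longrightarrow> a \<noteq> w \<and> b \<noteq> w" for a b using w in_arcsD1 in_arcsD2 by auto
  have M': "(a, b) \<in> M \<Longrightarrow> (a, b) \<in> parcs G \<and> (a, b) \<noteq> (u, v) \<and> (a, b) \<noteq> (v, u) \<or>
      (a, b) \<in> {(u, w), (w, u), (w, v), (v, w)}" for a b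
    using M(1) by auto
  have symM: "(a, b) \<in> M \<Longrightarrow> (b, a) \<in> M" for a b using M(2) by (auto simp: two_core_def sym_def)
  have core: "(a, b) \<in> M \<Longrightarrow> \<exists>c. c \<noteq> b \<and> (a, c) \<in> M" for a b using M(2) unfolding two_core_def by blast
  have finM: "finite M" "M \<noteq> {}" using M(2) by (auto simp: two_core_def)
  show ?thesis
  proof (cases "\<exists>a. (w, a) \<in> M")
    case False
    have "M \<subseteq> parcs G"
    proof (rule subrelI)
      fix a b assume ab: "(a, b) \<in> M"
      then have "a \<noteq> w" "b \<noteq> w" using False symM by auto
      then show "(a, b) \<in> parcs G" using M'[OF ab] by auto
    qed
    moreover have "sum l M = sum (split_weight l u v w) M"
      using False symM by (intro sum.cong) (auto simp: split_weight_def)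
    ultimately show ?thesis using M(2) by blast
  next
    case True
    then obtain a where a: "(w, a) \<in> M" by blast
    then obtain b where b: "b \<noteq> a" "(w, b) \<in> M" using core by blast
    have "a \<in> {u, v}" "b \<in> {u, v}" using M'[OF a] M'[OF b(2)] Gw by auto
    then have wM: "(w, u) \<in> M" "(w, v) \<in> M" "(u, w) \<in> M" "(v, w) \<in> M" using a b symM by auto
    define B where "B = {(u, w), (w, u), (w, v), (v, w)}"
    define N where "N = (M - B) \<union> {(u, v), (v, u)}"
    have MB: "(a, b) \<in> M - B \<longleftrightarrow> (a, b) \<in> M \<and> a \<noteq> w \<and> b \<noteq> w" for a b
      using M' Gw ne by (auto simp: B_def)
    have NN: "(a, b) \<in> N \<longleftrightarrow> (a, b) \<in> M \<and> a \<noteq> w \<and> b \<noteq> w \<or> (a, b) = (u, v) \<or> (a, b) = (v, u)" for a b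
      using MB[of a b] by (auto simp: N_def)
    have uvM: "(u, v) \<notin> M" "(v, u) \<notin> M" using M' ne by blast+
    have "N \<subseteq> parcs G"
    proof (rule subrelI)
      fix a b assume "(a, b) \<in> N"
      then show "(a, b) \<in> parcs G" using M'[of a b] uv arcs_symmetric unfolding NN by auto
    qed
    moreover have "two_core N"
      unfolding two_core_def
    proof (intro conjI allI impI)
      show "finite N" "N \<noteq> {}" using finM by (auto simp: N_def)
      show "sym N" using symM by (auto simp: sym_def NN)
      fix a b assume ab: "(a, b) \<in> N"
      show "\<exists>c. c \<noteq> b \<and> (a, c) \<in> N"
      proof (cases "a = u \<or> a = v")
        case False
        then have "(a, b) \<in> M" "a \<noteq> w" using ab by (auto simp: NN)
        then obtain c where c: "c \<noteq> b" "(a, c) \<in> M" using core by blast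
        then have "c \<noteq> w" using M'[OF c(2)] False \<open>a \<noteq> w\<close> Gw by auto
        then show ?thesis using c \<open>a \<noteq> w\<close> by (auto simp: NN)
      next
        case True
        define d where "d = (if a = u then v else u)"
        have ad: "(a, d) \<in> N" "(a, w) \<in> M" "(a, d) \<notin> M" "a \<noteq> w"
          using True wM uvM ne by (auto simp: d_def NN)
        show ?thesis
        proof (cases "b = d")
          case False
          then show ?thesis using ad by (intro exI[of _ d]) simp
        next
          case eq: True
          \<comment> \<open>The neighbour of \<open>a\<close> in \<open>M\<close> other than
            \<open>w\<close> survives, and it differs from \<open>d\<close> because
            \<open>(a, d)\<close> is not in \<open>M\<close>.\<close>
          obtain c where "c \<noteq> w" "(a, c) \<in> M" using core[OF ad(2)] by blast
          then show ?thesis using eq ad by (intro exI[of _ c]) (auto simp: NN)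
        qed
      qed
    qed
    moreover have "sum l N = sum (split_weight l u v w) M"
    proof -
      have "sum l N = sum l (M - B) + sum l {(u, v), (v, u)}"
        unfolding N_def using finM uvM by (intro sum.union_disjoint) auto
      also have "sum l {(u, v), (v, u)} = 2 * l (u, v)" using ne l by simp
      also have "sum l (M - B) = sum (split_weight l u v w) (M - B)"
        by (intro sum.cong) (auto simp: split_weight_def B_def)
      also have "2 * l (u, v) = sum (split_weight l u v w) B"
        using ne l(2) by (simp add: B_def split_weight_def)
      also have "sum (split_weight l u v w) (M - B) + sum (split_weight l u v w) B = sum (split_weight l u v w) M"
        using finM wM by (subst sum.subset_diff[of B M]) (auto simp: B_def)
      finally show ?thesis .
    qed
    ultimately show ?thesis by blast
  qed
qed

lemma wwalk_subdivide:
  assumes G: "pair_graph G" and uv: "(u, v) \<in> parcs G" and w: "w \<notin> pverts G"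
    and l: "l (v, u) = l (u, v)" "1 \<le> l (u, v)" and walk: "wwalk (parcs G) l x n y"
  shows "wwalk (parcs (subdivide G (u, v) w)) (split_weight l u v w) x n y"
  using walk
proof induction
  case (wwalk_refl x)
  then show ?case by (rule wwalk.wwalk_refl)
next
  case (wwalk_step x n y z)
  interpret pair_graph G by fact
  let ?R = "parcs (subdivide G (u, v) w)" and ?l = "split_weight l u v w"
  have ne: "u \<noteq> v" "u \<noteq> w" "v \<noteq> w" "y \<noteq> w" "z \<noteq> w"
    using uv w no_loops' in_arcsD1 in_arcsD2 wwalk_step(2) by auto
  show ?case
  proof (cases "(y, z) \<in> {(u, v), (v, u)}")
    case False
    then have "(y, z) \<in> ?R" "?l (y, z) = l (y, z)" using wwalk_step ne by (auto simp: split_weight_def)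
    then show ?thesis using wwalk.wwalk_step[OF wwalk_step.IH, of z] by simp
  next
    case True
    then have "(y, w) \<in> ?R" "(w, z) \<in> ?R" by auto
    from wwalk.wwalk_step[OF wwalk.wwalk_step[OF wwalk_step.IH this(1)] this(2)]
    have "wwalk ?R ?l x (n + ?l (y, w) + ?l (w, z)) z" .
    moreover have "?l (y, w) + ?l (w, z) = l (y, z)"
      using True ne l by (auto simp: split_weight_def)
    ultimately show ?thesis by (simp add: add.assoc)
  qed
qed

text \<open>One subdivision at a time, by induction on the total excess of the weights over 1. Walks
  are carried forward and two cores are carried back; once all weights are 1, total weights are
  lengths and cardinalities.\<close>

lemma weighted_subdivision:
  fixes C :: "nat_graph set"
  assumes C: "topologically_closed C"
    and "G \<in> C" "pair_graph G"
    and "\<And>u v. (u, v) \<in> parcs G \<Longrightarrow> l (v, u) = l (u, v)" "\<And>e. e \<in> parcs G \<Longrightarrow> 1 \<le> l e"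
    and "\<And>M. M \<subseteq> parcs G \<Longrightarrow> two_core M \<Longrightarrow> m \<le> sum l M"
  shows "\<exists>G' \<in> C. pair_graph G' \<and> pverts G \<subseteq> pverts G' \<and>
    (\<forall>x y n. wwalk (parcs G) l x n y \<longrightarrow> (x, y) \<in> parcs G' ^^ n) \<and>
    (\<forall>M \<subseteq> parcs G'. two_core M \<longrightarrow> m \<le> card M)"
  using assms(2-6)
proof (induction "\<Sum>e\<in>parcs G. l e - 1" arbitrary: G l rule: less_induct)
  case less
  interpret pair_graph G by fact
  have fin: "finite (parcs G)" "finite (pverts G)" by (rule pair_finite_arcs pair_finite_verts)+
  show ?case
  proof (cases "\<forall>e\<in>parcs G. l e = 1")
    case True
    then have "sum l M = card M" if "M \<subseteq> parcs G" for M
      using that by (subst card_eq_sum) (intro sum.cong, auto)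
    then show ?thesis using less.prems wwalk_relpow[of "parcs G" l] True by (intro bexI[of _ G]) auto
  next
    case False
    then obtain u v where uv: "(u, v) \<in> parcs G" "l (u, v) \<noteq> 1" by auto
    then have luv: "2 \<le> l (u, v)" "l (v, u) = l (u, v)" using less.prems(4)[of "(u, v)"] less.prems(3)[of u v] by auto
    then have luv1: "1 \<le> l (u, v)" by simp
    obtain w where w: "w \<notin> pverts G" using fin(2) ex_new_if_finite[OF infinite_UNIV_nat] by blast
    let ?G = "subdivide G (u, v) w" and ?l = "split_weight l u v w"
    have ne: "u \<noteq> v" "u \<noteq> w" "v \<noteq> w" using uv w no_loops' in_arcsD1 in_arcsD2 by auto
    have vu: "(v, u) \<in> parcs G" using uv(1) arcs_symmetric by auto
    have "subdivision_pair G ?G"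
      by (rule subdivision_pair_divide[OF uv(1) w subdivision_pair_base]) unfold_locales
    then have GC: "?G \<in> C" using C less.prems(1) unfolding topologically_closed_def by blast
    have G': "pair_graph ?G" using uv(1) w by (rule pair_graph_subdivide)
    define A where "A = parcs G - {(u, v), (v, u)}"
    have A: "(a, b) \<in> A \<Longrightarrow> a \<noteq> w \<and> b \<noteq> w" for a b using w in_arcsD1 in_arcsD2 by (auto simp: A_def)
    have lA: "?l e = l e" if "e \<in> A" for e
      using that A by (cases e) (auto simp: split_weight_def)
    have arcs: "parcs ?G = A \<union> {(u, w), (w, u), (w, v), (v, w)}" by (simp add: A_def)
    have "(\<Sum>e\<in>parcs ?G. ?l e - 1) = (\<Sum>e\<in>A. ?l e - 1) + (\<Sum>e\<in>{(u, w), (w, u), (w, v), (v, w)}. ?l e - 1)"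
      unfolding arcs using fin(1) A by (intro sum.union_disjoint) (auto simp: A_def)
    moreover have "(\<Sum>e\<in>A. ?l e - 1) = (\<Sum>e\<in>A. l e - 1)" using lA by (intro sum.cong) auto
    moreover have "(\<Sum>e\<in>{(u, w), (w, u), (w, v), (v, w)}. ?l e - 1) = 2 * (l (u, v) - 2)"
      using ne by (simp add: split_weight_def)
    moreover have "(\<Sum>e\<in>{(u, v), (v, u)}. l e - 1) = 2 * (l (u, v) - 1)" using ne luv by simp
    moreover have "(\<Sum>e\<in>parcs G. l e - 1) = (\<Sum>e\<in>A. l e - 1) + (\<Sum>e\<in>{(u, v), (v, u)}. l e - 1)"
      unfolding A_def using fin(1) uv(1) vu by (intro sum.subset_diff) auto
    \<comment> \<open>The two arcs of the edge together lose 2 from the excess.\<close>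
    ultimately have decr: "(\<Sum>e\<in>parcs ?G. ?l e - 1) < (\<Sum>e\<in>parcs G. l e - 1)"
      using luv(1) by linarith
    have "\<exists>G' \<in> C. pair_graph G' \<and> pverts ?G \<subseteq> pverts G' \<and>
      (\<forall>x y n. wwalk (parcs ?G) ?l x n y \<longrightarrow> (x, y) \<in> parcs G' ^^ n) \<and>
      (\<forall>M \<subseteq> parcs G'. two_core M \<longrightarrow> m \<le> card M)"
    proof (rule less.hyps[of ?l ?G, OF decr GC G'])
      fix a b assume ab: "(a, b) \<in> parcs ?G"
      show "?l (b, a) = ?l (a, b)"
      proof (cases "(a, b) \<in> A")
        case True
        then have "(b, a) \<in> A" using arcs_symmetric by (auto simp: A_def)
        then show ?thesis using True lA less.prems(3)[of a b] by (simp add: A_def)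
      next
        case False
        then have "(a, b) \<in> {(u, w), (w, u), (w, v), (v, w)}" using ab unfolding arcs by blast
        then show ?thesis using ne by (auto simp: split_weight_def)
      qed
    next
      fix e assume e: "e \<in> parcs ?G"
      show "1 \<le> ?l e"
      proof (cases "e \<in> A")
        case True
        then show ?thesis using lA less.prems(4)[of e] by (simp add: A_def)
      next
        case False
        then have "e \<in> {(u, w), (w, u), (w, v), (v, w)}" using e unfolding arcs by blast
        then show ?thesis using ne luv(1) by (auto simp: split_weight_def)
      qed
    next
      fix M assume "M \<subseteq> parcs ?G" "two_core M"
      then obtain M' where "M' \<subseteq> parcs G" "two_core M'" "sum l M' = sum ?l M"
        using two_core_unsubdivide[where l = l, OF \<open>pair_graph G\<close> uv(1) w luv(2) luv1] by blast
      then show "m \<le> sum ?l M" using less.prems(5)[of M'] by simp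
    qed
    then obtain G' where "G' \<in> C" "pair_graph G'" "pverts ?G \<subseteq> pverts G'"
      "\<And>x y n. wwalk (parcs ?G) ?l x n y \<Longrightarrow> (x, y) \<in> parcs G' ^^ n"
      "\<forall>M \<subseteq> parcs G'. two_core M \<longrightarrow> m \<le> card M" by blast
    moreover have "wwalk (parcs ?G) ?l x n y" if "wwalk (parcs G) l x n y" for x y n
      using \<open>pair_graph G\<close> uv(1) w luv(2) luv1 that by (rule wwalk_subdivide)
    ultimately show ?thesis by (intro bexI[of _ G']) auto
  qed
qed

section \<open>Subdividing path families\<close>

definition path_edges :: "'a list \<Rightarrow> ('a \<times> 'a) set" where
  "path_edges p = (\<lambda>i. (p ! i, p ! Suc i)) ` {..<length p - 1} \<union> (\<lambda>i. (p ! Suc i, p ! i)) ` {..<length p - 1}"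

lemma path_edges_nth: "Suc i < length p \<Longrightarrow> (p ! i, p ! Suc i) \<in> path_edges p \<and> (p ! Suc i, p ! i) \<in> path_edges p"
  unfolding path_edges_def by (auto intro!: imageI)

lemma path_edgesE:
  assumes "(x, y) \<in> path_edges p"
  obtains i where "Suc i < length p" "x = p ! i" "y = p ! Suc i"
  | i where "Suc i < length p" "x = p ! Suc i" "y = p ! i"
proof -
  obtain i where "i < length p - 1" "(x, y) = (p ! i, p ! Suc i) \<or> (x, y) = (p ! Suc i, p ! i)"
    using assms unfolding path_edges_def by blast
  then show ?thesis using that(1)[of i] that(2)[of i] by auto
qed

lemma sym_path_edges: "(x, y) \<in> path_edges p \<Longrightarrow> (y, x) \<in> path_edges p"
  by (elim path_edgesE) (auto dest: path_edges_nth)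

lemma path_edges_set: "(x, y) \<in> path_edges p \<Longrightarrow> x \<in> set p \<and> y \<in> set p"
  by (elim path_edgesE) auto

lemma path_edges_irrefl: "distinct p \<Longrightarrow> (x, y) \<in> path_edges p \<Longrightarrow> x \<noteq> y"
  by (elim path_edgesE) (auto simp: nth_eq_iff_index_eq)

lemma path_edges_subset:
  assumes "sym E" "successively (\<lambda>a b. (a, b) \<in> E) p"
  shows "path_edges p \<subseteq> E"
proof (rule subrelI)
  fix x y assume "(x, y) \<in> path_edges p"
  then show "(x, y) \<in> E"
    using assms by (elim path_edgesE) (auto simp: successively_conv_nth dest: symD)
qed

lemma finite_path_edges [simp]: "finite (path_edges p)"
  by (simp add: path_edges_def)

lemma sum_path_edges:
  fixes l :: "'a \<times> 'a \<Rightarrow> nat"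
  assumes "distinct p" "\<And>x y. (x, y) \<in> path_edges p \<Longrightarrow> l (y, x) = l (x, y)"
  shows "sum l (path_edges p) = 2 * (\<Sum>i<length p - 1. l (p ! i, p ! Suc i))"
proof -
  let ?A = "(\<lambda>i. (p ! i, p ! Suc i)) ` {..<length p - 1}" and ?B = "(\<lambda>i. (p ! Suc i, p ! i)) ` {..<length p - 1}"
  have inj: "inj_on (\<lambda>i. (p ! i, p ! Suc i)) {..<length p - 1}" "inj_on (\<lambda>i. (p ! Suc i, p ! i)) {..<length p - 1}"
    using assms(1) by (auto intro!: inj_onI simp: nth_eq_iff_index_eq)
  have "?A \<inter> ?B = {}"
    using assms(1) by (auto simp: nth_eq_iff_index_eq)
  then have "sum l (path_edges p) = sum l ?A + sum l ?B"
    unfolding path_edges_def by (intro sum.union_disjoint) auto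
  also have "sum l ?A = (\<Sum>i<length p - 1. l (p ! i, p ! Suc i))"
    using inj(1) by (simp add: sum.reindex)
  also have "sum l ?B = (\<Sum>i<length p - 1. l (p ! Suc i, p ! i))"
    using inj(2) by (simp add: sum.reindex)
  also have "\<dots> = (\<Sum>i<length p - 1. l (p ! i, p ! Suc i))"
  proof (rule sum.cong)
    fix i assume "i \<in> {..<length p - 1}"
    then have "Suc i < length p" by auto
    then show "l (p ! Suc i, p ! i) = l (p ! i, p ! Suc i)" using assms(2) path_edges_nth by blast
  qed simp
  finally show ?thesis by simp
qed

lemma wwalk_path:
  assumes "successively (\<lambda>a b. (a, b) \<in> E) p" "n < length p"
  shows "wwalk E l (p ! 0) (\<Sum>i<n. l (p ! i, p ! Suc i)) (p ! n)"
  using assms(2)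
proof (induction n)
  case (Suc n)
  have "(p ! n, p ! Suc n) \<in> E" using assms(1) Suc.prems by (simp add: successively_conv_nth)
  then show ?case using wwalk_step[OF Suc.IH] Suc.prems by simp
qed (simp add: wwalk_refl)

text \<open>Consequently a second neighbour of an end is reached along another path; this forces a
  two core to go on beyond the ends of a path.\<close>

lemma path_edge_unique:
  assumes "distinct p" "(x, y) \<in> path_edges p" "(x, z) \<in> path_edges p" "x \<in> {hd p, last p}"
  shows "y = z"
proof -
  have p: "p \<noteq> []" "2 \<le> length p" using assms(2) by (auto elim: path_edgesE)
  have x: "x = p ! 0 \<or> x = p ! (length p - 1)" using assms(4) p by (auto simp: hd_conv_nth last_conv_nth)
  have one: "x = p ! 0 \<and> w = p ! 1 \<or> x = p ! (length p - 1) \<and> w = p ! (length p - 2)"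
    if "(x, w) \<in> path_edges p" for w
    using that
  proof (cases rule: path_edgesE)
    case (1 i)
    then have "i = 0" using x assms(1) p by (auto simp: nth_eq_iff_index_eq)
    then show ?thesis using 1 by simp
  next
    case (2 i)
    then have "Suc i = length p - 1" using x assms(1) p by (auto simp: nth_eq_iff_index_eq)
    then have "i = length p - 2" by simp
    then show ?thesis using 2 \<open>Suc i = length p - 1\<close> by simp
  qed
  have "p ! 0 \<noteq> p ! (length p - 1)" using assms(1) p by (auto simp: nth_eq_iff_index_eq)
  then show ?thesis using one[OF assms(2)] one[OF assms(3)] by auto
qed

section \<open>Two cores inside a path family\<close>

context
  fixes E :: "('a \<times> 'a) set" and r S K
  assumes symE: "sym E" and pf: "path_family E r S K"
begin

lemma path_familyD:
  assumes "p \<in> K"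
  shows "distinct p" "2 \<le> length p" "length p \<le> Suc r" "hd p \<in> S" "last p \<in> S" "inner p \<inter> S = {}"
    "successively (\<lambda>a b. (a, b) \<in> E) p" "set p = inner p \<union> {hd p, last p}" "hd p \<noteq> last p"
    "path_edges p \<subseteq> E"
proof -
  show *: "distinct p" "2 \<le> length p" "length p \<le> Suc r" "hd p \<in> S" "last p \<in> S" "inner p \<inter> S = {}"
    "successively (\<lambda>a b. (a, b) \<in> E) p"
    using pf assms unfolding path_family_def by blast+
  then have "p \<noteq> []" by auto
  then show "set p = inner p \<union> {hd p, last p}" by (auto simp: inner_def)
  show "hd p \<noteq> last p" using *(1,2) \<open>p \<noteq> []\<close> by (auto simp: hd_conv_nth last_conv_nth nth_eq_iff_index_eq)
  show "path_edges p \<subseteq> E" using path_edges_subset[OF symE *(7)] .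
qed

lemma path_family_disjoint:
  assumes "p \<in> K" "q \<in> K" "p \<noteq> q"
  shows "inner p \<inter> inner q = {}" "{hd p, last p} \<noteq> {hd q, last q}"
  using pf assms unfolding path_family_def by blast+

lemma inner_unique:
  assumes "p \<in> K" "q \<in> K" "x \<in> inner p" "x \<in> set q"
  shows "p = q"
proof (rule ccontr)
  assume "p \<noteq> q"
  then have "x \<notin> inner q" using path_family_disjoint[OF assms(1,2)] assms(3) by blast
  then have "x \<in> S" using path_familyD(4,5,8)[OF assms(2)] assms(4) by auto
  then show False using path_familyD(6)[OF assms(1)] assms(3) by blast
qed

text \<open>An inner vertex lies on one member only, so a common arc would join the ends of both
  members, which then have the same pair of ends.\<close>

lemma path_edges_unique:
  assumes "p \<in> K" "q \<in> K" "(x, y) \<in> path_edges p" "(x, y) \<in> path_edges q"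
  shows "p = q"
proof (rule ccontr)
  assume "p \<noteq> q"
  then have n: "x \<notin> inner p" "y \<notin> inner p" "x \<notin> inner q" "y \<notin> inner q"
    using inner_unique assms path_edges_set[OF assms(3)] path_edges_set[OF assms(4)] by blast+
  then have "x \<in> {hd p, last p}" "y \<in> {hd p, last p}" "x \<in> {hd q, last q}" "y \<in> {hd q, last q}"
    using path_familyD(8)[OF assms(1)] path_familyD(8)[OF assms(2)] path_edges_set[OF assms(3)]
      path_edges_set[OF assms(4)] by blast+
  moreover have "x \<noteq> y" using path_edges_irrefl assms(3) path_familyD(1)[OF assms(1)] by metis
  ultimately have "{hd p, last p} = {x, y}" "{hd q, last q} = {x, y}" by auto
  then show False using path_family_disjoint(2)[OF assms(1,2) \<open>p \<noteq> q\<close>] by simp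
qed

text \<open>Within the union of the paths, an inner vertex has only its two neighbours on its own
  path. Minimum degree two therefore passes membership in \<open>M\<close> from arc to arc along the
  whole path.\<close>

lemma two_core_contains_path:
  assumes M: "two_core M" "M \<subseteq> (\<Union>p\<in>K. path_edges p)" and p: "p \<in> K" "path_edges p \<inter> M \<noteq> {}"
  shows "path_edges p \<subseteq> M"
proof -
  have symM: "(a, b) \<in> M \<Longrightarrow> (b, a) \<in> M" for a b using M(1) by (auto simp: two_core_def sym_def)
  note pD = path_familyD[OF p(1)]
  have inner: "p ! i \<in> inner p" if "0 < i" "Suc i < length p" for i
  proof -
    have "p \<noteq> []" using that by auto
    then show ?thesis using that pD(1) by (auto simp: inner_def hd_conv_nth last_conv_nth nth_eq_iff_index_eq)
  qed
  have next_edge: "(p ! i, p ! Suc i) \<in> M \<longleftrightarrow> (p ! Suc i, p ! Suc (Suc i)) \<in> M"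
    if i: "Suc (Suc i) < length p" for i
  proof -
    let ?x = "p ! Suc i"
    have x: "?x \<in> inner p" using inner i by simp
    have nb: "y = p ! i \<or> y = p ! Suc (Suc i)" if y: "(?x, y) \<in> M" for y
    proof -
      obtain q where q: "q \<in> K" "(?x, y) \<in> path_edges q" using M(2) y by blast
      have "q = p" using inner_unique[OF p(1) q(1) x] path_edges_set[OF q(2)] by simp
      then have "(?x, y) \<in> path_edges p" using q(2) by simp
      then show ?thesis
      proof (cases rule: path_edgesE)
        case (1 j)
        then have "j = Suc i" using pD(1) i by (simp add: nth_eq_iff_index_eq)
        then show ?thesis using 1 by simp
      next
        case (2 j)
        then have "j = i" using pD(1) i by (simp add: nth_eq_iff_index_eq)
        then show ?thesis using 2 by simp
      qed
    qed
    have two: "\<exists>c. c \<noteq> b \<and> (a, c) \<in> M" if "(a, b) \<in> M" for a b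
      using M(1) that unfolding two_core_def by blast
    show ?thesis
    proof
      assume "(p ! i, ?x) \<in> M"
      then obtain c where "c \<noteq> p ! i" "(?x, c) \<in> M" using two symM by blast
      then show "(?x, p ! Suc (Suc i)) \<in> M" using nb by blast
    next
      assume "(?x, p ! Suc (Suc i)) \<in> M"
      then obtain c where "c \<noteq> p ! Suc (Suc i)" "(?x, c) \<in> M" using two by blast
      then show "(p ! i, ?x) \<in> M" using nb symM by blast
    qed
  qed
  obtain x y where xy: "(x, y) \<in> path_edges p" "(x, y) \<in> M" using p(2) by auto
  then obtain i where i: "Suc i < length p" "(p ! i, p ! Suc i) \<in> M"
    by (cases rule: path_edgesE) (use symM in blast)+
  have to0: "(p ! 0, p ! Suc 0) \<in> M \<longleftrightarrow> (p ! j, p ! Suc j) \<in> M" if "Suc j < length p" for j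
    using that
  proof (induction j)
    case (Suc j)
    then show ?case using next_edge[of j] by simp
  qed simp
  have all: "(p ! j, p ! Suc j) \<in> M" if "Suc j < length p" for j
    using to0[OF i(1)] to0[OF that] i(2) by simp
  show ?thesis
  proof (rule subrelI)
    fix a b assume "(a, b) \<in> path_edges p"
    then show "(a, b) \<in> M" by (cases rule: path_edgesE) (use all symM in auto)
  qed
qed

text \<open>At either end of a path in \<open>M\<close> another path has to continue. The two
  continuations differ, as a single one would join the same pair as the first path.\<close>

lemma two_core_contains_three_paths:
  assumes M: "two_core M" "M \<subseteq> (\<Union>p\<in>K. path_edges p)"
  shows "\<exists>p q q'. distinct [p, q, q'] \<and> {p, q, q'} \<subseteq> K \<and> path_edges p \<union> path_edges q \<union> path_edges q' \<subseteq> M"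
proof -
  have other: "\<exists>q\<in>K. q \<noteq> p \<and> s \<in> {hd q, last q} \<and> path_edges q \<subseteq> M"
    if p: "p \<in> K" "path_edges p \<subseteq> M" "s \<in> {hd p, last p}" for p s
  proof -
    note pD = path_familyD[OF p(1)]
    have "\<exists>y. (s, y) \<in> path_edges p"
    proof -
      have "p \<noteq> []" using pD(2) by auto
      then have "s = p ! 0 \<or> s = p ! (length p - 1)"
        using p(3) by (auto simp: hd_conv_nth last_conv_nth)
      moreover have "Suc (length p - 2) = length p - 1" "Suc (length p - 2) < length p" using pD(2) by auto
      ultimately show ?thesis
        using path_edges_nth[of 0 p] path_edges_nth[of "length p - 2" p] pD(2) by auto
    qed
    then obtain y where y: "(s, y) \<in> path_edges p" by blast
    then obtain z where z: "z \<noteq> y" "(s, z) \<in> M" using p(2) M(1) unfolding two_core_def by blast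
    then obtain q where q: "q \<in> K" "(s, z) \<in> path_edges q" using M(2) by blast
    have "q \<noteq> p" using path_edge_unique[OF pD(1) y _ p(3)] z q(2) by blast
    moreover have "s \<in> S" using p(3) pD(4,5) by auto
    then have "s \<in> {hd q, last q}"
      using path_familyD(6,8)[OF q(1)] path_edges_set[OF q(2)] by auto
    moreover have "path_edges q \<subseteq> M" by (rule two_core_contains_path[OF M q(1)]) (use q z in auto)
    ultimately show ?thesis using q(1) by blast
  qed
  obtain x y where "(x, y) \<in> M" using M(1) by (auto simp: two_core_def)
  then obtain p where p: "p \<in> K" "(x, y) \<in> path_edges p" using M(2) by blast
  have pM: "path_edges p \<subseteq> M" by (rule two_core_contains_path[OF M p(1)]) (use p \<open>(x, y) \<in> M\<close> in auto)
  obtain q where q: "q \<in> K" "q \<noteq> p" "hd p \<in> {hd q, last q}" "path_edges q \<subseteq> M"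
    using other[OF p(1) pM, of "hd p"] by auto
  obtain q' where q': "q' \<in> K" "q' \<noteq> p" "last p \<in> {hd q', last q'}" "path_edges q' \<subseteq> M"
    using other[OF p(1) pM, of "last p"] by auto
  have "q \<noteq> q'"
  proof
    assume "q = q'"
    then have "{hd p, last p} = {hd q, last q}" using q(3) q'(3) path_familyD(9)[OF p(1)] by auto
    then show False using path_family_disjoint(2)[OF p(1) q(1)] q(2) by auto
  qed
  then show ?thesis using p(1) pM q q' by (intro exI[of _ p] exI[of _ q] exI[of _ q']) auto
qed

definition owner :: "'a \<times> 'a \<Rightarrow> 'a list" where
  "owner e = (THE p. p \<in> K \<and> e \<in> path_edges p)"

lemma owner: "p \<in> K \<Longrightarrow> e \<in> path_edges p \<Longrightarrow> owner e = p"
  unfolding owner_def using path_edges_unique by (intro the_equality) (auto, metis surj_pair)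

text \<open>The weights give the members of \<open>X\<close> total length \<open>a\<close> and the other members of \<open>K\<close> total length
  \<open>a + 1\<close>, by adjusting the first edge only.\<close>

definition path_weight :: "nat \<Rightarrow> 'a list set \<Rightarrow> 'a \<times> 'a \<Rightarrow> nat" where
  "path_weight a X e = (if e \<in> (\<Union>p\<in>K. path_edges p) then
      (let p = owner e in if e \<in> {(p ! 0, p ! 1), (p ! 1, p ! 0)}
        then (if p \<in> X then a else Suc a) - (length p - 2) else 1)
    else 6 * a)"

lemma path_weight_eq:
  assumes "p \<in> K" "e \<in> path_edges p"
  shows "path_weight a X e = (if e \<in> {(p ! 0, p ! 1), (p ! 1, p ! 0)}
    then (if p \<in> X then a else Suc a) - (length p - 2) else 1)"
proof -
  have "e \<in> (\<Union>p\<in>K. path_edges p)" using assms by blast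
  then show ?thesis by (simp only: path_weight_def owner[OF assms] Let_def if_True)
qed

lemma path_weight_sum:
  assumes p: "p \<in> K" and "r \<le> a"
  shows "(\<Sum>i<length p - 1. path_weight a X (p ! i, p ! Suc i)) = (if p \<in> X then a else Suc a)"
proof -
  note pD = path_familyD[OF p]
  obtain n where n: "length p - 1 = Suc n" using pD(2) by (cases "length p - 1") auto
  have l: "path_weight a X (p ! i, p ! Suc i) = (if i = 0 then (if p \<in> X then a else Suc a) - n else 1)"
    if i: "i < Suc n" for i
  proof -
    have e: "(p ! i, p ! Suc i) \<in> path_edges p" using path_edges_nth[of i p] i n by simp
    have "(p ! i, p ! Suc i) \<in> {(p ! 0, p ! 1), (p ! 1, p ! 0)} \<longleftrightarrow> i = 0"
    proof -
      have "Suc i < length p" "0 < length p" using i n by auto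
      then have "p ! i = p ! 0 \<longleftrightarrow> i = 0" "p ! Suc i \<noteq> p ! 0" using pD(1) by (simp_all add: nth_eq_iff_index_eq)
      then show ?thesis by auto
    qed
    moreover have "length p - 2 = n" using n by simp
    ultimately show ?thesis unfolding path_weight_eq[OF p e] by simp
  qed
  have "(\<Sum>i<length p - 1. path_weight a X (p ! i, p ! Suc i)) =
    path_weight a X (p ! 0, p ! Suc 0) + (\<Sum>i<n. path_weight a X (p ! Suc i, p ! Suc (Suc i)))"
    unfolding n by (rule sum.lessThan_Suc_shift)
  also have "\<dots> = (if p \<in> X then a else Suc a) - n + n" using l by simp
  also have "\<dots> = (if p \<in> X then a else Suc a)" using pD(3) n assms(2) by simp
  finally show ?thesis .
qed

lemma path_weight_sym: "path_weight a X (y, x) = path_weight a X (x, y)"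
proof (cases "(x, y) \<in> (\<Union>p\<in>K. path_edges p)")
  case True
  then obtain p where p: "p \<in> K" "(x, y) \<in> path_edges p" by blast
  note q = sym_path_edges[OF p(2)]
  have "(y, x) \<in> {(p ! 0, p ! 1), (p ! 1, p ! 0)} \<longleftrightarrow> (x, y) \<in> {(p ! 0, p ! 1), (p ! 1, p ! 0)}" by auto
  then show ?thesis unfolding path_weight_eq[OF p] path_weight_eq[OF p(1) q] by simp
next
  case False
  then have "(y, x) \<notin> (\<Union>p\<in>K. path_edges p)" by (auto dest: sym_path_edges)
  then show ?thesis using False by (simp only: path_weight_def if_False)
qed

lemma path_weight_pos:
  assumes "r \<le> a" "1 \<le> a"
  shows "1 \<le> path_weight a X e"
proof (cases "e \<in> (\<Union>p\<in>K. path_edges p)")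
  case True
  then obtain p where p: "p \<in> K" "e \<in> path_edges p" by blast
  \<comment> \<open>At most \<open>r - 1\<close> edges follow the first one, so the truncated
    subtraction leaves it a positive weight.\<close>
  have "1 \<le> a - (length p - 2)" using path_familyD(2,3)[OF p(1)] assms by simp
  then show ?thesis unfolding path_weight_eq[OF p] by auto
next
  case False
  then show ?thesis using assms by (simp add: path_weight_def)
qed

text \<open>With both orientations counted, this is weight at least \<open>2 * a + 2\<close>, one
  more than the odd-girth bound. Three paths of length at least \<open>a\<close> reach it because
  \<open>2 \<le> a\<close>.\<close>

lemma path_weight_two_core:
  assumes M: "two_core M" and a: "r \<le> a" "2 \<le> a"
  shows "2 * (2 * a + 2) \<le> sum (path_weight a X) M"
proof (cases "M \<subseteq> (\<Union>p\<in>K. path_edges p)")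
  case False
  \<comment> \<open>An arc outside the paths suffices alone: its weight \<open>6 * a\<close> is at
    least \<open>2 * (2 * a + 2)\<close>.\<close>
  then obtain e where "e \<in> M" "e \<notin> (\<Union>p\<in>K. path_edges p)" by blast
  then have e: "e \<in> M" "path_weight a X e = 6 * a" by (simp_all add: path_weight_def)
  have "finite M" using M by (simp add: two_core_def)
  then have "path_weight a X e \<le> sum (path_weight a X) M" using e(1) by (intro member_le_sum) auto
  then show ?thesis using e(2) a(2) by simp
next
  case True
  obtain p q q' where pq: "distinct [p, q, q']" "{p, q, q'} \<subseteq> K"
    "path_edges p \<union> path_edges q \<union> path_edges q' \<subseteq> M"
    using two_core_contains_three_paths[OF M True] by blast
  have s: "2 * a \<le> sum (path_weight a X) (path_edges t)" if "t \<in> K" for t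
  proof -
    have "sum (path_weight a X) (path_edges t) = 2 * (if t \<in> X then a else Suc a)"
      using sum_path_edges[of t "path_weight a X"] path_weight_sum[OF that a(1)] path_weight_sym
        path_familyD(1)[OF that] by simp
    then show ?thesis by simp
  qed
  have disj: "path_edges t \<inter> path_edges t' = {}" if "t \<in> K" "t' \<in> K" "t \<noteq> t'" for t t'
    using path_edges_unique[OF that(1,2)] that(3) by auto
  have "6 * a \<le> sum (path_weight a X) (path_edges p) + sum (path_weight a X) (path_edges q)
      + sum (path_weight a X) (path_edges q')"
    using s[of p] s[of q] s[of q'] pq(2) by simp
  also have "\<dots> = sum (path_weight a X) (path_edges p \<union> path_edges q \<union> path_edges q')"
  proof -
    have "(path_edges p \<union> path_edges q) \<inter> path_edges q' = {}" "path_edges p \<inter> path_edges q = {}"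
      using disj[of p q'] disj[of q q'] disj[of p q] pq(1,2) by auto
    then show ?thesis by (simp add: sum.union_disjoint)
  qed
  also have "\<dots> \<le> sum (path_weight a X) M"
    using M pq(3) by (intro sum_mono2) (auto simp: two_core_def)
  finally show ?thesis using a(2) by simp
qed

end

text \<open>Two subdivisions of \<open>G\<close> that differ in the length of some path \<open>p\<close> of \<open>K\<close> cannot be mapped to \<open>H\<close>
  with the same images of the ends of the paths: the images of the two versions of \<open>p\<close> would form a
  closed walk of length \<open>2 a + 1\<close> in \<open>H\<close>. So there are at least \<open>2 ^ card K\<close> maps from the ends to \<open>H\<close>.\<close>

lemma hom_bound_sparse_path_families:
  fixes C :: "nat_graph set" and H :: nat_graph
  assumes C: "\<forall>G \<in> C. pair_graph G" "topologically_closed C"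
    and a: "r \<le> a" "2 \<le> a"
    and H: "pair_graph H" "odd_girth H > enat (2 * a + 1)"
    and hom: "\<And>G. G \<in> C \<Longrightarrow> odd_girth G > enat (2 * a + 1) \<Longrightarrow> has_hom G H"
    and G: "G \<in> C"
  shows "sparse_path_families (parcs G) r (card (pverts H))"
  unfolding sparse_path_families_def
proof (intro allI impI, rule ccontr)
  fix S K assume S: "finite S" and pf: "path_family (parcs G) r S K"
    and large: "\<not> card K \<le> card (pverts H) * card S"
  interpret G: pair_graph G using C(1) G by blast
  interpret H: pair_graph H by fact
  have symG: "sym (parcs G)" using G.arcs_symmetric by (auto simp: sym_def)
  have symH: "sym (parcs H)" using H.arcs_symmetric by (auto simp: sym_def)
  note pD = path_familyD[OF symG pf]
  have "\<exists>f. f ` pverts G \<subseteq> pverts H \<and>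
    (\<forall>p\<in>K. (f (hd p), f (last p)) \<in> parcs H ^^ (if p \<in> X then a else Suc a))" for X
  proof -
    let ?l = "path_weight K a X"
    obtain G' where G': "G' \<in> C" "pair_graph G'" "pverts G \<subseteq> pverts G'"
      "\<And>x y n. wwalk (parcs G) ?l x n y \<Longrightarrow> (x, y) \<in> parcs G' ^^ n"
      "\<And>M. M \<subseteq> parcs G' \<Longrightarrow> two_core M \<Longrightarrow> 2 * (2 * a + 2) \<le> card M"
      using weighted_subdivision[OF C(2) G G.pair_graph_axioms, of ?l "2 * (2 * a + 2)"]
        path_weight_sym[OF symG pf] path_weight_pos[OF symG pf a(1)] path_weight_two_core[OF symG pf _ a] a(2)
      by auto
    have "odd_girth G' > enat (2 * a + 1)"
      unfolding odd_girth_greater_iff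
    proof (intro allI impI)
      fix w assume "pre_digraph.cycle (with_proj G') w" "odd (length w)"
      then obtain M where "M \<subseteq> parcs G'" "two_core M" "card M \<le> 2 * length w"
        using cycle_two_core[OF G'(2)] by blast
      then show "2 * a + 1 < length w" using G'(5)[of M] by simp
    qed
    then obtain f where f: "f ` pverts G' \<subseteq> pverts H" "\<forall>(u, v)\<in>parcs G'. (f u, f v) \<in> parcs H"
      using hom[OF G'(1)] by (auto simp: has_hom_def)
    have "(f (hd p), f (last p)) \<in> parcs H ^^ (if p \<in> X then a else Suc a)" if p: "p \<in> K" for p
    proof -
      have ne: "p \<noteq> []" using pD(2)[OF p] by auto
      have "wwalk (parcs G) ?l (hd p) (if p \<in> X then a else Suc a) (last p)"
        using wwalk_path[OF pD(7)[OF p], of "length p - 1" ?l] path_weight_sum[OF symG pf p a(1), of X] ne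
        by (simp add: hd_conv_nth last_conv_nth)
      then have "(hd p, last p) \<in> parcs G' ^^ (if p \<in> X then a else Suc a)" by (rule G'(4))
      then show ?thesis by (rule relpow_image) (use f(2) in auto)
    qed
    then show ?thesis using f(1) G'(3) by (intro exI[of _ f]) auto
  qed
  then obtain f where f: "\<And>X. f X ` pverts G \<subseteq> pverts H"
    "\<And>X p. p \<in> K \<Longrightarrow> (f X (hd p), f X (last p)) \<in> parcs H ^^ (if p \<in> X then a else Suc a)" by metis
  have finK: "finite K" using pf by (simp add: path_family_def)
  \<comment> \<open>The set \<open>S\<close> may contain elements that are no vertices of
    \<open>G\<close>; maps are counted on the ends that occur.\<close>
  define T where "T = hd ` K \<union> last ` K"
  have TS: "T \<subseteq> S" using pD(4,5) by (auto simp: T_def)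
  have TV: "T \<subseteq> pverts G"
  proof
    fix x assume "x \<in> T"
    then obtain p where p: "p \<in> K" "x = hd p \<or> x = last p" by (auto simp: T_def)
    have "p ! 0 \<in> pverts G" "(p ! (length p - 2), p ! Suc (length p - 2)) \<in> parcs G"
      using pD(2,10)[OF p(1)] path_edges_nth[of 0 p] path_edges_nth[of "length p - 2" p] G.in_arcsD1 by auto
    moreover have "Suc (length p - 2) = length p - 1" "p \<noteq> []" using pD(2)[OF p(1)] by auto
    ultimately show "x \<in> pverts G" using p(2) G.in_arcsD2 by (auto simp: hd_conv_nth last_conv_nth)
  qed
  have finT: "finite T" using finK by (simp add: T_def)
  have "card (PiE T (\<lambda>_. pverts H)) = card (pverts H) ^ card T" using finT by (simp add: card_PiE)
  \<comment> \<open>Bounding \<open>card (pverts H)\<close> by its power of 2 makes the exponent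
    linear in \<open>card S\<close>, with the order of \<open>H\<close> as the factor.\<close>
  also have "\<dots> \<le> (2 ^ card (pverts H)) ^ card T" by (intro power_mono) auto
  also have "\<dots> \<le> 2 ^ (card (pverts H) * card S)"
    using TS S by (simp add: card_mono flip: power_mult)
  also have "\<dots> < 2 ^ card K" using large by simp
  also have "\<dots> = card (Pow K)" using finK by (simp add: card_Pow)
  finally have lt: "card (PiE T (\<lambda>_. pverts H)) < card (Pow K)" .
  have "\<not> inj_on (\<lambda>X. restrict (f X) T) (Pow K)"
  proof
    assume "inj_on (\<lambda>X. restrict (f X) T) (Pow K)"
    moreover have "(\<lambda>X. restrict (f X) T) ` Pow K \<subseteq> PiE T (\<lambda>_. pverts H)"
    proof (rule image_subsetI)
      fix X
      have "f X x \<in> pverts H" if "x \<in> T" for x using f(1)[of X] TV that by blast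
      then show "restrict (f X) T \<in> PiE T (\<lambda>_. pverts H)" by simp
    qed
    moreover have "finite (PiE T (\<lambda>_. pverts H))" using finT H.pair_finite_verts by (intro finite_PiE) auto
    ultimately show False using lt card_inj_on_le by (metis not_le)
  qed
  then obtain X Y where XY: "X \<subseteq> K" "Y \<subseteq> K" "X \<noteq> Y" "restrict (f X) T = restrict (f Y) T"
    by (auto simp: inj_on_def)
  \<comment> \<open>Stated for any two sets because the path that distinguishes \<open>X\<close>
    from \<open>Y\<close> may lie in either of them.\<close>
  have contra: False if "X \<subseteq> K" "restrict (f X) T = restrict (f Y) T" "p \<in> X" "p \<notin> Y" for X Y p
  proof -
    have p: "p \<in> K" using that by auto
    then have "hd p \<in> T" "last p \<in> T" by (auto simp: T_def)
    then have eq: "f X (hd p) = f Y (hd p)" "f X (last p) = f Y (last p)"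
      using that(2) by (metis restrict_apply')+
    have "(f X (hd p), f X (last p)) \<in> parcs H ^^ a" "(f X (hd p), f X (last p)) \<in> parcs H ^^ Suc a"
      using f(2)[OF p, of X] f(2)[OF p, of Y] that(3,4) unfolding eq by simp_all
    then have "(f X (hd p), f X (hd p)) \<in> parcs H ^^ (a + Suc a)"
      using relpow_trans' relpow_sym[OF symH] by metis
    then show False
      using odd_girth_greaterD[OF H.pair_wf_digraph H(2)] by fastforce
  qed
  show False using contra[of X Y] contra[of Y X] XY by fastforce
qed

section \<open>Restricted dualities\<close>

lemma pair_graphI:
  assumes "finite (pverts G)" "parcs G \<subseteq> pverts G \<times> pverts G" "sym (parcs G)" "irrefl (parcs G)"
  shows "pair_graph G"
proof -
  have "finite (parcs G)" using assms(1,2) by (meson finite_SigmaI finite_subset)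
  then show ?thesis
    using assms by unfold_locales (auto simp: symmetric_def irrefl_def)
qed

lemma pair_graphD:
  assumes "pair_graph G"
  shows "finite (pverts G)" "parcs G \<subseteq> pverts G \<times> pverts G" "sym (parcs G)" "irrefl (parcs G)"
    "finite (parcs G)"
proof -
  interpret pair_graph G by fact
  show "finite (pverts G)" "finite (parcs G)" by (rule pair_finite_verts pair_finite_arcs)+
  show "parcs G \<subseteq> pverts G \<times> pverts G" using in_arcsD1 in_arcsD2 by auto
  show "sym (parcs G)" using arcs_symmetric by (auto simp: sym_def)
  show "irrefl (parcs G)" using no_loops' by (auto simp: irrefl_def)
qed

lemma average_degree_eq:
  assumes "pair_graph G"
  shows "average_degree G = real (card (parcs G)) / real (card (pverts G))"
proof -
  note G = pair_graphD[OF assms]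
  have "card (parcs G) = card (\<Union>v\<in>pverts G. {e \<in> parcs G. fst e = v})"
    using G(2) by (intro arg_cong[where f = card]) auto
  also have "\<dots> = (\<Sum>v\<in>pverts G. card {e \<in> parcs G. fst e = v})"
    using G(1,5) by (intro card_UN_disjoint) auto
  finally show ?thesis
    by (simp add: average_degree_def out_degree_def out_arcs_def flip: of_nat_sum)
qed

lemma induced_awalk_iff:
  "pre_digraph.awalk (with_proj G \<restriction> B) u w v \<longleftrightarrow>
     u \<in> B \<and> set w \<subseteq> {e \<in> parcs G. fst e \<in> B \<and> snd e \<in> B} \<and> pcas u w v"
proof -
  have "pre_digraph.cas (with_proj G \<restriction> B) u w v \<longleftrightarrow> pcas u w v"
    by (induction w arbitrary: u) (auto simp: pre_digraph.cas.simps)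
  then show ?thesis by (simp add: pre_digraph.awalk_def)
qed

lemma induced_awalk_walk:
  assumes "pre_digraph.awalk (with_proj G \<restriction> B) u w v"
  shows "\<exists>xs. walk (parcs G) u xs v \<and> set xs \<subseteq> B \<and> length xs = Suc (length w)"
  using assms
proof (induction w arbitrary: u)
  case Nil
  then show ?case by (intro exI[of _ "[u]"]) (auto simp: induced_awalk_iff)
next
  case (Cons e w)
  then have e: "e \<in> parcs G" "fst e = u" "u \<in> B" "pre_digraph.awalk (with_proj G \<restriction> B) (snd e) w v"
    by (auto simp: induced_awalk_iff)
  obtain xs where xs: "walk (parcs G) (snd e) xs v" "set xs \<subseteq> B" "length xs = Suc (length w)"
    using Cons.IH[OF e(4)] by blast
  moreover have "xs \<noteq> []" "hd xs = snd e" using xs(1) by (auto simp: walk_def)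
  moreover have "(u, snd e) \<in> parcs G" using e(1,2) by (metis prod.collapse)
  ultimately show ?case using e(3) by (intro exI[of _ "u # xs"]) (simp add: walk_Cons)
qed

section \<open>Uniform sparsity and bounded expansion\<close>

definition uniformly_sparse :: "nat_graph set \<Rightarrow> bool" where
  "uniformly_sparse C \<longleftrightarrow> (\<forall>r. \<exists>D. \<forall>G \<in> C. sparse_path_families (parcs G) r D)"

text \<open>The branch set of \<open>s\<close> consists of \<open>s\<close> and the interiors of the
  members that start at \<open>s\<close>; along such a member all of its interior is within
  \<open>r\<close> steps of \<open>s\<close>.\<close>

lemma path_family_shallow_minor:
  assumes G: "pair_graph G" and pf: "path_family (parcs G) r S K"
  shows "shallow_minor r \<lparr>pverts = S \<inter> pverts G, parcs = ends_rel K\<rparr> G"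
proof -
  interpret G: pair_graph G by fact
  note GD = pair_graphD[OF G]
  note pD = path_familyD[OF GD(3) pf]
  let ?T = "S \<inter> pverts G"
  let ?H = "\<lparr>pverts = ?T, parcs = ends_rel K\<rparr>"
  have nthV: "p ! i \<in> pverts G" if "p \<in> K" "i < length p" for p i
  proof -
    have "walk (parcs G) (hd p) p (last p)" "2 \<le> length p" using pD(2,7)[OF that(1)] by (auto simp: walk_def)
    then have "set p \<subseteq> Field (parcs G)" by (rule walk_Field)
    then have "p ! i \<in> Field (parcs G)" using nth_mem[OF that(2)] by blast
    then show ?thesis using GD(2) by (auto simp: Field_def)
  qed
  have setV: "set p \<subseteq> pverts G" if "p \<in> K" for p
    using nthV[OF that] by (auto simp: in_set_conv_nth)
  have endsT: "hd p \<in> ?T" "last p \<in> ?T" if "p \<in> K" for p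
  proof -
    have "p \<noteq> []" using pD(2)[OF that] by auto
    then have "hd p \<in> pverts G" "last p \<in> pverts G" using setV[OF that] by auto
    then show "hd p \<in> ?T" "last p \<in> ?T" using pD(4,5)[OF that] by auto
  qed
  have H: "pair_graph ?H"
  proof (rule pair_graphI)
    show "finite (pverts ?H)" using GD(1) by simp
    show "parcs ?H \<subseteq> pverts ?H \<times> pverts ?H" using endsT by (auto simp: ends_rel_def)
    show "sym (parcs ?H)" using sym_ends_rel by simp
    have "x \<noteq> y" if xy: "(x, y) \<in> ends_rel K" for x y
    proof -
      obtain p where "p \<in> K" "(x, y) = (hd p, last p) \<or> (x, y) = (last p, hd p)"
        using xy by (auto simp: ends_rel_def)
      then show ?thesis using pD(9)[of p] by auto
    qed
    then show "irrefl (parcs ?H)" by (auto simp: irrefl_def)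
  qed
  define B where "B s = insert s (\<Union>p\<in>{p \<in> K. hd p = s}. inner p)" for s
  have BI: "x \<in> B (hd p)" if "p \<in> K" "x \<in> inner p" for x p using that by (auto simp: B_def)
  \<comment> \<open>The interior belongs to the start of the member, so the arc between the two
    branch sets is the last one. For a single edge the penultimate vertex is the start
    itself.\<close>
  have penult: "p ! (length p - 2) \<in> B (hd p)" "(p ! (length p - 2), last p) \<in> parcs G" if p: "p \<in> K" for p
  proof -
    have l: "Suc (length p - 2) = length p - 1" "Suc (length p - 2) < length p" "p \<noteq> []" using pD(2)[OF p] by auto
    show "(p ! (length p - 2), last p) \<in> parcs G"
    proof -
      have "(p ! (length p - 2), p ! Suc (length p - 2)) \<in> parcs G"
        using pD(7)[OF p] l(2) by (simp add: successively_conv_nth)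
      then show ?thesis using l(3) unfolding l(1) by (simp add: last_conv_nth)
    qed
    have "p ! (length p - 2) \<noteq> last p"
      using l pD(1)[OF p] by (auto simp: last_conv_nth nth_eq_iff_index_eq)
    then show "p ! (length p - 2) \<in> B (hd p)"
      using BI[OF p] l by (cases "p ! (length p - 2) = hd p") (auto simp: inner_def B_def)
  qed
  have "disjoint_family_on B ?T"
    unfolding disjoint_family_on_def
  proof (intro ballI impI)
    fix s t assume st: "s \<in> ?T" "t \<in> ?T" "s \<noteq> t"
    have inn: "s \<notin> inner p" "t \<notin> inner p" if "p \<in> K" for p using pD(6)[OF that] st by auto
    have "inner p \<inter> inner q = {}" if "p \<in> K" "q \<in> K" "hd p = s" "hd q = t" for p q
      using path_family_disjoint(1)[OF GD(3) pf that(1,2)] that st(3) by auto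
    then show "B s \<inter> B t = {}" using inn st(3) unfolding B_def by auto
  qed
  moreover have "B s \<subseteq> pverts G" if "s \<in> ?T" for s
    using that setV by (auto simp: B_def inner_def)
  moreover have "s \<in> B s" for s by (simp add: B_def)
  moreover have "\<exists>w. pre_digraph.awalk (with_proj G \<restriction> B s) s w v \<and> length w \<le> r" if v: "v \<in> B s" for s v
  proof (cases "v = s")
    case True
    then show ?thesis by (intro exI[of _ "[]"]) (simp add: induced_awalk_iff B_def)
  next
    case False
    then obtain p where p: "p \<in> K" "hd p = s" "v \<in> inner p" using v by (auto simp: B_def)
    have ne: "p \<noteq> []" using pD(2)[OF p(1)] by auto
    obtain i where i: "i < length p" "p ! i = v" using p(3) by (auto simp: inner_def in_set_conv_nth)
    have il: "i < length p - 1"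
    proof -
      have "i \<noteq> length p - 1" using i p(3) ne by (auto simp: inner_def last_conv_nth)
      then show ?thesis using i(1) by simp
    qed
    have inB: "p ! j \<in> B s" if "j \<le> i" for j
    proof (cases "j = 0")
      case True
      then show ?thesis using p(2) ne by (auto simp: B_def hd_conv_nth)
    next
      case False
      have "j < length p" "0 < length p" "length p - 1 < length p" "j \<noteq> length p - 1" using that il by auto
      then have "p ! j \<noteq> p ! 0" "p ! j \<noteq> p ! (length p - 1)"
        using pD(1)[OF p(1)] False by (simp_all add: nth_eq_iff_index_eq)
      then have "p ! j \<in> inner p"
        using \<open>j < length p\<close> ne by (auto simp: inner_def hd_conv_nth last_conv_nth)
      then show ?thesis using BI p(1,2) by blast
    qed
    let ?w = "map (\<lambda>j. (p ! j, p ! Suc j)) [0..<0 + i]"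
    have "pcas (p ! 0) ?w (p ! (0 + i))" by (rule pcas_map)
    moreover have "p ! 0 = s" using p(2) ne by (simp add: hd_conv_nth)
    moreover have "set ?w \<subseteq> {e \<in> parcs G. fst e \<in> B s \<and> snd e \<in> B s}"
      using inB il pD(7)[OF p(1)] by (auto simp: successively_conv_nth)
    ultimately have "pre_digraph.awalk (with_proj G \<restriction> B s) s ?w v"
      using i(2) by (simp add: induced_awalk_iff B_def)
    moreover have "length ?w \<le> r" using il pD(3)[OF p(1)] by simp
    ultimately show ?thesis by blast
  qed
  moreover have "\<exists>u\<in>B x. \<exists>v\<in>B y. (u, v) \<in> parcs G" if xy: "(x, y) \<in> ends_rel K" for x y
  proof -
    obtain p where p: "p \<in> K" "(x, y) = (hd p, last p) \<or> (x, y) = (last p, hd p)"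
      using xy by (auto simp: ends_rel_def)
    have "last p \<in> B (last p)" by (simp add: B_def)
    then show ?thesis using p(2) penult[OF p(1)] symD[OF GD(3) penult(2)[OF p(1)]] by blast
  qed
  ultimately show ?thesis
    unfolding shallow_minor_def using H by (intro conjI exI[of _ B] exI[of _ "\<lambda>s. s"]) auto
qed

lemma bounded_expansion_imp_uniformly_sparse:
  assumes C: "\<forall>G \<in> C. pair_graph G" and be: "bounded_expansion C"
  shows "uniformly_sparse C"
  unfolding uniformly_sparse_def
proof
  fix r
  obtain b where b: "\<And>G H. G \<in> C \<Longrightarrow> shallow_minor r (H :: nat_graph) G \<Longrightarrow> average_degree H \<le> b"
    using be unfolding bounded_expansion_def by blast
  have "sparse_path_families (parcs G) r (nat \<lceil>b\<rceil>)" if G: "G \<in> C" for G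
    unfolding sparse_path_families_def
  proof (intro allI impI)
    fix S K assume S: "finite S" and pf: "path_family (parcs G) r S K"
    let ?T = "S \<inter> pverts G"
    let ?H = "\<lparr>pverts = ?T, parcs = ends_rel K\<rparr>"
    have sm: "shallow_minor r ?H G" using path_family_shallow_minor C G pf by blast
    then have H: "pair_graph ?H" by (simp add: shallow_minor_def)
    have finK: "finite K" using pf by (simp add: path_family_def)
    have "card K \<le> card (ends_rel K)"
    proof (rule card_inj_on_le)
      have "sym (parcs G)" using pair_graphD(3) C G by blast
      then show "inj_on (\<lambda>p. (hd p, last p)) K"
        using path_family_disjoint(2)[OF _ pf] by (intro inj_onI) (metis prod.inject)
      show "(\<lambda>p. (hd p, last p)) ` K \<subseteq> ends_rel K" by (auto simp: ends_rel_def)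
      show "finite (ends_rel K)" using finK by (rule finite_ends_rel)
    qed
    \<comment> \<open>If \<open>?T\<close> is empty, the average degree is 0 by convention and
      bounds nothing, but then there are no arcs.\<close>
    moreover have "card (ends_rel K) \<le> nat \<lceil>b\<rceil> * card ?T"
    proof (cases "?T = {}")
      case True
      then show ?thesis using pair_graphD(2)[OF H] by simp
    next
      case False
      then have T: "0 < card ?T" using S by (simp add: card_gt_0_iff)
      have "real (card (ends_rel K)) / real (card ?T) \<le> b"
        using b[OF G sm] average_degree_eq[OF H] by simp
      then have "real (card (ends_rel K)) \<le> b * real (card ?T)" using T by (simp add: field_simps)
      also have "\<dots> \<le> real (nat \<lceil>b\<rceil>) * real (card ?T)" by (intro mult_right_mono) linarith+
      finally have "real (card (ends_rel K)) \<le> real (nat \<lceil>b\<rceil> * card ?T)" by simp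
      then show ?thesis by (simp only: of_nat_le_iff)
    qed
    moreover have "nat \<lceil>b\<rceil> * card ?T \<le> nat \<lceil>b\<rceil> * card S" using S by (intro mult_le_mono2 card_mono) auto
    ultimately show "card K \<le> nat \<lceil>b\<rceil> * card S" by linarith
  qed
  then show "\<exists>D. \<forall>G\<in>C. sparse_path_families (parcs G) r D" by blast
qed

lemma uniformly_sparse_wreach:
  assumes C: "\<forall>G \<in> C. pair_graph G" and us: "uniformly_sparse C"
  shows "\<exists>N. \<forall>G \<in> C. \<exists>f :: nat \<Rightarrow> nat. inj_on f (pverts G) \<and>
    (\<forall>v \<in> pverts G. finite (wreach (parcs G) f r v) \<and> card (wreach (parcs G) f r v) \<le> N)"
proof -
  obtain D where D: "\<And>G. G \<in> C \<Longrightarrow> sparse_path_families (parcs G) (2 * r) D"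
    using us unfolding uniformly_sparse_def by blast
  let ?N = "(1 + Suc (2 * D) * (3 * D + 2 * r * D * D) * r) ^ r"
  have "\<exists>f :: nat \<Rightarrow> nat. inj_on f (pverts G) \<and>
    (\<forall>v \<in> pverts G. finite (wreach (parcs G) f r v) \<and> card (wreach (parcs G) f r v) \<le> ?N)"
    if G: "G \<in> C" for G
    using pair_graphD(3,2,1)[OF bspec[OF C G]] D[OF G] by (rule sparse_path_families_wreach)
  then show ?thesis by blast
qed

lemma uniformly_sparse_imp_bounded_expansion:
  assumes C: "\<forall>G \<in> C. pair_graph G" and us: "uniformly_sparse C"
  shows "bounded_expansion C"
  unfolding bounded_expansion_def
proof
  fix p
  obtain N where N: "\<And>G. G \<in> C \<Longrightarrow> \<exists>f :: nat \<Rightarrow> nat. inj_on f (pverts G) \<and>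
    (\<forall>v \<in> pverts G. finite (wreach (parcs G) f (4 * p + 1) v) \<and> card (wreach (parcs G) f (4 * p + 1) v) \<le> N)"
    using uniformly_sparse_wreach[OF C us, of "4 * p + 1"] by blast
  have "average_degree H \<le> real (2 * N)" if G: "G \<in> C" and sm: "shallow_minor p H G" for G and H :: nat_graph
  proof -
    have H: "pair_graph H" using sm by (simp add: shallow_minor_def)
    note GD = pair_graphD[OF bspec[OF C G]] and HD = pair_graphD[OF H]
    obtain f :: "nat \<Rightarrow> nat" where f: "inj_on f (pverts G)" "\<And>v. v \<in> pverts G \<Longrightarrow>
      finite (wreach (parcs G) f (4 * p + 1) v) \<and> card (wreach (parcs G) f (4 * p + 1) v) \<le> N"
      using N[OF G] by blast
    obtain B c where B: "disjoint_family_on B (pverts H)"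
      and B': "\<forall>x \<in> pverts H. B x \<subseteq> pverts G \<and> c x \<in> B x \<and>
        (\<forall>v \<in> B x. \<exists>w. pre_digraph.awalk (with_proj G \<restriction> B x) (c x) w v \<and> length w \<le> p)"
      and edge: "\<forall>(x, y) \<in> parcs H. \<exists>u \<in> B x. \<exists>v \<in> B y. (u, v) \<in> parcs G"
      using sm unfolding shallow_minor_def by blast
    have "card (parcs H) \<le> 2 * N * card (pverts H)"
    proof (rule minor_density[OF GD(3) f HD(1) B])
      fix x assume x: "x \<in> pverts H"
      show "finite (B x) \<and> B x \<subseteq> pverts G \<and> c x \<in> B x" using bspec[OF B' x] GD(1) finite_subset by auto
      fix v assume "v \<in> B x"
      then obtain w where "pre_digraph.awalk (with_proj G \<restriction> B x) (c x) w v" "length w \<le> p"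
        using bspec[OF B' x] by auto
      moreover from induced_awalk_walk[OF this(1)] obtain xs
        where "walk (parcs G) (c x) xs v" "set xs \<subseteq> B x" "length xs = Suc (length w)" by auto
      ultimately show "\<exists>xs. walk (parcs G) (c x) xs v \<and> set xs \<subseteq> B x \<and> length xs \<le> Suc p"
        by (intro exI[of _ xs]) simp
    next
      fix x y assume "(x, y) \<in> parcs H"
      then show "\<exists>u\<in>B x. \<exists>v\<in>B y. (u, v) \<in> parcs G" using edge by auto
    qed (use HD in auto)
    then have "real (card (parcs H)) \<le> real (2 * N) * real (card (pverts H))"
      by (metis of_nat_le_iff of_nat_mult)
    then show ?thesis
      unfolding average_degree_eq[OF H] by (cases "card (pverts H) = 0") (auto simp: field_simps)
  qed
  then show "\<exists>b. \<forall>G\<in>C. \<forall>H :: nat_graph. shallow_minor p H G \<longrightarrow> average_degree H \<le> b" by blast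
qed

section \<open>Homomorphisms into disjoint unions\<close>

lemma has_homE:
  assumes "has_hom G H"
  obtains f where "f ` pverts G \<subseteq> pverts H" "\<And>x y. (x, y) \<in> parcs G \<Longrightarrow> (f x, f y) \<in> parcs H"
proof -
  obtain f where "f ` pverts G \<subseteq> pverts H" "\<forall>(x, y) \<in> parcs G. (f x, f y) \<in> parcs H"
    using assms unfolding has_hom_def by blast
  then show ?thesis by (intro that[of f]) auto
qed

lemma has_hom_trans: "has_hom G H \<Longrightarrow> has_hom H I \<Longrightarrow> has_hom G I"
proof -
  assume "has_hom G H" "has_hom H I"
  then obtain f g where "f ` pverts G \<subseteq> pverts H" "\<forall>(u, v)\<in>parcs G. (f u, f v) \<in> parcs H"
    "g ` pverts H \<subseteq> pverts I" "\<forall>(u, v)\<in>parcs H. (g u, g v) \<in> parcs I" by (auto simp: has_hom_def)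
  then show ?thesis unfolding has_hom_def by (intro exI[of _ "g \<circ> f"]) fastforce
qed

text \<open>The numbering \<open>e\<close> of the index set lets the vertices stay natural numbers;
  the copies are disjoint when \<open>e\<close> is injective on \<open>I\<close>.\<close>

definition disjoint_union_graph :: "('i \<Rightarrow> nat) \<Rightarrow> 'i set \<Rightarrow> ('i \<Rightarrow> nat_graph) \<Rightarrow> nat_graph" where
  "disjoint_union_graph e I D = \<lparr>pverts = (\<Union>i\<in>I. (\<lambda>x. prod_encode (e i, x)) ` pverts (D i)),
     parcs = (\<Union>i\<in>I. (\<lambda>(x, y). (prod_encode (e i, x), prod_encode (e i, y))) ` parcs (D i))\<rparr>"

lemma pair_graph_disjoint_union:
  assumes "finite I" "\<And>i. i \<in> I \<Longrightarrow> pair_graph (D i)"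
  shows "pair_graph (disjoint_union_graph e I D)"
proof (rule pair_graphI)
  show "finite (pverts (disjoint_union_graph e I D))"
    using assms pair_graphD(1) by (auto simp: disjoint_union_graph_def)
  show "parcs (disjoint_union_graph e I D) \<subseteq> pverts (disjoint_union_graph e I D) \<times> pverts (disjoint_union_graph e I D)"
    using pair_graphD(2)[OF assms(2)] by (fastforce simp: disjoint_union_graph_def)
  show "sym (parcs (disjoint_union_graph e I D))"
    using pair_graphD(3)[OF assms(2)] by (fastforce simp: disjoint_union_graph_def sym_def)
  show "irrefl (parcs (disjoint_union_graph e I D))"
    using pair_graphD(4)[OF assms(2)] by (fastforce simp: disjoint_union_graph_def irrefl_def)
qed

lemma has_hom_disjoint_union: "i \<in> I \<Longrightarrow> has_hom (D i) (disjoint_union_graph e I D)"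
  unfolding has_hom_def disjoint_union_graph_def
  by (intro exI[of _ "\<lambda>x. prod_encode (e i, x)"]) fastforce

text \<open>The copy in which the image of a vertex lies cannot change along an arc, so
  connectedness of \<open>F\<close> confines the homomorphism to one copy.\<close>

lemma connected_hom_disjoint_union:
  fixes F :: "'a pair_pre_digraph"
  assumes F: "pair_graph F" "pverts F \<noteq> {}" "connected (with_proj F)" and e: "inj_on e I"
    and hom: "has_hom F (disjoint_union_graph e I D)"
  shows "\<exists>i\<in>I. has_hom F (D i)"
proof -
  let ?U = "disjoint_union_graph e I D"
  obtain f where f: "f ` pverts F \<subseteq> pverts ?U" "\<And>x y. (x, y) \<in> parcs F \<Longrightarrow> (f x, f y) \<in> parcs ?U"
    using hom by (rule has_homE) blast
  have arc: "\<exists>i\<in>I. \<exists>x' y'. f x = prod_encode (e i, x') \<and> f y = prod_encode (e i, y') \<and> (x', y') \<in> parcs (D i)"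
    if "(x, y) \<in> parcs F" for x y
    using f(2)[OF that] by (fastforce simp: disjoint_union_graph_def)
  let ?k = "\<lambda>x. fst (prod_decode (f x))"
  have step: "?k x = ?k y" if "(x, y) \<in> parcs F" for x y using arc[OF that] by auto
  obtain x0 where x0: "x0 \<in> pverts F" using F(2) by blast
  have const: "?k x = ?k x0" if x: "x \<in> pverts F" for x
  proof -
    interpret F: pair_graph F by fact
    have "(x0, x) \<in> rtrancl_on (pverts F) ((parcs F)\<^sup>s)"
      using F(3) x0 x by (simp add: connected_conv)
    then show ?thesis
    proof (induction rule: rtrancl_on_induct)
      case (step y z)
      then have "?k y = ?k z" using \<open>\<And>x y. (x, y) \<in> parcs F \<Longrightarrow> ?k x = ?k y\<close> by (fastforce simp: symcl_def)
      then show ?case using step by simp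
    qed simp
  qed
  obtain i where i: "i \<in> I" "f x0 \<in> (\<lambda>x. prod_encode (e i, x)) ` pverts (D i)"
    using f(1) x0 by (auto simp: disjoint_union_graph_def)
  then have k0: "?k x0 = e i" by auto
  have "has_hom F (D i)"
    unfolding has_hom_def
  proof (intro exI[of _ "\<lambda>x. snd (prod_decode (f x))"] conjI, safe)
    fix x assume x: "x \<in> pverts F"
    then obtain j x' where j: "j \<in> I" "x' \<in> pverts (D j)" "f x = prod_encode (e j, x')"
      using f(1) by (auto simp: disjoint_union_graph_def)
    have "e j = ?k x" using j(3) by simp
    then have "e j = e i" using const[OF x] k0 by simp
    then have "j = i" using e i(1) j(1) by (auto dest: inj_onD)
    then show "snd (prod_decode (f x)) \<in> pverts (D i)" using j by simp
  next
    fix x y assume xy: "(x, y) \<in> parcs F"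
    then obtain j x' y' where j: "j \<in> I" "f x = prod_encode (e j, x')" "f y = prod_encode (e j, y')" "(x', y') \<in> parcs (D j)"
      using arc by blast
    have "x \<in> pverts F" using pair_graphD(2)[OF F(1)] xy by auto
    then have "?k x = e i" using const k0 by simp
    then have "e j = e i" using j(2) by simp
    then have "j = i" using e i(1) j(1) by (auto dest: inj_onD)
    then show "(snd (prod_decode (f x)), snd (prod_decode (f y))) \<in> parcs (D i)" using j by simp
  qed
  then show ?thesis using i(1) by blast
qed

section \<open>Small targets and duals\<close>

lemma uniformly_sparse_centred:
  assumes C: "\<forall>G \<in> C. pair_graph G" and us: "uniformly_sparse C"
  shows "\<exists>N. \<forall>G \<in> C. \<exists>c. c ` pverts G \<subseteq> {..N} \<and> centred (parcs G) (pverts G) p c"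
proof -
  obtain N where N: "\<And>G. G \<in> C \<Longrightarrow> \<exists>f :: nat \<Rightarrow> nat. inj_on f (pverts G) \<and>
    (\<forall>v \<in> pverts G. finite (wreach (parcs G) f (2 ^ p) v) \<and> card (wreach (parcs G) f (2 ^ p) v) \<le> N)"
    using uniformly_sparse_wreach[OF C us, of "2 ^ p"] by blast
  have "\<exists>c. c ` pverts G \<subseteq> {..N} \<and> centred (parcs G) (pverts G) p c" if G: "G \<in> C" for G
  proof -
    note GD = pair_graphD[OF bspec[OF C G]]
    obtain f :: "nat \<Rightarrow> nat" where f: "inj_on f (pverts G)" "\<And>v. v \<in> pverts G \<Longrightarrow>
      finite (wreach (parcs G) f (2 ^ p) v) \<and> card (wreach (parcs G) f (2 ^ p) v) \<le> N"
      using N[OF G] by blast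
    show ?thesis by (rule centred_coloring_exists[OF GD(3,2,1) f])
  qed
  then show ?thesis by blast
qed

text \<open>For \<open>p\<close> the order of \<open>F\<close>, a homomorphism from \<open>F\<close>
  to the quotient yields one to \<open>G\<close>; and \<open>\<phi>\<close> separates adjacent
  vertices, which keeps the quotient loopless. \<open>Q\<close> comes from \<open>p\<close> and the
  colour bound, before \<open>G\<close> is given.\<close>

lemma uniformly_sparse_small_target:
  assumes C: "\<forall>G \<in> C. pair_graph G" and us: "uniformly_sparse C"
    and F: "pair_graph (F :: nat_graph)" "pverts F \<noteq> {}"
  shows "\<exists>Q. \<forall>G \<in> C. \<not> has_hom F G \<longrightarrow>
    (\<exists>D :: nat_graph. pair_graph D \<and> pverts D \<subseteq> {..<Q} \<and> \<not> has_hom F D \<and> has_hom G D)"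
proof -
  define p where "p = card (pverts F)"
  note FD = pair_graphD[OF F(1)]
  have p: "1 \<le> p" using F(2) FD(1) by (simp add: p_def Suc_le_eq card_gt_0_iff)
  obtain N where N: "\<And>G. G \<in> C \<Longrightarrow> \<exists>c. c ` pverts G \<subseteq> {..N} \<and> centred (parcs G) (pverts G) p c"
    using uniformly_sparse_centred[OF C us, of p] by blast
  obtain Q where Q: "\<forall>(E :: (nat \<times> nat) set) V c. sym E \<longrightarrow> finite V \<longrightarrow> c ` V \<subseteq> {..N} \<longrightarrow> centred E V p c \<longrightarrow>
    (\<exists>\<phi>. \<phi> ` V \<subseteq> {..<Q :: nat} \<and> (\<forall>u\<in>V. \<forall>v\<in>V. (u, v) \<in> E \<longrightarrow> u \<noteq> v \<longrightarrow> \<phi> u \<noteq> \<phi> v) \<and>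
      reflects E V p \<phi>)"
    using centred_quotient[OF p, where 'a = nat, of N] by (elim exE)
  have "\<exists>D :: nat_graph. pair_graph D \<and> pverts D \<subseteq> {..<Q} \<and> \<not> has_hom F D \<and> has_hom G D"
    if G: "G \<in> C" and no: "\<not> has_hom F G" for G
  proof -
    note GD = pair_graphD[OF bspec[OF C G]]
    obtain c where c: "c ` pverts G \<subseteq> {..N}" "centred (parcs G) (pverts G) p c" using N[OF G] by blast
    obtain \<phi> where \<phi>: "\<phi> ` pverts G \<subseteq> {..<Q}"
      "\<forall>u\<in>pverts G. \<forall>v\<in>pverts G. (u, v) \<in> parcs G \<longrightarrow> u \<noteq> v \<longrightarrow> \<phi> u \<noteq> \<phi> v"
      and lift: "reflects (parcs G) (pverts G) p \<phi>"
      using Q[rule_format, OF GD(3,1) c] by (elim exE conjE)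
    define D where "D = \<lparr>pverts = \<phi> ` pverts G, parcs = (\<lambda>(u, v). (\<phi> u, \<phi> v)) ` parcs G\<rparr>"
    have "pair_graph D"
    proof (rule pair_graphI)
      show "finite (pverts D)" using GD(1) by (simp add: D_def)
      show "parcs D \<subseteq> pverts D \<times> pverts D" using GD(2) by (auto simp: D_def)
      show "sym (parcs D)" using GD(3) by (fastforce simp: D_def sym_def)
      show "irrefl (parcs D)" using \<phi>(2) GD(2,4) by (fastforce simp: D_def irrefl_def)
    qed
    moreover have "pverts D \<subseteq> {..<Q}" using \<phi>(1) by (simp add: D_def)
    moreover have "has_hom G D" unfolding has_hom_def D_def by (intro exI[of _ \<phi>]) auto
    moreover have "\<not> has_hom F D"
    proof
      assume "has_hom F D"
      then obtain \<psi> where \<psi>: "\<psi> ` pverts F \<subseteq> \<phi> ` pverts G"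
        "\<And>x y. (x, y) \<in> parcs F \<Longrightarrow> (\<psi> x, \<psi> y) \<in> (\<lambda>(u, v). (\<phi> u, \<phi> v)) ` parcs G"
        by (rule has_homE) (auto simp: D_def)
      have "\<forall>x y. (x, y) \<in> parcs F \<longrightarrow> x \<in> pverts F \<and> y \<in> pverts F \<and>
          (\<exists>u\<in>pverts G. \<exists>v\<in>pverts G. (u, v) \<in> parcs G \<and> \<phi> u = \<psi> x \<and> \<phi> v = \<psi> y)"
      proof (intro allI impI)
        fix x y assume xy: "(x, y) \<in> parcs F"
        then obtain u v where "(u, v) \<in> parcs G" "\<psi> x = \<phi> u" "\<psi> y = \<phi> v" using \<psi>(2)[OF xy] by auto
        moreover from this have "u \<in> pverts G" "v \<in> pverts G" using GD(2) by auto
        ultimately show "x \<in> pverts F \<and> y \<in> pverts F \<and>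
          (\<exists>u\<in>pverts G. \<exists>v\<in>pverts G. (u, v) \<in> parcs G \<and> \<phi> u = \<psi> x \<and> \<phi> v = \<psi> y)"
          using xy FD(2) by auto
      qed
      then obtain \<chi> where "\<chi> ` pverts F \<subseteq> pverts G" "\<forall>x y. (x, y) \<in> parcs F \<longrightarrow> (\<chi> x, \<chi> y) \<in> parcs G"
        using lift[unfolded reflects_def, rule_format, OF FD(1) _ \<psi>(1), of "parcs F"] unfolding p_def by blast
      then have "has_hom F G" unfolding has_hom_def by (intro exI[of _ \<chi>]) auto
      then show False using no by blast
    qed
    ultimately show ?thesis by blast
  qed
  then show ?thesis by blast
qed

lemma uniformly_sparse_imp_dualities:
  assumes C: "\<forall>G \<in> C. pair_graph G" and us: "uniformly_sparse C"
  shows "all_restricted_dualities C"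
  unfolding all_restricted_dualities_def
proof (intro allI impI, elim conjE)
  fix F :: nat_graph assume F: "pair_graph F" "pverts F \<noteq> {}" "connected (with_proj F)"
  obtain Q where Q: "\<And>G. G \<in> C \<Longrightarrow> \<not> has_hom F G \<Longrightarrow>
    \<exists>D :: nat_graph. pair_graph D \<and> pverts D \<subseteq> {..<Q} \<and> \<not> has_hom F D \<and> has_hom G D"
    using uniformly_sparse_small_target[OF C us F(1,2)] by blast
  \<comment> \<open>Naming the vertices by numbers below \<open>Q\<close> makes this set finite, and
    it does not depend on \<open>G\<close>.\<close>
  define I where "I = {D :: nat_graph. pair_graph D \<and> pverts D \<subseteq> {..<Q} \<and> \<not> has_hom F D}"
  have "finite I"
  proof (rule finite_imageD)
    show "finite ((\<lambda>D. (pverts D, parcs D)) ` I)"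
    proof (rule finite_subset)
      show "(\<lambda>D. (pverts D, parcs D)) ` I \<subseteq> Pow {..<Q} \<times> Pow ({..<Q} \<times> {..<Q})"
        using pair_graphD(2) by (fastforce simp: I_def)
    qed simp
    show "inj_on (\<lambda>D. (pverts D, parcs D)) I" by (auto intro!: inj_onI)
  qed
  from finite_imp_inj_to_nat_seg[OF this] obtain e :: "nat_graph \<Rightarrow> nat" where e: "inj_on e I"
    by (elim exE conjE)
  let ?D = "disjoint_union_graph e I (\<lambda>D. D)"
  have "pair_graph ?D" using \<open>finite I\<close> by (rule pair_graph_disjoint_union) (simp add: I_def)
  moreover have noF: "\<not> has_hom F ?D"
    using connected_hom_disjoint_union[OF F e, of "\<lambda>D. D"] by (auto simp: I_def)
  moreover have "has_hom F G \<longleftrightarrow> \<not> has_hom G ?D" if G: "G \<in> C" for G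
  proof
    assume "has_hom F G"
    then show "\<not> has_hom G ?D" using noF has_hom_trans by blast
  next
    assume "\<not> has_hom G ?D"
    show "has_hom F G"
    proof (rule ccontr)
      assume "\<not> has_hom F G"
      then obtain D where "D \<in> I" "has_hom G D" using Q[OF G] by (auto simp: I_def)
      then have "has_hom G ?D" using has_hom_trans[OF _ has_hom_disjoint_union[of D I "\<lambda>D. D" e]] by blast
      then show False using \<open>\<not> has_hom G ?D\<close> by blast
    qed
  qed
  ultimately show "\<exists>D :: nat_graph. pair_graph D \<and> \<not> has_hom F D \<and> (\<forall>G\<in>C. has_hom F G \<longleftrightarrow> \<not> has_hom G D)"
    by blast
qed

section \<open>Odd cycles as test graphs\<close>

text \<open>For \<open>g = 1\<close> this is a loop, hence no simple graph.\<close>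

definition cycle_graph :: "nat \<Rightarrow> nat_graph" where
  "cycle_graph g = \<lparr>pverts = {..<g}, parcs = {(i, j). i < g \<and> j < g \<and> (j = Suc i mod g \<or> i = Suc j mod g)}\<rparr>"

lemma pair_graph_cycle_graph: "2 \<le> g \<Longrightarrow> pair_graph (cycle_graph g)"
  by (rule pair_graphI) (auto simp: cycle_graph_def sym_def irrefl_def mod_Suc split: if_splits)

lemma connected_cycle_graph:
  assumes "2 \<le> g"
  shows "connected (with_proj (cycle_graph g))"
proof -
  let ?V = "pverts (cycle_graph g)" and ?R = "parcs (cycle_graph g)"
  interpret pair_graph "cycle_graph g" by (rule pair_graph_cycle_graph[OF assms])
  have from0: "(0, i) \<in> rtrancl_on ?V (?R\<^sup>s) \<and> (i, 0) \<in> rtrancl_on ?V (?R\<^sup>s)" if "i < g" for i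
    using that
  proof (induction i)
    case 0
    then show ?case by (auto simp: cycle_graph_def)
  next
    case (Suc i)
    then have IH: "(0, i) \<in> rtrancl_on ?V (?R\<^sup>s)" "(i, 0) \<in> rtrancl_on ?V (?R\<^sup>s)" by auto
    have "(i, Suc i) \<in> ?R\<^sup>s" "(Suc i, i) \<in> ?R\<^sup>s" "Suc i \<in> ?V"
      using Suc.prems by (auto simp: cycle_graph_def symcl_def)
    then show ?case
      using rtrancl_on_into_rtrancl_on[OF IH(1)] converse_rtrancl_on_into_rtrancl_on[OF _ IH(2)] by blast
  qed
  have "0 \<in> ?V" using assms by (simp add: cycle_graph_def)
  then have "?V \<noteq> {}" by blast
  moreover have "(u, v) \<in> rtrancl_on ?V (?R\<^sup>s)" if "u \<in> ?V" "v \<in> ?V" for u v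
    using from0[of u] from0[of v] that rtrancl_on_trans by (fastforce simp: cycle_graph_def)
  ultimately show ?thesis by (simp add: connected_conv)
qed

lemma has_hom_cycle_graph_iff:
  assumes "1 \<le> g" "pair_graph G"
  shows "has_hom (cycle_graph g) G \<longleftrightarrow> (\<exists>x. (x, x) \<in> parcs G ^^ g)"
proof
  assume "has_hom (cycle_graph g) G"
  then obtain f where f: "\<And>i j. (i, j) \<in> parcs (cycle_graph g) \<Longrightarrow> (f i, f j) \<in> parcs G"
    by (rule has_homE) blast
  have "(f (i mod g), f (Suc i mod g)) \<in> parcs G" for i
    using assms(1) by (intro f) (auto simp: cycle_graph_def mod_Suc_eq)
  then have "\<forall>i<g. (f (i mod g), f (Suc i mod g)) \<in> parcs G" by blast
  then have "(f 0, f 0) \<in> parcs G ^^ g"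
    unfolding relpow_fun_conv by (intro exI[of _ "\<lambda>i. f (i mod g)"]) (simp del: mod_less)
  then show "\<exists>x. (x, x) \<in> parcs G ^^ g" by blast
next
  assume "\<exists>x. (x, x) \<in> parcs G ^^ g"
  then obtain h where h: "h 0 = h g" "\<And>i. i < g \<Longrightarrow> (h i, h (Suc i)) \<in> parcs G"
    unfolding relpow_fun_conv by metis
  note GD = pair_graphD[OF assms(2)]
  have step: "(h i, h (Suc i mod g)) \<in> parcs G" if "i < g" for i
    using h(2)[OF that] h(1) that by (cases "Suc i = g") auto
  show "has_hom (cycle_graph g) G"
    unfolding has_hom_def
  proof (intro exI[of _ h] conjI)
    show "h ` pverts (cycle_graph g) \<subseteq> pverts G"
      using h(2) GD(2) by (fastforce simp: cycle_graph_def)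
    show "\<forall>(u, v)\<in>parcs (cycle_graph g). (h u, h v) \<in> parcs G"
      using step symD[OF GD(3)] by (auto simp: cycle_graph_def)
  qed
qed

text \<open>A shorter odd cycle is prolonged to a closed walk of length exactly \<open>g\<close> by
  going back and forth; conversely, a closed walk of odd length contains an odd cycle that is no
  longer.\<close>

lemma odd_girth_greater_iff_hom:
  assumes "odd g" "pair_graph G"
  shows "odd_girth G > enat g \<longleftrightarrow> \<not> has_hom (cycle_graph g) G"
proof -
  interpret pair_graph G by fact
  have g: "1 \<le> g" using assms(1) by (cases g) auto
  show ?thesis
    unfolding has_hom_cycle_graph_iff[OF g assms(2)]
  proof
    assume "odd_girth G > enat g"
    then show "\<nexists>x. (x, x) \<in> parcs G ^^ g"
      using odd_girth_greaterD[OF pair_wf_digraph _ _ assms(1)] by blast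
  next
    assume no: "\<nexists>x. (x, x) \<in> parcs G ^^ g"
    show "odd_girth G > enat g"
      unfolding odd_girth_greater_iff
    proof (intro allI impI, rule ccontr)
      fix w assume w: "pre_digraph.cycle (with_proj G) w" "odd (length w)" "\<not> g < length w"
      obtain x where x: "(x, x) \<in> parcs G ^^ length w" "w \<noteq> []" using cycle_relpow[OF w(1)] by blast
      have "1 \<le> length w" using x(2) by (simp add: Suc_le_eq)
      moreover have "length w \<le> g" "even (g - length w)" using w(2,3) assms(1) by simp_all
      ultimately have "(x, x) \<in> parcs G ^^ g"
        by (rule closed_relpow_extend[OF pair_graphD(3)[OF assms(2)] x(1)])
      then show False using no by blast
    qed
  qed
qed

theorem theorem8:
  fixes C :: "nat_graph set"
  assumes "\<forall>G \<in> C. pair_graph G"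
    and "topologically_closed C"
  shows "(bounded_expansion C \<longleftrightarrow> all_restricted_dualities C) \<and>
         (all_restricted_dualities C \<longleftrightarrow>
            (\<forall>g :: nat. odd g \<longrightarrow>
               (\<exists>H :: nat_graph. pair_graph H \<and> odd_girth H > enat g \<and>
                  (\<forall>G \<in> C. odd_girth G > enat g \<longrightarrow> has_hom G H))))"
proof -
  let ?bound = "\<lambda>g. \<exists>H :: nat_graph. pair_graph H \<and> odd_girth H > enat g \<and>
    (\<forall>G \<in> C. odd_girth G > enat g \<longrightarrow> has_hom G H)"
  \<comment> \<open>Only \<open>3 \<le> g\<close> is assumed, so that dualities, which apply to
    loopless cycles, can supply the bounds.\<close>
  have sparse: "uniformly_sparse C" if bound: "\<And>g. odd g \<Longrightarrow> 3 \<le> g \<Longrightarrow> ?bound g"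
    unfolding uniformly_sparse_def
  proof
    fix r :: nat
    define a where "a = max r 2"
    have a: "r \<le> a" "2 \<le> a" by (auto simp: a_def)
    then obtain H :: nat_graph where H: "pair_graph H" "odd_girth H > enat (2 * a + 1)"
      "\<And>G. G \<in> C \<Longrightarrow> odd_girth G > enat (2 * a + 1) \<Longrightarrow> has_hom G H"
      using bound[of "2 * a + 1"] by auto
    then have "\<forall>G\<in>C. sparse_path_families (parcs G) r (card (pverts H))"
      using hom_bound_sparse_path_families[OF assms a] by blast
    then show "\<exists>D. \<forall>G\<in>C. sparse_path_families (parcs G) r D" by blast
  qed
  \<comment> \<open>The dual of the cycle of length \<open>g\<close> serves as \<open>H\<close>:
    odd-girth greater than \<open>g\<close> means that this cycle has no homomorphism to the graph,
    both for the dual and for the members of \<open>C\<close>.\<close>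
  have bound: "?bound g" if d: "all_restricted_dualities C" and g: "odd g" "3 \<le> g" for g
  proof -
    have "pair_graph (cycle_graph g)" "pverts (cycle_graph g) \<noteq> {}" "connected (with_proj (cycle_graph g))"
      using g(2) pair_graph_cycle_graph[of g] connected_cycle_graph[of g]
      by (auto simp: cycle_graph_def lessThan_empty_iff)
    then obtain D :: nat_graph where D: "pair_graph D" "\<not> has_hom (cycle_graph g) D"
      "\<forall>G\<in>C. has_hom (cycle_graph g) G \<longleftrightarrow> \<not> has_hom G D"
      using d unfolding all_restricted_dualities_def by blast
    then show ?thesis
      using odd_girth_greater_iff_hom[OF g(1)] assms(1) by (intro exI[of _ D]) auto
  qed
  \<comment> \<open>Simple graphs have odd-girth greater than 1, so a bounded chromatic number is
    wanted: a centred colouring for \<open>p = 1\<close> is proper, and \<open>H\<close> is complete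
    on the colours.\<close>
  have bound1: "?bound 1" if us: "uniformly_sparse C"
  proof -
    obtain N where N: "\<And>G. G \<in> C \<Longrightarrow> \<exists>c. c ` pverts G \<subseteq> {..N :: nat} \<and> centred (parcs G) (pverts G) 1 c"
      using uniformly_sparse_centred[OF assms(1) us, of 1] by blast
    define H where "H = \<lparr>pverts = {..N}, parcs = {(i, j). i \<le> N \<and> j \<le> N \<and> i \<noteq> j}\<rparr>"
    have H: "pair_graph H" by (rule pair_graphI) (auto simp: H_def sym_def irrefl_def)
    have "\<not> has_hom (cycle_graph 1) H"
      unfolding has_hom_cycle_graph_iff[OF order_refl H] by (auto simp: H_def)
    then have "odd_girth H > enat 1" using odd_girth_greater_iff_hom[OF _ H, of 1] by simp
    moreover have "has_hom G H" if G: "G \<in> C" for G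
    proof -
      note GD = pair_graphD[OF bspec[OF assms(1) G]]
      obtain c where c: "c ` pverts G \<subseteq> {..N}" "centred (parcs G) (pverts G) 1 c" using N[OF G] by blast
      have "(c u, c v) \<in> parcs H" if uv: "(u, v) \<in> parcs G" for u v
      proof -
        have "u \<in> pverts G" "v \<in> pverts G" "u \<noteq> v" using uv GD(2,4) by (auto simp: irrefl_def)
        then show ?thesis
          using centred_proper[OF GD(3) c(2) order_refl _ _ uv] c(1) by (auto simp: H_def)
      qed
      then show ?thesis using c(1) unfolding has_hom_def by (intro exI[of _ c]) (auto simp: H_def)
    qed
    ultimately show ?thesis using H by blast
  qed
  have 12: "bounded_expansion C \<Longrightarrow> all_restricted_dualities C"
    using bounded_expansion_imp_uniformly_sparse uniformly_sparse_imp_dualities assms(1) by blast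
  have us: "uniformly_sparse C" if "all_restricted_dualities C"
    using sparse bound[OF that] by blast
  have 21: "all_restricted_dualities C \<Longrightarrow> bounded_expansion C"
    using us uniformly_sparse_imp_bounded_expansion assms(1) by blast
  have 23: "?bound g" if "all_restricted_dualities C" "odd g" for g
  proof (cases "g = 1")
    case True
    then show ?thesis using bound1[OF us[OF that(1)]] by simp
  next
    case False
    moreover have "g \<noteq> 0" "g \<noteq> 2" using that(2) by (auto intro: odd_pos)
    ultimately have "3 \<le> g" by linarith
    then show ?thesis using bound that by blast
  qed
  have 32: "all_restricted_dualities C" if "\<forall>g. odd g \<longrightarrow> ?bound g"
    using sparse that uniformly_sparse_imp_dualities[OF assms(1)] by blast
  show ?thesis using 12 21 23 32 by blast
qed

end
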